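(* Let $d\ge 2$ be an integer and let $\mathcal F$ be a first-order structure with universe $F$ that expands either an ordered field or a field with more than two elements. Let $\mathcal G$ and $\mathcal G'$ be finite-relational, parameter-free $\mathcal F$-definable coordinate geometries on the same domain $F^d$. Assume that $\mathcal G'$ is semilinearly faithful over $\mathcal F$. Then $$\mathrm{Conc}(\mathcal G)\subseteq \mathrm{Conc}(\mathcal G')\iff \mathrm{AffAut}(\mathcal G')\subseteq \mathrm{AffAut}(\mathcal G).$$
   Context: All definability is parameter-free (without parameters). $\mathcal F$ is a first-order structure whose language contains that of ordered fields $\{+,\cdot,0,1,<\}$ (ordered-field case) or of fields $\{+,\cdot,0,1\}$ (field case), possibly with further predicate, function and constant symbols, and whose corresponding reduct is an ordered field, respectively a field with more than two elements. $(F^d)^n$ is identified with $F^{dn}$; a relation on $F^d$ is $\mathcal F$-definable if the corresponding relation on $F$ is. Key relation $\mathsf K$: in the ordered-field case, $\mathsf K=\mathsf{Bw}$ (betweenness): $\mathsf{Bw}(a,b,c)\iff\exists t\,(0\le t\le 1\wedge b=(1-t)a+tc)$; in the field case, $\mathsf K=\mathsf{Col}$ (collinearity): $\mathsf{Col}(a,b,c)\iff a=b\vee b=c\vee a=c\vee\exists t\,(b=(1-t)a+tc)$, with $a,b,c\in F^d$, $t\in F$. A finite-relational, parameter-free $\mathcal F$-definable coordinate geometry on $F^d$ is a structure $\mathcal G=\langle F^d;\mathsf K,P_1,\dots,P_k\rangle$ in the finite relational language $L_{\mathcal G}=\{\mathsf K,P_1,\dots,P_k\}$, where each $P_i\subseteq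 (F^d)^{n_i}$ is parameter-free $\mathcal F$-definable. ($\mathcal G$ and $\mathcal G'$ may have different lists of primitives $P_i$, but both include $\mathsf K$.) $\mathrm{Conc}(\mathcal G)$ (the concepts of $\mathcal G$) is the set of all relations on $F^d$, of any finite arity $n\ge1$, definable in $\mathcal G$ by a parameter-free $L_{\mathcal G}$-formula. $\mathrm{Aff}(F^d)$ is the group of maps $x\mapsto Ax+b$ with $A\in \mathrm{GL}_d(F)$, $b\in F^d$; $\mathrm{AffAut}(\mathcal G)=\mathrm{Aut}(\mathcal G)\cap\mathrm{Aff}(F^d)$. For an ultrafilter $U$ on a set $I$, $\mathcal F^U$ is the ultrapower, with universe $F^U$, and $\mathcal G(\mathcal F^U)=\langle (F^U)^d;\mathsf K^U,P_1^U,\dots,P_k^U\rangle$, where $\mathsf K^U$ is $\mathsf{Bw}$ (resp. $\mathsf{Col}$) on $(F^U)^d$ and $P_i^U$ is defined in $\mathcal F^U$ by the same formula that defines $P_i$ in $\mathcal F$. $\mathrm{AffAut}(\mathcal G(\mathcal F^U))$ is the group of automorphisms of $\mathcal G(\mathcal F^U)$ that are affine over the field $F^U$. A geometry $\mathcal G$ is semilinearly faithful over $\mathcal F$ if for every ultrafilter $U$ (on any set) and every $\alpha\in\mathrm{Aut}(\mathcal G(\mathcal F^U))$ there exist $A\in\mathrm{AffAut}(\mathcal G(\mathcal F^U))$ and $\sigma\in\mathrm{Aut}(\mathcal F^U)$ (an automorphism of the full expanded structure) such that $\alpha=A\circ\widetilde\sigma$, where $\widetilde\sigma(x_1,\dots,x_d)=(\sigma(x_1),\dots,\sigma(x_d))$.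 *)

theory Defs
  imports "HOL-Algebra.Ring" "HOL-Algebra.Bij"
begin

section \<open>First-order languages, formulas and structures\<close>

datatype 'f tm = Var nat | Fn 'f "'f tm list"

datatype ('f, 'p) fm =
    Equal "'f tm" "'f tm"
  | Rel 'p "'f tm list"
  | Neg "('f, 'p) fm"
  | Conj "('f, 'p) fm" "('f, 'p) fm"
  | Exists nat "('f, 'p) fm"

text \<open>Constant symbols are function symbols of arity 0.\<close>

record ('f, 'p) lang =
  fsyms :: "'f set"
  farity :: "'f \<Rightarrow> nat"
  psyms :: "'p set"
  parity :: "'p \<Rightarrow> nat"

record ('f, 'p, 'u) fostruct =
  univ :: "'u set"
  fint :: "'f \<Rightarrow> 'u list \<Rightarrow> 'u"
  pint :: "'p \<Rightarrow> 'u list set"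

definition tuples :: "nat \<Rightarrow> 'u set \<Rightarrow> 'u list set" where
  "tuples n A = {xs. length xs = n \<and> set xs \<subseteq> A}"

definition is_structure :: "('f, 'p) lang \<Rightarrow> ('f, 'p, 'u) fostruct \<Rightarrow> bool" where
  "is_structure L M \<longleftrightarrow>
     univ M \<noteq> {} \<and>
     (\<forall>f\<in>fsyms L. \<forall>xs\<in>tuples (farity L f) (univ M). fint M f xs \<in> univ M) \<and>
     (\<forall>p\<in>psyms L. pint M p \<subseteq> tuples (parity L p) (univ M))"

primrec wf_tm :: "('f, 'p) lang \<Rightarrow> 'f tm \<Rightarrow> bool" where
  "wf_tm L (Var n) \<longleftrightarrow> True"
| "wf_tm L (Fn f ts) \<longleftrightarrow>
     f \<in> fsyms L \<and> length ts = farity L f \<and> list_all (wf_tm L) ts"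

primrec wf_fm :: "('f, 'p) lang \<Rightarrow> ('f, 'p) fm \<Rightarrow> bool" where
  "wf_fm L (Equal s t) \<longleftrightarrow> wf_tm L s \<and> wf_tm L t"
| "wf_fm L (Rel p ts) \<longleftrightarrow>
     p \<in> psyms L \<and> length ts = parity L p \<and> list_all (wf_tm L) ts"
| "wf_fm L (Neg \<phi>) \<longleftrightarrow> wf_fm L \<phi>"
| "wf_fm L (Conj \<phi> \<psi>) \<longleftrightarrow> wf_fm L \<phi> \<and> wf_fm L \<psi>"
| "wf_fm L (Exists n \<phi>) \<longleftrightarrow> wf_fm L \<phi>"

primrec fv_tm :: "'f tm \<Rightarrow> nat set" where
  "fv_tm (Var n) = {n}"
| "fv_tm (Fn f ts) = \<Union> (set (map fv_tm ts))"

primrec fv :: "('f, 'p) fm \<Rightarrow> nat set" where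
  "fv (Equal s t) = fv_tm s \<union> fv_tm t"
| "fv (Rel p ts) = \<Union> (set (map fv_tm ts))"
| "fv (Neg \<phi>) = fv \<phi>"
| "fv (Conj \<phi> \<psi>) = fv \<phi> \<union> fv \<psi>"
| "fv (Exists n \<phi>) = fv \<phi> - {n}"

primrec val :: "('f, 'p, 'u) fostruct \<Rightarrow> (nat \<Rightarrow> 'u) \<Rightarrow> 'f tm \<Rightarrow> 'u" where
  "val M e (Var n) = e n"
| "val M e (Fn f ts) = fint M f (map (val M e) ts)"

primrec sat :: "('f, 'p, 'u) fostruct \<Rightarrow> (nat \<Rightarrow> 'u) \<Rightarrow> ('f, 'p) fm \<Rightarrow> bool" where
  "sat M e (Equal s t) \<longleftrightarrow> val M e s = val M e t"
| "sat M e (Rel p ts) \<longleftrightarrow> map (val M e) ts \<in> pint M p"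
| "sat M e (Neg \<phi>) \<longleftrightarrow> \<not> sat M e \<phi>"
| "sat M e (Conj \<phi> \<psi>) \<longleftrightarrow> sat M e \<phi> \<and> sat M e \<psi>"
| "sat M e (Exists n \<phi>) \<longleftrightarrow> (\<exists>x\<in>univ M. sat M (e(n := x)) \<phi>)"

text \<open>
  \<open>is_formula L n \<phi>\<close>: an \<open>L\<close>-formula whose free variables are among the first \<open>n\<close>.
  The \<open>n\<close>-ary relation it defines is obtained by assigning to variable \<open>i\<close> the \<open>i\<close>-th
  entry of a tuple; the values of \<open>nth xs\<close> beyond \<open>length xs\<close> are then irrelevant.
\<close>

definition is_formula :: "('f, 'p) lang \<Rightarrow> nat \<Rightarrow> ('f, 'p) fm \<Rightarrow> bool" where
  "is_formula L n \<phi> \<longleftrightarrow> wf_fm L \<phi> \<and> fv \<phi> \<subseteq> {..<n}"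

definition defined_rel :: "('f, 'p, 'u) fostruct \<Rightarrow> nat \<Rightarrow> ('f, 'p) fm \<Rightarrow> 'u list set" where
  "defined_rel M n \<phi> = {xs \<in> tuples n (univ M). sat M (nth xs) \<phi>}"

definition definable ::
    "('f, 'p) lang \<Rightarrow> ('f, 'p, 'u) fostruct \<Rightarrow> nat \<Rightarrow> 'u list set \<Rightarrow> bool" where
  "definable L M n R \<longleftrightarrow> (\<exists>\<phi>. is_formula L n \<phi> \<and> R = defined_rel M n \<phi>)"

text \<open>As usual in \<^theory>\<open>HOL-Algebra.Bij\<close>, maps are extensional on the universe.\<close>

definition Aut :: "('f, 'p) lang \<Rightarrow> ('f, 'p, 'u) fostruct \<Rightarrow> ('u \<Rightarrow> 'u) set" where
  "Aut L M = {\<alpha> \<in> Bij (univ M).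
     (\<forall>f\<in>fsyms L. \<forall>xs\<in>tuples (farity L f) (univ M).
        \<alpha> (fint M f xs) = fint M f (map \<alpha> xs)) \<and>
     (\<forall>p\<in>psyms L. \<forall>xs\<in>tuples (parity L p) (univ M).
        xs \<in> pint M p \<longleftrightarrow> map \<alpha> xs \<in> pint M p)}"


section \<open>Ultrapowers\<close>

definition is_ultrafilter :: "'i filter \<Rightarrow> bool" where
  "is_ultrafilter U \<longleftrightarrow>
     U \<noteq> bot \<and> (\<forall>P. eventually P U \<or> eventually (\<lambda>i. \<not> P i) U)"

definition ult_eq :: "'i filter \<Rightarrow> 'u set \<Rightarrow> (('i \<Rightarrow> 'u) \<times> ('i \<Rightarrow> 'u)) set" where
  "ult_eq U A = {(g, h). g \<in> UNIV \<rightarrow> A \<and> h \<in> UNIV \<rightarrow> A \<and> eventually (\<lambda>i. g i = h i) U}"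

definition ult_class :: "'i filter \<Rightarrow> 'u set \<Rightarrow> ('i \<Rightarrow> 'u) \<Rightarrow> ('i \<Rightarrow> 'u) set" where
  "ult_class U A g = ult_eq U A `` {g}"

text \<open>
  Function symbols are interpreted without choosing representatives: the value at the
  classes of \<open>hs\<close> consists of all \<open>g\<close> that agree \<open>U\<close>-almost everywhere with the pointwise
  value at \<open>hs\<close>.
\<close>

definition ultrapower ::
    "'i filter \<Rightarrow> ('f, 'p, 'u) fostruct \<Rightarrow> ('f, 'p, ('i \<Rightarrow> 'u) set) fostruct" where
  "ultrapower U M = \<lparr>
     univ = (UNIV \<rightarrow> univ M) // ult_eq U (univ M),
     fint = (\<lambda>f xs. {g \<in> UNIV \<rightarrow> univ M.
       \<exists>hs. set hs \<subseteq> (UNIV \<rightarrow> univ M) \<and> xs = map (ult_class U (univ M)) hs \<and>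
            eventually (\<lambda>i. g i = fint M f (map (\<lambda>h. h i) hs)) U}),
     pint = (\<lambda>p. {map (ult_class U (univ M)) hs | hs.
       set hs \<subseteq> (UNIV \<rightarrow> univ M) \<and> eventually (\<lambda>i. map (\<lambda>h. h i) hs \<in> pint M p) U}) \<rparr>"


section \<open>Expansions of fields and of ordered fields\<close>

datatype 'f fsym = Plus | Times | Zero | One | Extra_Fun 'f
datatype 'p psym = Less | Extra_Pred 'p

datatype field_kind = Ordered_Field | Plain_Field

definition field_reduct :: "('f fsym, 'p, 'u) fostruct \<Rightarrow> 'u ring" where
  "field_reduct M = \<lparr>
     carrier = univ M,
     monoid.mult = (\<lambda>x y. fint M Times [x, y]),
     one = fint M One [],
     zero = fint M Zero [],
     add = (\<lambda>x y. fint M Plus [x, y]) \<rparr>"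

definition lt :: "('f, 'p psym, 'u) fostruct \<Rightarrow> 'u \<Rightarrow> 'u \<Rightarrow> bool" where
  "lt M x y \<longleftrightarrow> [x, y] \<in> pint M Less"

definition le :: "('f, 'p psym, 'u) fostruct \<Rightarrow> 'u \<Rightarrow> 'u \<Rightarrow> bool" where
  "le M x y \<longleftrightarrow> lt M x y \<or> x = y"

definition is_ordered_field :: "('f fsym, 'p psym, 'u) fostruct \<Rightarrow> bool" where
  "is_ordered_field M \<longleftrightarrow>
     field (field_reduct M) \<and>
     (\<forall>x\<in>univ M. \<not> lt M x x) \<and>
     (\<forall>x\<in>univ M. \<forall>y\<in>univ M. \<forall>z\<in>univ M. lt M x y \<longrightarrow> lt M y z \<longrightarrow> lt M x z) \<and>
     (\<forall>x\<in>univ M. \<forall>y\<in>univ M. lt M x y \<or> x = y \<or> lt M y x) \<and>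
     (\<forall>x\<in>univ M. \<forall>y\<in>univ M. \<forall>z\<in>univ M. lt M x y \<longrightarrow>
        lt M (x \<oplus>\<^bsub>field_reduct M\<^esub> z) (y \<oplus>\<^bsub>field_reduct M\<^esub> z)) \<and>
     (\<forall>x\<in>univ M. \<forall>y\<in>univ M.
        lt M \<zero>\<^bsub>field_reduct M\<^esub> x \<longrightarrow> lt M \<zero>\<^bsub>field_reduct M\<^esub> y \<longrightarrow>
        lt M \<zero>\<^bsub>field_reduct M\<^esub> (x \<otimes>\<^bsub>field_reduct M\<^esub> y))"

definition contains_field_language :: "('f fsym, 'p) lang \<Rightarrow> bool" where
  "contains_field_language L \<longleftrightarrow>
     {Plus, Times, Zero, One} \<subseteq> fsyms L \<and>
     farity L Plus = 2 \<and> farity L Times = 2 \<and> farity L Zero = 0 \<and> farity L One = 0"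

text \<open>
  In the case \<open>Plain_Field\<close> the symbol \<open>Less\<close> plays no role; if it belongs to \<open>L\<close>, it is an
  arbitrary further predicate symbol.
\<close>

fun expands :: "field_kind \<Rightarrow> ('f fsym, 'p psym) lang \<Rightarrow> ('f fsym, 'p psym, 'u) fostruct \<Rightarrow> bool"
where
  "expands Ordered_Field L M \<longleftrightarrow>
     is_structure L M \<and> contains_field_language L \<and> Less \<in> psyms L \<and> parity L Less = 2 \<and>
     is_ordered_field M"
| "expands Plain_Field L M \<longleftrightarrow>
     is_structure L M \<and> contains_field_language L \<and>
     field (field_reduct M) \<and> (infinite (univ M) \<or> card (univ M) > 2)"


section \<open>Coordinate geometries\<close>

abbreviation points :: "nat \<Rightarrow> ('f, 'p, 'u) fostruct \<Rightarrow> 'u list set" where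
  "points d M \<equiv> tuples d (univ M)"

definition aff_comb ::
    "nat \<Rightarrow> ('f fsym, 'p, 'u) fostruct \<Rightarrow> 'u \<Rightarrow> 'u list \<Rightarrow> 'u list \<Rightarrow> 'u list" where
  "aff_comb d M t a c = map (\<lambda>i.
     ((\<one>\<^bsub>field_reduct M\<^esub> \<ominus>\<^bsub>field_reduct M\<^esub> t) \<otimes>\<^bsub>field_reduct M\<^esub> (a ! i))
       \<oplus>\<^bsub>field_reduct M\<^esub> (t \<otimes>\<^bsub>field_reduct M\<^esub> (c ! i))) [0..<d]"

definition Bw ::
    "nat \<Rightarrow> ('f fsym, 'p psym, 'u) fostruct \<Rightarrow> 'u list \<Rightarrow> 'u list \<Rightarrow> 'u list \<Rightarrow> bool" where
  "Bw d M a b c \<longleftrightarrow>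
     (\<exists>t\<in>univ M. le M \<zero>\<^bsub>field_reduct M\<^esub> t \<and> le M t \<one>\<^bsub>field_reduct M\<^esub> \<and> b = aff_comb d M t a c)"

definition Col ::
    "nat \<Rightarrow> ('f fsym, 'p, 'u) fostruct \<Rightarrow> 'u list \<Rightarrow> 'u list \<Rightarrow> 'u list \<Rightarrow> bool" where
  "Col d M a b c \<longleftrightarrow>
     a = b \<or> b = c \<or> a = c \<or> (\<exists>t\<in>univ M. b = aff_comb d M t a c)"

fun key_rel ::
    "field_kind \<Rightarrow> nat \<Rightarrow> ('f fsym, 'p psym, 'u) fostruct \<Rightarrow> 'u list list set" where
  "key_rel Ordered_Field d M =
     {[a, b, c] | a b c. a \<in> points d M \<and> b \<in> points d M \<and> c \<in> points d M \<and> Bw d M a b c}"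
| "key_rel Plain_Field d M =
     {[a, b, c] | a b c. a \<in> points d M \<and> b \<in> points d M \<and> c \<in> points d M \<and> Col d M a b c}"

text \<open>
  A geometry is given by the arities and the defining formulas of its primitives
  \<open>P\<^sub>1, \<dots>, P\<^sub>k\<close>.  The formulas are part of the data so that the same geometry can be
  formed over \<open>\<F>\<close> and over each of its ultrapowers.
\<close>

type_synonym ('f, 'p) geometry = "(nat \<times> ('f fsym, 'p psym) fm) list"

definition is_geometry :: "('f fsym, 'p psym) lang \<Rightarrow> nat \<Rightarrow> ('f, 'p) geometry \<Rightarrow> bool" where
  "is_geometry L d \<Gamma> \<longleftrightarrow> (\<forall>(n, \<phi>)\<in>set \<Gamma>. is_formula L (d * n) \<phi>)"

text \<open>\<open>concat\<close> identifies \<open>(F\<^sup>d)\<^sup>n\<close> with \<open>d * n\<close>-tuples over \<open>F\<close>.\<close>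

definition prim_rel ::
    "nat \<Rightarrow> ('f fsym, 'p psym, 'u) fostruct \<Rightarrow> nat \<times> ('f fsym, 'p psym) fm \<Rightarrow> 'u list list set"
where
  "prim_rel d M P =
     {as \<in> tuples (fst P) (points d M). concat as \<in> defined_rel M (d * fst P) (snd P)}"

datatype geo_sym = Key | Prim nat

text \<open>The language has no function symbols; \<open>unit\<close> is a dummy type for them.\<close>

definition geo_lang :: "('f, 'p) geometry \<Rightarrow> (unit, geo_sym) lang" where
  "geo_lang \<Gamma> = \<lparr>
     fsyms = {}, farity = (\<lambda>_. 0),
     psyms = insert Key (Prim ` {..<length \<Gamma>}),
     parity = (\<lambda>s. case s of Key \<Rightarrow> 3 | Prim j \<Rightarrow> fst (\<Gamma> ! j)) \<rparr>"

definition geo_struct ::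
    "field_kind \<Rightarrow> nat \<Rightarrow> ('f, 'p) geometry \<Rightarrow> ('f fsym, 'p psym, 'u) fostruct \<Rightarrow>
     (unit, geo_sym, 'u list) fostruct" where
  "geo_struct \<kappa> d \<Gamma> M = \<lparr>
     univ = points d M,
     fint = (\<lambda>_ _. undefined),
     pint = (\<lambda>s. case s of Key \<Rightarrow> key_rel \<kappa> d M | Prim j \<Rightarrow> prim_rel d M (\<Gamma> ! j)) \<rparr>"

definition Conc ::
    "field_kind \<Rightarrow> nat \<Rightarrow> ('f, 'p) geometry \<Rightarrow> ('f fsym, 'p psym, 'u) fostruct \<Rightarrow>
     'u list list set set" where
  "Conc \<kappa> d \<Gamma> M = {R. \<exists>n\<ge>1. definable (geo_lang \<Gamma>) (geo_struct \<kappa> d \<Gamma> M) n R}"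


section \<open>Affine automorphisms and semilinear faithfulness\<close>

text \<open>Only the entries \<open>A i j\<close> with \<open>i < d\<close> and \<open>j < d\<close> of a matrix matter.\<close>

definition is_matrix :: "nat \<Rightarrow> 'u ring \<Rightarrow> (nat \<Rightarrow> nat \<Rightarrow> 'u) \<Rightarrow> bool" where
  "is_matrix d R A \<longleftrightarrow> (\<forall>i<d. \<forall>j<d. A i j \<in> carrier R)"

definition inverse_matrices ::
    "nat \<Rightarrow> 'u ring \<Rightarrow> (nat \<Rightarrow> nat \<Rightarrow> 'u) \<Rightarrow> (nat \<Rightarrow> nat \<Rightarrow> 'u) \<Rightarrow> bool" where
  "inverse_matrices d R A B \<longleftrightarrow> (\<forall>i<d. \<forall>j<d.
     (\<Oplus>\<^bsub>R\<^esub>k\<in>{..<d}. A i k \<otimes>\<^bsub>R\<^esub> B k j) = (if i = j then \<one>\<^bsub>R\<^esub> else \<zero>\<^bsub>R\<^esub>) \<and>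
     (\<Oplus>\<^bsub>R\<^esub>k\<in>{..<d}. B i k \<otimes>\<^bsub>R\<^esub> A k j) = (if i = j then \<one>\<^bsub>R\<^esub> else \<zero>\<^bsub>R\<^esub>))"

definition GL :: "nat \<Rightarrow> 'u ring \<Rightarrow> (nat \<Rightarrow> nat \<Rightarrow> 'u) set" where
  "GL d R = {A. is_matrix d R A \<and> (\<exists>B. is_matrix d R B \<and> inverse_matrices d R A B)}"

definition affine_map ::
    "nat \<Rightarrow> 'u ring \<Rightarrow> (nat \<Rightarrow> nat \<Rightarrow> 'u) \<Rightarrow> 'u list \<Rightarrow> 'u list \<Rightarrow> 'u list" where
  "affine_map d R A b = (\<lambda>x\<in>tuples d (carrier R).
     map (\<lambda>i. (\<Oplus>\<^bsub>R\<^esub>j\<in>{..<d}. A i j \<otimes>\<^bsub>R\<^esub> (x ! j)) \<oplus>\<^bsub>R\<^esub> (b ! i)) [0..<d])"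

definition Aff :: "nat \<Rightarrow> 'u ring \<Rightarrow> ('u list \<Rightarrow> 'u list) set" where
  "Aff d R = {affine_map d R A b | A b. A \<in> GL d R \<and> b \<in> tuples d (carrier R)}"

definition AffAut ::
    "field_kind \<Rightarrow> nat \<Rightarrow> ('f, 'p) geometry \<Rightarrow> ('f fsym, 'p psym, 'u) fostruct \<Rightarrow>
     ('u list \<Rightarrow> 'u list) set" where
  "AffAut \<kappa> d \<Gamma> M = Aut (geo_lang \<Gamma>) (geo_struct \<kappa> d \<Gamma> M) \<inter> Aff d (field_reduct M)"

definition coordinatewise ::
    "nat \<Rightarrow> ('f, 'p, 'u) fostruct \<Rightarrow> ('u \<Rightarrow> 'u) \<Rightarrow> 'u list \<Rightarrow> 'u list" where
  "coordinatewise d M \<sigma> = (\<lambda>x\<in>points d M. map \<sigma> x)"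

text \<open>
  The type argument \<open>'i\<close> supplies the index sets of the ultrafilters: an ultrafilter on a set
  \<open>I\<close> of elements of type \<open>'i\<close> is an ultrafilter \<open>U\<close> on \<open>'i\<close> with \<open>U \<le> principal I\<close>,
  and yields the same ultrapower up to isomorphism.  HOL cannot quantify over all types
  \<open>'i\<close> inside a definition.  Enlarging \<open>'i\<close> makes the property stronger (push ultrafilters
  forward along an injection), so a theorem that assumes it for one fixed \<open>'i\<close> also holds
  under the assumption for all index sets.
\<close>

definition semilinearly_faithful ::
    "'i itself \<Rightarrow> field_kind \<Rightarrow> nat \<Rightarrow> ('f, 'p) geometry \<Rightarrow>
     ('f fsym, 'p psym) lang \<Rightarrow> ('f fsym, 'p psym, 'u) fostruct \<Rightarrow> bool" where
  "semilinearly_faithful _ \<kappa> d \<Gamma> L M \<longleftrightarrow>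
     (\<forall>U :: 'i filter. is_ultrafilter U \<longrightarrow>
       (\<forall>\<alpha> \<in> Aut (geo_lang \<Gamma>) (geo_struct \<kappa> d \<Gamma> (ultrapower U M)).
         \<exists>A \<in> AffAut \<kappa> d \<Gamma> (ultrapower U M). \<exists>\<sigma> \<in> Aut L (ultrapower U M).
           \<alpha> = compose (points d (ultrapower U M)) A (coordinatewise d (ultrapower U M) \<sigma>)))"

end

theory Submission
  imports Defs "HOL-Library.Equipollence"
begin

text \<open>
  The hard direction is Svenonius' theorem for ultrapowers.  If a concept \<open>Q\<close> of \<open>\<G>\<close> is not
  definable in \<open>\<G>'\<close>, then for every \<open>n\<close> there are tuples \<open>a\<^sub>n\<close> in \<open>Q\<close> and \<open>b\<^sub>n\<close> outside \<open>Q\<close>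
  that cannot be told apart in \<open>n\<close> rounds of the Ehrenfeucht-Fraisse game on \<open>\<G>'\<close>.  Shelah's
  construction of isomorphic ultrapowers, which needs no continuum hypothesis, yields an
  ultrafilter \<open>U\<close> and an automorphism \<open>\<alpha>\<close> of \<open>\<G>'(\<F>\<^sup>U)\<close> that maps the class of \<open>(a\<^sub>n)\<close> to that of
  \<open>(b\<^sub>n)\<close>.  By semilinear faithfulness \<open>\<alpha>\<close> is the composition of an affine automorphism \<open>A\<close> with
  a coordinatewise automorphism of \<open>\<F>\<^sup>U\<close>; the latter preserves \<open>Q\<close>, so \<open>A\<close> does not.  As \<open>A\<close> is
  given by finitely many elements of \<open>\<F>\<^sup>U\<close>, almost all of its components are affine
  automorphisms of \<open>\<G>'\<close>, and some of them does not preserve \<open>Q\<close>.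
\<close>

section \<open>Families of independent functions\<close>

text \<open>With enough saturation a plain back-and-forth would give \<open>\<alpha>\<close>, but an
  ultrapower on an index set I may have 2^|I| elements, and without an assumption like the
  generalized continuum hypothesis it need not be saturated to that degree. By any stage fewer than
  2^|I| of them are spent, and every ultrafilter that contains all the sets
  \<open>agree n ps\<close> turns the final matching into an automorphism. The index type
  \<open>'a set set\<close> can carry such a family because a family of at most |'a| indices is
  coded by a single index. A finite point set is treated apart: there a long enough game already
  gives an automorphism of the geometry itself. The locale \<open>ultra_map\<close> serves two
  structures: the ultrapower of the field, and the geometry over it, which is an ultrapower only up
  to renaming, since its points are lists of classes and not classes of points.\<close>

lemma lepoll_iff_card_of_ordLeq: "A \<lesssim> B \<longleftrightarrow> (card_of A, card_of B) \<in> ordLeq"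
  by (simp add: lepoll_def card_of_ordLeq)

lemma infinite_lepoll: "infinite A \<Longrightarrow> A \<lesssim> B \<Longrightarrow> infinite B"
  using card_of_ordLeq_infinite lepoll_iff_card_of_ordLeq by blast

lemma UN_lepoll_infinite:
  assumes "infinite B" "I \<lesssim> B" "\<And>x. x \<in> I \<Longrightarrow> Y x \<lesssim> B"
  shows "(\<Union>x\<in>I. Y x) \<lesssim> B"
  using assms card_of_UNION_ordLeq_infinite[of B I Y] by (simp add: lepoll_iff_card_of_ordLeq)

lemma Un_lepoll_infinite:
  assumes "infinite B" "X \<lesssim> B" "Y \<lesssim> B"
  shows "X \<union> Y \<lesssim> B"
proof -
  have "X \<union> Y = (\<Union>b\<in>{True, False}. if b then X else Y)" by auto
  also have "\<dots> \<lesssim> B"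
    by (rule UN_lepoll_infinite[OF assms(1)]) (auto simp: assms intro: finite_lepoll_infinite[OF assms(1)])
  finally show ?thesis .
qed

lemma Times_lepoll_infinite:
  assumes "infinite B" "X \<lesssim> B" "Y \<lesssim> B"
  shows "X \<times> Y \<lesssim> B"
  using assms card_of_Sigma_ordLeq_infinite[of B X "\<lambda>_. Y"] by (simp add: lepoll_iff_card_of_ordLeq)

lemma lists_lepoll_infinite:
  assumes "infinite B" "X \<lesssim> B"
  shows "lists X \<lesssim> B"
proof -
  have *: "{xs \<in> lists X. length xs = n} \<lesssim> B" for n
  proof (induction n)
    case 0
    have "{xs \<in> lists X. length xs = 0} = {[]}" by auto
    then show ?case by (simp add: finite_lepoll_infinite[OF assms(1)])
  next
    case (Suc n)
    have "{xs \<in> lists X. length xs = Suc n} = (\<lambda>(x, xs). x # xs) ` (X \<times> {xs \<in> lists X. length xs = n})"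
      by (auto simp: length_Suc_conv image_iff)
    also have "\<dots> \<lesssim> X \<times> {xs \<in> lists X. length xs = n}" by (rule image_lepoll)
    also have "\<dots> \<lesssim> B" by (rule Times_lepoll_infinite) (use assms Suc in auto)
    finally show ?case .
  qed
  have "lists X = (\<Union>n. {xs \<in> lists X. length xs = n})" by auto
  also have "\<dots> \<lesssim> B"
    by (rule UN_lepoll_infinite[OF assms(1)]) (use * assms infinite_le_lepoll in auto)
  finally show ?thesis .
qed

lemma surj_from_lepoll: 
  assumes "A \<lesssim> B" "A \<noteq> {}"
  shows "\<exists>h. h ` B = A"
proof -
  obtain f where f: "inj_on f A" "f ` A \<subseteq> B" using assms by (auto simp: lepoll_def)
  obtain a where a: "a \<in> A" using assms by auto
  define h where "h = (\<lambda>b. if b \<in> f ` A then inv_into A f b else a)"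
  have "h ` B \<subseteq> A" using a by (auto simp: h_def inv_into_into)
  moreover have "x \<in> h ` B" if "x \<in> A" for x
    using that f by (auto simp: h_def image_iff intro!: bexI[of _ "f x"])
  ultimately show ?thesis by blast
qed

text \<open>Independence relative to \<open>Z\<close>. Up to |'v| functions are prescribed at once,
  not just finitely many, because the diagonal argument below has to satisfy the prescriptions of
  |'v| counterexamples at a common index.\<close>

definition large :: "('x \<Rightarrow> 'i \<Rightarrow> 'v) \<Rightarrow> 'x set \<Rightarrow> 'i set \<Rightarrow> bool" where
  "large F X Z \<longleftrightarrow>
     (\<forall>S s. S \<subseteq> X \<longrightarrow> S \<lesssim> (UNIV :: 'v set) \<longrightarrow> (\<exists>i\<in>Z. \<forall>x\<in>S. F x i = s x))"

lemma large_mono: "large F X Z \<Longrightarrow> Y \<subseteq> X \<Longrightarrow> Z \<subseteq> W \<Longrightarrow> large F Y W"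
  unfolding large_def by (meson subset_trans subsetD)

lemma large_nonempty: "large F X Z \<Longrightarrow> Z \<noteq> {}"
  unfolding large_def by (metis empty_iff empty_lepoll empty_subsetI)

text \<open>The family of Engelking and Karlowicz.  An index codes a family \<open>t\<close> of at most
  \<open>|'v|\<close> test points, a list \<open>u\<close> of traces on these points, and a list \<open>v\<close> of values.\<close>

lemma ex_independent_family:
  fixes dec :: "'i \<Rightarrow> ('v \<Rightarrow> 'i) \<times> ('v \<Rightarrow> 'v set) \<times> ('v \<Rightarrow> 'v)"
  assumes "surj dec" and inf: "infinite (UNIV :: 'v set)"
  shows "\<exists>F :: 'i set \<Rightarrow> 'i \<Rightarrow> 'v. large F UNIV UNIV"
proof -
  \<comment> \<open>One function for each set \<open>X\<close> of indices, hence 2^|I| functions.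
    The trace of \<open>X\<close> on the test points coded in \<open>i\<close> selects the position
    whose value is returned.\<close>
  define F :: "'i set \<Rightarrow> 'i \<Rightarrow> 'v" where
    "F = (\<lambda>X i. case dec i of (t, u, v) \<Rightarrow> v (SOME p. u p = {q. t q \<in> X}))"
  have "\<exists>i. \<forall>X\<in>S. F X i = s X" if S: "S \<lesssim> (UNIV :: 'v set)" for S :: "'i set set" and s
  proof (cases "S = {}")
    case False
    obtain e :: "'v \<Rightarrow> 'i set" where e: "range e = S"
      using surj_from_lepoll[OF S False] ..
    have "(UNIV :: ('v \<times> 'v) set) \<lesssim> (UNIV :: 'v set)"
      using Times_lepoll_infinite[OF inf lepoll_refl lepoll_refl] by simp
    from surj_from_lepoll[OF this UNIV_not_empty] obtain \<pi> :: "'v \<Rightarrow> 'v \<times> 'v"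
      where \<pi>: "surj \<pi>" ..
    \<comment> \<open>For each coded pair of members of \<open>S\<close> the test point lies in
      exactly one of the two if they differ, so |'v| points tell all members of \<open>S\<close>
      apart.\<close>
    define t where "t = (\<lambda>r. let (p, q) = \<pi> r in
      SOME y. (y \<in> e p) \<noteq> (y \<in> e q))"
    define u where "u = (\<lambda>p. {q. t q \<in> e p})"
    define v where "v = (\<lambda>p. s (e p))"
    have sep: "e p = e q" if "u p = u q" for p q
    proof (rule ccontr)
      assume "e p \<noteq> e q"
      then have ex: "\<exists>y. (y \<in> e p) \<noteq> (y \<in> e q)" by blast
      obtain r where r: "\<pi> r = (p, q)" using surjD[OF \<pi>, of "(p, q)"] by metis
      have "(t r \<in> e p) \<noteq> (t r \<in> e q)"
        using someI_ex[OF ex] unfolding t_def r by simp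
      moreover have "r \<in> u p \<longleftrightarrow> r \<in> u q" using that by simp
      ultimately show False by (simp add: u_def)
    qed
    obtain i where i: "dec i = (t, u, v)" using surjD[OF assms(1), of "(t, u, v)"] by metis
    have "F X i = s X" if "X \<in> S" for X
    proof -
      obtain p where p: "X = e p" using \<open>X \<in> S\<close> e by auto
      have up: "u p = {q. t q \<in> X}" by (simp add: u_def p)
      have "u (SOME p'. u p' = u p) = u p" by (rule someI) (rule refl)
      then have "e (SOME p'. u p' = u p) = X" using sep p by metis
      then show ?thesis unfolding F_def i v_def up by simp
    qed
    then show ?thesis by auto
  qed auto
  then have "large F UNIV UNIV" by (simp add: large_def)
  then show ?thesis by (rule exI[of _ F])
qed

text \<open>Cardinal arithmetic: a function into \<open>'v set set\<close> is a relation between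
  \<open>'v\<close> and \<open>'v set\<close>, and such pairs embed into \<open>'v set\<close>;
  hence there are no more of these functions than elements of \<open>'v set set\<close>. The other
  two factors have codomains that embed into \<open>'v set set\<close>.\<close>

lemma ex_code_functions:
  assumes inf: "infinite (UNIV :: 'v set)"
  shows "\<exists>dec :: 'v set set \<Rightarrow> ('v \<Rightarrow> 'v set set) \<times> ('v \<Rightarrow> 'v set) \<times> ('v \<Rightarrow> 'v). surj dec"
proof -
  have v1: "(UNIV :: 'v set) \<lesssim> (UNIV :: 'v set set)"
    using lepoll_Pow_self[of "UNIV :: 'v set"] by simp
  have v2: "(UNIV :: 'v set set) \<lesssim> (UNIV :: 'v set set set)"
    using lepoll_Pow_self[of "UNIV :: 'v set set"] by simp
  have v12: "(UNIV :: 'v set) \<lesssim> (UNIV :: 'v set set set)"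
    using v1 v2 lepoll_trans by blast
  have inf1: "infinite (UNIV :: 'v set set)" using inf v1 infinite_lepoll by blast
  have inf2: "infinite (UNIV :: 'v set set set)" using inf1 v2 infinite_lepoll by blast
  have "(UNIV :: 'v set) \<times> (UNIV :: 'v set set) \<lesssim> (UNIV :: 'v set set)"
    by (rule Times_lepoll_infinite[OF inf1]) (use v1 in auto)
  then obtain h :: "'v \<times> 'v set \<Rightarrow> 'v set" where h: "inj h"
    by (auto simp: lepoll_def)
  have f1: "(UNIV :: ('v \<Rightarrow> 'v set set) set) \<lesssim> (UNIV :: 'v set set set)"
  proof -
    have "inj (\<lambda>t :: 'v \<Rightarrow> 'v set set. h ` {(v, Y). Y \<in> t v})"
    proof (rule injI)
      fix t t' :: "'v \<Rightarrow> 'v set set"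
      assume "h ` {(v, Y). Y \<in> t v} = h ` {(v, Y). Y \<in> t' v}"
      then have "{(v, Y). Y \<in> t v} = {(v, Y). Y \<in> t' v}" using h by (simp add: inj_image_eq_iff)
      then show "t = t'" by (auto simp: set_eq_iff fun_eq_iff)
    qed
    then show ?thesis unfolding lepoll_def by blast
  qed
  have comp: "(UNIV :: ('v \<Rightarrow> 'w) set) \<lesssim> (UNIV :: 'v set set set)"
    if w: "(UNIV :: 'w set) \<lesssim> (UNIV :: 'v set set set)"
  proof -
    obtain j :: "'w \<Rightarrow> 'v set set" where "inj j" using w unfolding lepoll_def by blast
    then have "inj (\<lambda>g :: 'v \<Rightarrow> 'w. j \<circ> g)" by (auto simp: inj_def fun_eq_iff)
    then have "(UNIV :: ('v \<Rightarrow> 'w) set) \<lesssim> (UNIV :: ('v \<Rightarrow> 'v set set) set)"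
      unfolding lepoll_def by blast
    then show ?thesis using f1 lepoll_trans by blast
  qed
  have "(UNIV :: ('v \<Rightarrow> 'v set set) set) \<times> (UNIV :: ('v \<Rightarrow> 'v set) set) \<times> (UNIV :: ('v \<Rightarrow> 'v) set)
    \<lesssim> (UNIV :: 'v set set set)"
    by (intro Times_lepoll_infinite inf2 f1 comp v2 v12)
  then show ?thesis unfolding UNIV_Times_UNIV by (rule surj_from_lepoll) simp
qed

text \<open>If the conclusion failed, one could choose \<open>|'v|\<close> many counterexamples with pairwise
  disjoint supports, and prescribe the value \<open>v\<close> for the function \<open>F x\<^sub>v\<close>; whatever the
  value of \<open>g\<close> is, one of the counterexamples is then refuted.\<close>

lemma ex_small_exceptional_set:
  fixes F :: "'x \<Rightarrow> 'i \<Rightarrow> 'v"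
  assumes inf: "infinite (UNIV :: 'v set)" and L: "large F X Z"
  shows "\<exists>R. R \<lesssim> (UNIV :: 'v set) \<and>
    (\<forall>x\<in>X - R. large F (X - R - {x}) {i \<in> Z. F x i = g i})"
proof (rule ccontr)
  assume neg: "\<not> ?thesis"
  \<comment> \<open>The counterexamples: a pattern \<open>s\<close> on a small set \<open>S\<close>
    that cannot be realised in \<open>Z\<close> together with \<open>F x\<close> following
    \<open>g\<close>.\<close>
  define fail where "fail = (\<lambda>(x, S, s). x \<in> X \<and> S \<subseteq> X - {x} \<and> S \<lesssim> (UNIV :: 'v set) \<and>
    \<not> (\<exists>i\<in>Z. F x i = g i \<and> (\<forall>y\<in>S. F y i = s y)))"
  define supp where "supp = (\<lambda>(x :: 'x, S, s :: 'x \<Rightarrow> 'v). insert x S)"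
  have ex: "\<exists>c. fail c \<and> supp c \<inter> R = {}" if "R \<lesssim> (UNIV :: 'v set)" for R
  proof -
    from neg that obtain x where "x \<in> X - R" "\<not> large F (X - R - {x}) {i \<in> Z. F x i = g i}" by blast
    then obtain S s where "S \<subseteq> X - R - {x}" "S \<lesssim> (UNIV :: 'v set)"
      "\<not> (\<exists>i\<in>{i \<in> Z. F x i = g i}. \<forall>x\<in>S. F x i = s x)" unfolding large_def by blast
    then have "fail (x, S, s)" "supp (x, S, s) \<inter> R = {}" using \<open>x \<in> X - R\<close>
      by (auto simp: fail_def supp_def)
    then show ?thesis by (intro exI conjI)
  qed
  have small: "supp c \<lesssim> (UNIV :: 'v set)" if "fail c" for c
    using that Un_lepoll_infinite[OF inf finite_lepoll_infinite[OF inf], of "{fst c}" "fst (snd c)"]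
    by (cases c) (auto simp: fail_def supp_def)
  obtain r :: "'v rel" where r: "well_order_on UNIV r" using well_order_on by blast
  then have wf: "wf (r - Id)" by (simp add: well_order_on_def)
  have tot: "v = w \<or> (v, w) \<in> r - Id \<or> (w, v) \<in> r - Id" for v w
    using r by (auto simp: well_order_on_def linear_order_on_def total_on_def)
  \<comment> \<open>The guard \<open>fail (f w)\<close> keeps the union small for an arbitrary
    \<open>f\<close>, so the existence step needs no induction hypothesis; for the function obtained
    in the end the guard always holds.\<close>
  have "\<exists>f. \<forall>v. fail (f v) \<and> supp (f v) \<inter> (\<Union>w\<in>{w. (w, v) \<in> r - Id \<and> fail (f w)}. supp (f w)) = {}"
  proof (rule dependent_wf_choice[OF wf])
    fix f g :: "'v \<Rightarrow> 'x \<times> 'x set \<times> ('x \<Rightarrow> 'v)" and v c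
    assume "\<And>z. (z, v) \<in> r - Id \<Longrightarrow> f z = g z"
    then have "(\<Union>w\<in>{w. (w, v) \<in> r - Id \<and> fail (f w)}. supp (f w)) =
      (\<Union>w\<in>{w. (w, v) \<in> r - Id \<and> fail (g w)}. supp (g w))" by auto
    then show "(fail c \<and> supp c \<inter> (\<Union>w\<in>{w. (w, v) \<in> r - Id \<and> fail (f w)}. supp (f w)) = {}) =
      (fail c \<and> supp c \<inter> (\<Union>w\<in>{w. (w, v) \<in> r - Id \<and> fail (g w)}. supp (g w)) = {})" by simp
  next
    fix v and f :: "'v \<Rightarrow> 'x \<times> 'x set \<times> ('x \<Rightarrow> 'v)"
    show "\<exists>c. fail c \<and> supp c \<inter> (\<Union>w\<in>{w. (w, v) \<in> r - Id \<and> fail (f w)}. supp (f w)) = {}"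
    proof (rule ex, rule UN_lepoll_infinite[OF inf])
      show "{w. (w, v) \<in> r - Id \<and> fail (f w)} \<lesssim> (UNIV :: 'v set)"
        by (rule subset_imp_lepoll) simp
      show "supp (f w) \<lesssim> (UNIV :: 'v set)" if "w \<in> {w. (w, v) \<in> r - Id \<and> fail (f w)}" for w
        using that by (intro small) simp
    qed
  qed
  then obtain f where f': "\<forall>v. fail (f v) \<and>
    supp (f v) \<inter> (\<Union>w\<in>{w. (w, v) \<in> r - Id \<and> fail (f w)}. supp (f w)) = {}" ..
  have f: "fail (f v)" for v using f' by simp
  have dj: "supp (f v) \<inter> supp (f w) = {}" if "(w, v) \<in> r - Id" for v w
    using spec[OF f', of v] f that by blast
  have disj: "v = w" if "y \<in> supp (f v)" "y \<in> supp (f w)" for v w y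
    using tot[of v w] dj[of v w] dj[of w v] that by blast
  define T where "T = (\<Union>v. supp (f v))"
  have T: "T \<lesssim> (UNIV :: 'v set)" unfolding T_def
    by (rule UN_lepoll_infinite[OF inf]) (use small f in auto)
  have "supp c \<subseteq> X" if "fail c" for c
    using that by (cases c) (auto simp: fail_def supp_def)
  then have TX: "T \<subseteq> X" using f unfolding T_def by blast
  define own where "own = (\<lambda>y. THE v. y \<in> supp (f v))"
  have own: "own y = v" if "y \<in> supp (f v)" for y v
    unfolding own_def using that disj by blast
  \<comment> \<open>Disjoint supports make the prescription consistent: every member of
    \<open>T\<close> belongs to exactly one counterexample, whose number is
    \<open>own y\<close>.\<close>
  define s' where "s' = (\<lambda>y. case f (own y) of (x, S, s) \<Rightarrow> if y = x then own y else s y)"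
  obtain i where i: "i \<in> Z" "\<And>y. y \<in> T \<Longrightarrow> F y i = s' y"
    using L T TX unfolding large_def by metis
  obtain x S s where c: "f (g i) = (x, S, s)" by (cases "f (g i)") auto
  have sub: "supp (f (g i)) \<subseteq> T" by (auto simp: T_def)
  have "F x i = g i"
    using i(2)[of x] own[of x "g i"] sub by (auto simp: c supp_def s'_def)
  moreover have "F y i = s y" if "y \<in> S" for y
  proof -
    have "y \<in> T" "y \<noteq> x" "own y = g i"
      using own[of y "g i"] sub that f[of "g i"] by (auto simp: c supp_def fail_def)
    then show ?thesis using i(2)[of y] by (simp add: s'_def c)
  qed
  ultimately show False using f[of "g i"] i(1) by (auto simp: c fail_def)
qed

text \<open>The union of the exceptional sets for the single \<open>k\<close> still has size at most
  |B|, and by \<open>large_mono\<close> enlarging an exceptional set does no harm. Thus one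
  \<open>x\<close> outside the union can serve all \<open>k\<close> simultaneously.\<close>

lemma ex_small_exceptional_set_family:
  fixes F :: "'x \<Rightarrow> 'i \<Rightarrow> 'v"
  assumes inf: "infinite (UNIV :: 'v set)" and B: "(UNIV :: 'v set) \<lesssim> B" and K: "K \<lesssim> B"
    and L: "\<And>k. k \<in> K \<Longrightarrow> large F X (Z k)"
  shows "\<exists>R. R \<lesssim> B \<and> (\<forall>x\<in>X - R. \<forall>k\<in>K. large F (X - R - {x}) {i \<in> Z k. F x i = g k i})"
proof -
  have "\<forall>k\<in>K. \<exists>R. R \<lesssim> (UNIV :: 'v set) \<and>
    (\<forall>x\<in>X - R. large F (X - R - {x}) {i \<in> Z k. F x i = g k i})"
    using ex_small_exceptional_set[OF inf L] by blast
  then obtain R where R: "\<And>k. k \<in> K \<Longrightarrow> R k \<lesssim> (UNIV :: 'v set)"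
    "\<And>k x. k \<in> K \<Longrightarrow> x \<in> X - R k \<Longrightarrow> large F (X - R k - {x}) {i \<in> Z k. F x i = g k i}"
    by metis
  have "(\<Union>k\<in>K. R k) \<lesssim> B"
    by (rule UN_lepoll_infinite) (use inf B K R infinite_lepoll lepoll_trans in blast)+
  moreover have "large F (X - (\<Union>k\<in>K. R k) - {x}) {i \<in> Z k. F x i = g k i}"
    if "x \<in> X - (\<Union>k\<in>K. R k)" "k \<in> K" for x k
    using R(2)[of k x] that by (auto intro: large_mono)
  ultimately show ?thesis by blast
qed

section \<open>Shelah's construction\<close>

lemma ex_ultrafilter_le:
  assumes "G \<noteq> bot"
  shows "\<exists>U. is_ultrafilter U \<and> U \<le> G"
proof -
  define \<A> where "\<A> = {U. U \<noteq> bot \<and> U \<le> G}"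
  \<comment> \<open>Finer filters are smaller in the filter order, so Zorn's lemma is used
    downwards. A minimal proper filter decides every \<open>P\<close>, because the complement of an
    undecided \<open>P\<close> could be adjoined.\<close>
  have "\<exists>m\<in>\<A>. \<forall>a\<in>\<A>. a \<le> m \<longrightarrow> a = m"
  proof (rule predicate_Zorn)
    show "partial_order_on \<A> (relation_of (\<lambda>x y. y \<le> x) \<A>)"
      by (rule partial_order_on_relation_ofI) auto
  next
    fix C assume C: "C \<in> Chains (relation_of (\<lambda>x y. y \<le> x) \<A>)"
    then have CA: "C \<subseteq> \<A>" by (auto simp: Chains_def relation_of_def)
    have chain: "x \<le> y \<or> y \<le> x" if "x \<in> C" "y \<in> C" for x y
      using C that by (auto simp: Chains_def relation_of_def)
    show "\<exists>u\<in>\<A>. \<forall>a\<in>C. u \<le> a"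
    proof (cases "C = {}")
      case True
      then show ?thesis using assms by (auto simp: \<A>_def)
    next
      case False
      have "eventually P (Inf C) \<longleftrightarrow> (\<exists>b\<in>C. eventually P b)" for P
        using False chain by (intro eventually_Inf_base) (auto simp: le_inf_iff)
      then have "Inf C \<noteq> bot" using CA by (force simp: \<A>_def trivial_limit_def)
      moreover have "Inf C \<le> G" using False CA by (auto simp: \<A>_def intro: Inf_lower2)
      ultimately show ?thesis by (intro bexI[of _ "Inf C"]) (auto simp: \<A>_def Inf_lower)
    qed
  qed
  then obtain U where U: "U \<noteq> bot" "U \<le> G" and
    max: "\<And>a. a \<noteq> bot \<Longrightarrow> a \<le> U \<Longrightarrow> a = U"
    by (auto simp: \<A>_def dest: order_trans)
  have "eventually (\<lambda>i. \<not> P i) U" if "\<not> eventually P U" for P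
  proof -
    let ?V = "inf U (principal {i. \<not> P i})"
    have "?V \<noteq> bot"
      using that by (simp add: trivial_limit_def eventually_inf_principal)
    then have "?V = U" by (rule max) simp
    moreover have "eventually (\<lambda>i. \<not> P i) ?V" by (simp add: eventually_inf_principal)
    ultimately show ?thesis by simp
  qed
  then show ?thesis using U unfolding is_ultrafilter_def by blast
qed

lemma ex_ultrafilter_base:
  assumes "\<Z> \<noteq> {}" "{} \<notin> \<Z>"
    and dir: "\<And>Z W. Z \<in> \<Z> \<Longrightarrow> W \<in> \<Z> \<Longrightarrow> \<exists>V\<in>\<Z>. V \<subseteq> Z \<inter> W"
  shows "\<exists>U. is_ultrafilter U \<and> (\<forall>Z\<in>\<Z>. eventually (\<lambda>i. i \<in> Z) U)"
proof -
  let ?G = "INF Z\<in>\<Z>. principal Z"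
  have "eventually P ?G \<longleftrightarrow> (\<exists>Z\<in>\<Z>. eventually P (principal Z))" for P
    using assms(1) dir by (intro eventually_INF_base) (auto simp: le_inf_iff)
  then have ev: "eventually P ?G \<longleftrightarrow> (\<exists>Z\<in>\<Z>. \<forall>i\<in>Z. P i)" for P
    by (simp add: eventually_principal)
  have "?G \<noteq> bot" using assms(2) by (auto simp: trivial_limit_def ev)
  then obtain U where "is_ultrafilter U" "U \<le> ?G" using ex_ultrafilter_le by blast
  then show ?thesis using ev by (meson filter_leD)
qed

text \<open>A function is coded by its graph, moved into the index type along a pairing function.
  All representatives can therefore be enumerated along \<open>'i set\<close>, the type that also
  indexes the independent family.\<close>

lemma funcset_lepoll_Pow:
  assumes inf: "infinite (UNIV :: 'i set)" and A: "A \<lesssim> (UNIV :: 'i set)"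
  shows "(UNIV \<rightarrow> A :: ('i \<Rightarrow> 'm) set) \<lesssim> (UNIV :: 'i set set)"
proof -
  obtain e :: "'m \<Rightarrow> 'i" where e: "inj_on e A" using A by (auto simp: lepoll_def)
  have "(UNIV :: ('i \<times> 'i) set) \<lesssim> (UNIV :: 'i set)"
    using Times_lepoll_infinite[OF inf lepoll_refl lepoll_refl] by simp
  then obtain j :: "'i \<times> 'i \<Rightarrow> 'i" where j: "inj j" by (auto simp: lepoll_def)
  have "inj_on (\<lambda>f. range (\<lambda>i. j (i, e (f i)))) (UNIV \<rightarrow> A :: ('i \<Rightarrow> 'm) set)"
  proof (rule inj_onI, rule ext)
    fix f g :: "'i \<Rightarrow> 'm" and i
    assume fg: "f \<in> UNIV \<rightarrow> A" "g \<in> UNIV \<rightarrow> A"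
      "range (\<lambda>i. j (i, e (f i))) = range (\<lambda>i. j (i, e (g i)))"
    have "j (i, e (f i)) \<in> range (\<lambda>i. j (i, e (g i)))" unfolding fg(3)[symmetric] by (rule rangeI)
    then obtain i' where "j (i, e (f i)) = j (i', e (g i'))" by blast
    from injD[OF j this] have "e (f i) = e (g i)" by auto
    then show "f i = g i" by (rule inj_onD[OF e]) (use fg(1,2) in auto)
  qed
  then show ?thesis unfolding lepoll_def by (intro exI conjI) auto
qed

text \<open>An abstract form of equivalence in the game with \<open>n\<close> rounds.
  \<open>E_reindex\<close> allows entries to be dropped, repeated and permuted, so that only the set
  of matched pairs matters. The axioms are symmetric in the two sides, which later yields the back
  step from the forth step.\<close>

locale back_forth_system =
  fixes A :: "'m set" and E :: "nat \<Rightarrow> 'm list \<Rightarrow> 'm list \<Rightarrow> bool"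
  assumes E_mono: "E (Suc n) xs ys \<Longrightarrow> E n xs ys"
    and E_forth: "E (Suc n) xs ys \<Longrightarrow> x \<in> A \<Longrightarrow> \<exists>y\<in>A. E n (xs @ [x]) (ys @ [y])"
    and E_back: "E (Suc n) xs ys \<Longrightarrow> y \<in> A \<Longrightarrow> \<exists>x\<in>A. E n (xs @ [x]) (ys @ [y])"
    and E_reindex: "E n xs ys \<Longrightarrow> length xs = length ys \<Longrightarrow> set js \<subseteq> {..<length xs} \<Longrightarrow>
      E n (map (nth xs) js) (map (nth ys) js)"
begin

definition agree :: "nat \<Rightarrow> (('i \<Rightarrow> 'm) \<times> ('i \<Rightarrow> 'm)) list \<Rightarrow> 'i set" where
  "agree n ps = {i. E n (map (\<lambda>p. fst p i) ps) (map (\<lambda>p. snd p i) ps)}"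

definition extendible ::
    "('x \<Rightarrow> 'i \<Rightarrow> 'v) \<Rightarrow> 'x set \<Rightarrow> (('i \<Rightarrow> 'm) \<times> ('i \<Rightarrow> 'm)) set \<Rightarrow> bool" where
  "extendible F X P \<longleftrightarrow> (\<forall>n. \<forall>ps\<in>lists P. large F X (agree n ps))"

lemma E_antimono: "m \<le> n \<Longrightarrow> E n xs ys \<Longrightarrow> E m xs ys"
  by (induction n rule: dec_induct) (auto dest: E_mono)

text \<open>Reindexing along positions of the members of \<open>qs\<close> in \<open>ps\<close>. The
  consequence needed later is that the sets \<open>agree n ps\<close> are directed: concatenating
  two lists and taking the larger number of rounds refines both.\<close>

lemma agree_subset:
  assumes "set qs \<subseteq> set ps" "m \<le> n"
  shows "agree n ps \<subseteq> agree m qs"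
proof -
  have "\<forall>q\<in>set qs. \<exists>j<length ps. ps ! j = q" using assms(1) by (auto simp: in_set_conv_nth)
  then obtain k where k: "\<And>q. q \<in> set qs \<Longrightarrow> k q < length ps \<and> ps ! k q = q" by metis
  have "E m (map (\<lambda>p. fst p i) qs) (map (\<lambda>p. snd p i) qs)"
    if "E n (map (\<lambda>p. fst p i) ps) (map (\<lambda>p. snd p i) ps)" for i
  proof -
    have "map (\<lambda>p. fst p i) qs = map (nth (map (\<lambda>p. fst p i) ps)) (map k qs)"
      "map (\<lambda>p. snd p i) qs = map (nth (map (\<lambda>p. snd p i) ps)) (map k qs)" using k by auto
    moreover have "E m (map (nth (map (\<lambda>p. fst p i) ps)) (map k qs))
        (map (nth (map (\<lambda>p. snd p i) ps)) (map k qs))"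
      using k by (intro E_reindex E_antimono[OF assms(2)] that) auto
    ultimately show ?thesis by metis
  qed
  then show ?thesis by (auto simp: agree_def)
qed

lemma extendible_mono: "extendible F X P \<Longrightarrow> Y \<subseteq> X \<Longrightarrow> Q \<subseteq> P \<Longrightarrow> extendible F Y Q"
  unfolding extendible_def using large_mono[of F X _ Y] lists_mono[of Q P] by blast

text \<open>Each condition mentions only finitely many pairs, and a finite subset of the union of a
  chain lies in one of its members. This carries the invariant through limit stages.\<close>

lemma extendible_chain:
  assumes "C \<noteq> {}" and ext: "\<And>c. c \<in> C \<Longrightarrow> extendible F (X - snd c) (fst c)"
    and ch: "\<And>c d. c \<in> C \<Longrightarrow> d \<in> C \<Longrightarrow> fst c \<subseteq> fst d \<or> fst d \<subseteq> fst c"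
  shows "extendible F (X - \<Union> (snd ` C)) (\<Union> (fst ` C))"
  unfolding extendible_def
proof (intro allI ballI)
  fix n ps assume "ps \<in> lists (\<Union> (fst ` C))"
  then have "set ps \<subseteq> \<Union> (fst ` C)" by auto
  then have "\<exists>c\<in>C. set ps \<subseteq> fst c"
  proof (induction ps)
    case Nil
    then show ?case using assms(1) by auto
  next
    case (Cons p ps)
    then obtain c d where "c \<in> C" "d \<in> C" "set ps \<subseteq> fst c" "p \<in> fst d" by auto
    then show ?case using ch[of c d] by auto
  qed
  then obtain c where c: "c \<in> C" "ps \<in> lists (fst c)" by auto
  then have "large F (X - snd c) (agree n ps)" using ext unfolding extendible_def by blast
  then show "large F (X - \<Union> (snd ` C)) (agree n ps)" by (rule large_mono) (use c in auto)
qed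

text \<open>The partner of \<open>a\<close> is \<open>h \<circ> F x\<close> for an unused index \<open>x\<close>.  By independence \<open>F x\<close>
  agrees with each of the Skolem functions \<open>g k\<close> on a large set, so one and the same \<open>x\<close>
  serves all conditions.\<close>

lemma extend_forth:
  fixes F :: "'x \<Rightarrow> 'i \<Rightarrow> 'v" and h :: "'v \<Rightarrow> 'm"
  assumes inf: "infinite (UNIV :: 'v set)" and B: "(UNIV :: 'v set) \<lesssim> B" "P \<lesssim> B" "\<not> X \<lesssim> B"
    and h: "range h = A" and ext: "extendible F X P" and a: "a \<in> UNIV \<rightarrow> A"
  shows "\<exists>b\<in>UNIV \<rightarrow> A. \<exists>R. R \<lesssim> B \<and> extendible F (X - R) (insert (a, b) P)"
proof -
  have infB: "infinite B" using inf B(1) infinite_lepoll by blast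
  \<comment> \<open>A condition is a number of rounds together with a finite list of matched pairs,
    so there are at most |B| conditions.\<close>
  define K where "K = (UNIV :: nat set) \<times> lists P"
  have K: "K \<lesssim> B" unfolding K_def
    by (intro Times_lepoll_infinite[OF infB] lists_lepoll_infinite[OF infB] B(2))
      (use infB infinite_le_lepoll in blast)
  \<comment> \<open>\<open>Suc n\<close> keeps one round in reserve: \<open>E_forth\<close> spends
    it on answering \<open>a i\<close>, and \<open>n\<close> rounds remain for the extended
    list.\<close>
  define Z :: "nat \<times> (('i \<Rightarrow> 'm) \<times> ('i \<Rightarrow> 'm)) list \<Rightarrow> 'i set"
    where "Z = (\<lambda>(n, ps). agree (Suc n) ps)"
  define ok where "ok = (\<lambda>(n, ps) i v.
    E n (map (\<lambda>p. fst p i) ps @ [a i]) (map (\<lambda>p. snd p i) ps @ [h v]))"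
  define g where "g = (\<lambda>k i. SOME v. ok k i v)"
  have g: "ok k i (g k i)" if "i \<in> Z k" for k i
  proof -
    obtain n ps where k: "k = (n, ps)" by (cases k)
    have "\<exists>y\<in>A. E n (map (\<lambda>p. fst p i) ps @ [a i]) (map (\<lambda>p. snd p i) ps @ [y])"
      using that a by (intro E_forth) (auto simp: Z_def agree_def k)
    then have "\<exists>v. ok k i v" using h by (auto simp: ok_def k)
    then show ?thesis unfolding g_def by (rule someI_ex)
  qed
  have "large F X (Z k)" if "k \<in> K" for k
    using that ext by (auto simp: K_def Z_def extendible_def)
  then obtain R where R: "R \<lesssim> B"
    and large: "\<And>x k. x \<in> X - R \<Longrightarrow> k \<in> K \<Longrightarrow> large F (X - R - {x}) {i \<in> Z k. F x i = g k i}"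
    using ex_small_exceptional_set_family[OF inf B(1) K, of F X Z g] by blast
  have "\<not> X \<subseteq> R" using R B(3) subset_imp_lepoll lepoll_trans by blast
  then obtain x where x: "x \<in> X - R" by blast
  define b where "b = (\<lambda>i. h (F x i))"
  have "extendible F (X - insert x R) (insert (a, b) P)"
    unfolding extendible_def
  proof (intro allI ballI)
    fix n qs assume qs: "qs \<in> lists (insert (a, b) P)"
    \<comment> \<open>The new pair may occur in \<open>qs\<close> anywhere and repeatedly; by
      \<open>agree_subset\<close> it suffices to treat the old pairs followed by one copy of
      it.\<close>
    define ps where "ps = filter (\<lambda>p. p \<in> P) qs"
    have k: "(n, ps) \<in> K" by (auto simp: K_def ps_def)
    have "set qs \<subseteq> set (ps @ [(a, b)])" using qs by (auto simp: ps_def)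
    then have "agree n (ps @ [(a, b)]) \<subseteq> agree n qs" by (intro agree_subset) auto
    moreover have "{i \<in> Z (n, ps). F x i = g (n, ps) i} \<subseteq> agree n (ps @ [(a, b)])"
      using g[of _ "(n, ps)"] by (auto simp: agree_def ok_def b_def)
    ultimately show "large F (X - insert x R) (agree n qs)"
      by (intro large_mono[OF large[OF x k]]) auto
  qed
  moreover have "insert x R \<lesssim> B"
    using Un_lepoll_infinite[OF infB finite_lepoll_infinite[OF infB] R, of "{x}"] by simp
  moreover have "b \<in> UNIV \<rightarrow> A" using h by (auto simp: b_def)
  ultimately show ?thesis by blast
qed

end

text \<open>Forth and back exchange their roles, so \<open>extend_back\<close> becomes
  \<open>extend_forth\<close> for the swapped pairs.\<close>

lemma (in back_forth_system) back_forth_system_converse: "back_forth_system A (\<lambda>n xs ys. E n ys xs)"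
  by unfold_locales (use E_mono E_forth E_back E_reindex in auto)

context back_forth_system
begin

lemma extendible_converse:
  "back_forth_system.extendible (\<lambda>n xs ys. E n ys xs) F X P \<longleftrightarrow> extendible F X (prod.swap ` P)"
proof -
  interpret conv: back_forth_system A "\<lambda>n xs ys. E n ys xs" by (rule back_forth_system_converse)
  have ag: "conv.agree n ps = agree n (map prod.swap ps)" for n ps
    by (simp add: agree_def conv.agree_def comp_def)
  show ?thesis unfolding extendible_def conv.extendible_def ag by (auto simp: lists_image)
qed

lemma extend_back:
  fixes F :: "'x \<Rightarrow> 'i \<Rightarrow> 'v" and h :: "'v \<Rightarrow> 'm"
  assumes inf: "infinite (UNIV :: 'v set)" and B: "(UNIV :: 'v set) \<lesssim> B" "P \<lesssim> B" "\<not> X \<lesssim> B"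
    and h: "range h = A" and ext: "extendible F X P" and b: "b \<in> UNIV \<rightarrow> A"
  shows "\<exists>a\<in>UNIV \<rightarrow> A. \<exists>R. R \<lesssim> B \<and> extendible F (X - R) (insert (a, b) P)"
proof -
  interpret conv: back_forth_system A "\<lambda>n xs ys. E n ys xs" by (rule back_forth_system_converse)
  have "prod.swap ` P \<lesssim> B" using B(2) image_lepoll lepoll_trans by blast
  from conv.extend_forth[OF inf B(1) this B(3) h _ b, of F] show ?thesis
    using ext by (simp add: extendible_converse image_image)
qed


lemma extend_both:
  fixes F :: "'x \<Rightarrow> 'i \<Rightarrow> 'v" and h :: "'v \<Rightarrow> 'm"
  assumes inf: "infinite (UNIV :: 'v set)" and vB: "(UNIV :: 'v set) \<lesssim> B"
    and PB: "P \<lesssim> B" "P \<subseteq> (UNIV \<rightarrow> A) \<times> (UNIV \<rightarrow> A)" and RB: "R \<lesssim> B" "\<not> (UNIV :: 'x set) \<lesssim> B"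
    and h: "range h = A" and ext: "extendible F (UNIV - R) P" and c: "c \<in> UNIV \<rightarrow> A"
  shows "\<exists>P' R'. P \<subseteq> P' \<and> R \<subseteq> R' \<and> P' \<lesssim> B \<and> R' \<lesssim> B \<and> P' \<subseteq> (UNIV \<rightarrow> A) \<times> (UNIV \<rightarrow> A) \<and>
    extendible F (UNIV - R') P' \<and> c \<in> fst ` P' \<and> c \<in> snd ` P'"
proof -
  have infB: "infinite B" using inf vB infinite_lepoll by blast
  have big: "\<not> UNIV - S \<lesssim> B" if "S \<lesssim> B" for S :: "'x set"
    using Un_lepoll_infinite[OF infB that, of "UNIV - S"] RB(2) by auto
  have ins: "insert q Q \<lesssim> B" if "Q \<lesssim> B" for q and Q :: "'q set"
    using Un_lepoll_infinite[OF infB finite_lepoll_infinite[OF infB] that, of "{q}"] by simp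
  obtain b R1 where 1: "b \<in> UNIV \<rightarrow> A" "R1 \<lesssim> B" "extendible F (UNIV - R - R1) (insert (c, b) P)"
    using extend_forth[OF inf vB PB(1) big[OF RB(1)] h ext c] by blast
  have R1: "R \<union> R1 \<lesssim> B" using Un_lepoll_infinite[OF infB RB(1) 1(2)] .
  have 2: "extendible F (UNIV - (R \<union> R1)) (insert (c, b) P)" using 1(3) by (simp add: Diff_Un Diff_Int_distrib Diff_eq Int_assoc)
  obtain a R2 where 3: "a \<in> UNIV \<rightarrow> A" "R2 \<lesssim> B"
    "extendible F (UNIV - (R \<union> R1) - R2) (insert (a, c) (insert (c, b) P))"
    using extend_back[OF inf vB ins[OF PB(1)] big[OF R1] h 2 c] by blast
  have 4: "extendible F (UNIV - (R \<union> R1 \<union> R2)) (insert (a, c) (insert (c, b) P))"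
    by (rule extendible_mono[OF 3(3)]) auto
  show ?thesis
    by (rule exI[of _ "insert (a, c) (insert (c, b) P)"], rule exI[of _ "R \<union> R1 \<union> R2"])
      (use 4 1(1) 3(1,2) c PB in \<open>auto intro: ins Un_lepoll_infinite[OF infB] R1\<close>)
qed

text \<open>Transfinite recursion along a well-order of \<open>'i set\<close> of minimal order type: before stage \<open>x\<close>
  at most \<open>|B x| < |'i set|\<close> indices have been used up, hence unused ones remain.\<close>

lemma ex_total_extension:
  fixes F :: "'i set \<Rightarrow> 'i \<Rightarrow> 'v" and h :: "'v \<Rightarrow> 'm" and en :: "'i set \<Rightarrow> 'i \<Rightarrow> 'm"
  assumes inf: "infinite (UNIV :: 'v set)" and vi: "(UNIV :: 'v set) \<lesssim> (UNIV :: 'i set)"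
    and h: "range h = A" and en: "range en = UNIV \<rightarrow> A"
    and P0: "finite P0" "P0 \<subseteq> (UNIV \<rightarrow> A) \<times> (UNIV \<rightarrow> A)" and R0: "finite R0"
    and ext0: "extendible F (UNIV - R0) P0"
  shows "\<exists>P. P0 \<subseteq> P \<and> P \<subseteq> (UNIV \<rightarrow> A) \<times> (UNIV \<rightarrow> A) \<and>
    fst ` P = (UNIV \<rightarrow> A) \<and> snd ` P = (UNIV \<rightarrow> A) \<and> (\<forall>n. \<forall>ps\<in>lists P. agree n ps \<noteq> {})"
proof -
  let ?r = "card_of (UNIV :: 'i set set)"
  \<comment> \<open>Bounds the pairs and indices used up to stage \<open>x\<close>. The summand
    \<open>'i\<close> makes the bound infinite and at least |'v| even at the earliest
    stages.\<close>
  define B where "B = (\<lambda>x. Order_Relation.underS ?r x <+> (UNIV :: 'i set))"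
  have infi: "infinite (UNIV :: 'i set)" using inf vi infinite_lepoll by blast
  have iB: "(UNIV :: 'i set) \<lesssim> B x" for x
    using inj_Inr unfolding B_def lepoll_def by (intro exI[of _ Inr]) auto
  have infB: "infinite (B x)" for x using infi iB infinite_lepoll by blast
  have finB: "S \<lesssim> B x" if "finite S" for x and S :: "'q set"
    using finite_lepoll_infinite[OF infB that] .
  have vB: "(UNIV :: 'v set) \<lesssim> B x" for x using vi iB lepoll_trans by blast
  have uB: "Order_Relation.underS ?r x \<lesssim> B x" for x
    using inj_Inl unfolding B_def lepoll_def by (intro exI[of _ Inl]) auto
  have wo: "well_order_on UNIV ?r" by (rule card_of_well_order_on)
  have tr: "trans ?r" and an: "antisym ?r" and tot: "\<And>x y. x = y \<or> (x, y) \<in> ?r \<or> (y, x) \<in> ?r"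
    using wo by (auto simp: well_order_on_def linear_order_on_def partial_order_on_def
        preorder_on_def total_on_def)
  have wf: "wf (?r - Id)" using wo by (simp add: well_order_on_def)
  have us: "y \<in> Order_Relation.underS ?r x \<longleftrightarrow> (y, x) \<in> ?r - Id" for x y
    by (auto simp: Order_Relation.underS_def)
  have BB: "B y \<lesssim> B x" if "(y, x) \<in> ?r - Id" for x y
  proof -
    have "Order_Relation.underS ?r y \<subseteq> Order_Relation.underS ?r x"
      using that transD[OF tr] antisymD[OF an] unfolding Order_Relation.underS_def by blast
    then show ?thesis unfolding B_def by (intro sum_lepoll_mono subset_imp_lepoll lepoll_refl)
  qed
  have big: "\<not> (UNIV :: 'i set set) \<lesssim> B x" for x
  proof -
    have "infinite (UNIV :: 'i set set)" using infi by (simp add: Finite_Set.finite_set)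
    moreover have "(card_of (Order_Relation.underS ?r x), ?r) \<in> ordLess"
      by (intro card_of_underS card_of_Card_order) (simp add: Field_card_of)
    moreover have "(card_of (UNIV :: 'i set), ?r) \<in> ordLess"
      using card_of_Pow[of "UNIV :: 'i set"] by simp
    ultimately have "(card_of (B x), ?r) \<in> ordLess"
      unfolding B_def by (intro card_of_Plus_ordLess_infinite)
    then show ?thesis using not_ordLess_ordLeq by (auto simp: lepoll_iff_card_of_ordLeq)
  qed
  \<comment> \<open>\<open>fst c\<close> holds the matched pairs, \<open>snd c\<close> the spent
    indices. Every stage contains all earlier ones and the initial data, so earlier stages form a
    chain and no distinction between successor and limit stages is needed.\<close>
  define stage where "stage = (\<lambda>f x c. 
    (\<forall>q \<in> insert (P0, R0) (f ` {y. (y, x) \<in> ?r - Id}). fst q \<subseteq> fst c \<and> snd q \<subseteq> snd c) \<and>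
    fst c \<lesssim> B x \<and> snd c \<lesssim> B x \<and> fst c \<subseteq> (UNIV \<rightarrow> A) \<times> (UNIV \<rightarrow> A) \<and>
    extendible F (UNIV - snd c) (fst c) \<and> en x \<in> fst ` fst c \<and> en x \<in> snd ` fst c)"
  have "\<exists>f. \<forall>x. stage f x (f x)"
  proof (rule dependent_wf_choice[OF wf])
    fix f g :: "'i set \<Rightarrow> (('i \<Rightarrow> 'm) \<times> ('i \<Rightarrow> 'm)) set \<times> 'i set set" and x c
    assume "\<And>z. (z, x) \<in> ?r - Id \<Longrightarrow> f z = g z"
    then have "f ` {y. (y, x) \<in> ?r - Id} = g ` {y. (y, x) \<in> ?r - Id}" by (intro image_cong) auto
    then show "stage f x c = stage g x c" by (simp only: stage_def)
  next
    fix x and f :: "'i set \<Rightarrow> (('i \<Rightarrow> 'm) \<times> ('i \<Rightarrow> 'm)) set \<times> 'i set set"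
    assume st: "\<And>y. (y, x) \<in> ?r - Id \<Longrightarrow> stage f y (f y)"
    define C where "C = insert (P0, R0) (f ` {y. (y, x) \<in> ?r - Id})"
    have cC: "fst c \<lesssim> B x \<and> snd c \<lesssim> B x \<and> fst c \<subseteq> (UNIV \<rightarrow> A) \<times> (UNIV \<rightarrow> A) \<and>
      extendible F (UNIV - snd c) (fst c)" if "c \<in> C" for c
    proof (cases "c = (P0, R0)")
      case True
      then show ?thesis using finB[OF P0(1)] P0 finB[OF R0] ext0 by simp
    next
      case False
      then obtain y where y: "(y, x) \<in> ?r - Id" "c = f y" using \<open>c \<in> C\<close> by (auto simp: C_def)
      from st[OF y(1)] show ?thesis
        unfolding stage_def y(2)[symmetric]
        by (auto intro: lepoll_trans[OF _ BB[OF y(1)]])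
    qed
    have "{y. (y, x) \<in> ?r - Id} \<lesssim> B x" using uB[of x] unfolding us[symmetric] by simp
    then have "f ` {y. (y, x) \<in> ?r - Id} \<lesssim> B x" by (rule lepoll_trans[OF image_lepoll])
    then have CB: "C \<lesssim> B x"
      using Un_lepoll_infinite[OF infB finB[of "{(P0, R0)}"]] unfolding C_def by simp
    have small: "\<Union> (fst ` C) \<lesssim> B x" "\<Union> (snd ` C) \<lesssim> B x"
      by (rule UN_lepoll_infinite[OF infB CB], simp add: cC)+
    have P0: "P0 \<subseteq> fst c" if "c \<in> C" for c
    proof (cases "c = (P0, R0)")
      case False
      then obtain y where y: "(y, x) \<in> ?r - Id" "c = f y" using \<open>c \<in> C\<close> by (auto simp: C_def)
      from st[OF y(1)] show ?thesis unfolding stage_def y(2)[symmetric] by simp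
    qed simp
    have mono: "fst (f y) \<subseteq> fst (f z)" if "(y, z) \<in> ?r - Id" "(z, x) \<in> ?r - Id" for y z
      using st[OF that(2)] that(1) unfolding stage_def by blast
    have "extendible F (UNIV - \<Union> (snd ` C)) (\<Union> (fst ` C))"
    proof (rule extendible_chain)
      fix c d assume cd: "c \<in> C" "d \<in> C"
      show "fst c \<subseteq> fst d \<or> fst d \<subseteq> fst c"
      proof (cases "c = (P0, R0) \<or> d = (P0, R0)")
        case True
        then show ?thesis using P0[OF cd(1)] P0[OF cd(2)] by auto
      next
        case False
        then have "c \<in> f ` {y. (y, x) \<in> ?r - Id}" "d \<in> f ` {y. (y, x) \<in> ?r - Id}"
          using cd by (simp_all add: C_def)
        then obtain y z where yz: "(y, x) \<in> ?r - Id" "(z, x) \<in> ?r - Id" "c = f y" "d = f z"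
          by (elim imageE CollectE)
        consider "y = z" | "(y, z) \<in> ?r - Id" | "(z, y) \<in> ?r - Id" using tot[of y z] by auto
        then show ?thesis
        proof cases
          case 2
          then show ?thesis using mono[OF 2 yz(2)] yz by simp
        next
          case 3
          then show ?thesis using mono[OF 3 yz(1)] yz by simp
        qed (simp add: yz)
      qed
    next
      show "C \<noteq> {}" by (simp add: C_def)
    qed (simp add: cC)
    moreover have "\<Union> (fst ` C) \<subseteq> (UNIV \<rightarrow> A) \<times> (UNIV \<rightarrow> A)" using cC by (intro UN_least) blast
    moreover have "en x \<in> UNIV \<rightarrow> A" using en by (metis rangeI)
    ultimately have "\<exists>P' R'. \<Union> (fst ` C) \<subseteq> P' \<and> \<Union> (snd ` C) \<subseteq> R' \<and> P' \<lesssim> B x \<and> R' \<lesssim> B x \<and>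
      P' \<subseteq> (UNIV \<rightarrow> A) \<times> (UNIV \<rightarrow> A) \<and> extendible F (UNIV - R') P' \<and>
      en x \<in> fst ` P' \<and> en x \<in> snd ` P'"
      by (intro extend_both[OF inf vB small(1) _ small(2) big h])
    then obtain P' R' where c: "\<Union> (fst ` C) \<subseteq> P'" "\<Union> (snd ` C) \<subseteq> R'" "P' \<lesssim> B x" "R' \<lesssim> B x"
      "P' \<subseteq> (UNIV \<rightarrow> A) \<times> (UNIV \<rightarrow> A)" "extendible F (UNIV - R') P'" "en x \<in> fst ` P'" "en x \<in> snd ` P'"
      by (elim exE conjE)
    have "\<forall>q\<in>C. fst q \<subseteq> P' \<and> snd q \<subseteq> R'" using c(1,2) by blast
    then have "stage f x (P', R')"
      unfolding stage_def C_def[symmetric] using c(3-) by simp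
    then show "\<exists>c. stage f x c" ..
  qed
  then obtain f where st: "\<forall>x. stage f x (f x)" ..
  define P where "P = \<Union> (fst ` range f)"
  have mono: "fst (f y) \<subseteq> fst (f x)" if "(y, x) \<in> ?r" for x y
  proof (cases "x = y")
    case False
    then have "f y \<in> insert (P0, R0) (f ` {y. (y, x) \<in> ?r - Id})" using that by auto
    then show ?thesis using spec[OF st, of x] unfolding stage_def by blast
  qed simp
  have "extendible F (UNIV - snd (f x)) (fst (f x))" for x
    using spec[OF st, of x] unfolding stage_def by blast
  moreover have "fst (f x) \<subseteq> fst (f y) \<or> fst (f y) \<subseteq> fst (f x)" for x y
    using tot[of x y] mono[of x y] mono[of y x] by (elim disjE) simp_all
  ultimately have ext: "extendible F (UNIV - \<Union> (snd ` range f)) P"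
    unfolding P_def by (intro extendible_chain) (simp, (elim rangeE, simp)+)
  have ne: "\<forall>n. \<forall>ps\<in>lists P. agree n ps \<noteq> {}"
  proof (intro allI ballI)
    fix n ps assume "ps \<in> lists P"
    then have "large F (UNIV - \<Union> (snd ` range f)) (agree n ps)"
      using ext unfolding extendible_def by simp
    then show "agree n ps \<noteq> {}" by (rule large_nonempty)
  qed
  have fP: "fst (f x) \<subseteq> P" for x unfolding P_def by (rule UN_upper) simp
  have "P0 \<subseteq> fst (f undefined)"
    using spec[OF st, of undefined] unfolding stage_def by simp
  then have P0P: "P0 \<subseteq> P" using fP by (rule order_trans)
  have "fst (f x) \<subseteq> (UNIV \<rightarrow> A) \<times> (UNIV \<rightarrow> A)" for x
    using spec[OF st, of x] unfolding stage_def by (elim conjE)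
  then have sub: "P \<subseteq> (UNIV \<rightarrow> A) \<times> (UNIV \<rightarrow> A)"
    unfolding P_def by (intro UN_least) (elim rangeE, simp)
  have "en x \<in> fst ` fst (f x) \<and> en x \<in> snd ` fst (f x)" for x
    using spec[OF st, of x] unfolding stage_def by (elim conjE, intro conjI)
  then have "en x \<in> fst ` P" "en x \<in> snd ` P" for x
    using image_mono[OF fP[of x], of fst] image_mono[OF fP[of x], of snd] by (metis subsetD)+
  then have sup: "range en \<subseteq> fst ` P" "range en \<subseteq> snd ` P" by (simp_all add: image_subset_iff)
  have "fst p \<in> UNIV \<rightarrow> A \<and> snd p \<in> UNIV \<rightarrow> A" if "p \<in> P" for p
    using subsetD[OF sub that] by (simp only: mem_Times_iff)
  then have "fst ` P \<subseteq> (UNIV \<rightarrow> A)" "snd ` P \<subseteq> (UNIV \<rightarrow> A)"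
    unfolding image_subset_iff by (metis+)
  then have "fst ` P = (UNIV \<rightarrow> A)" "snd ` P = (UNIV \<rightarrow> A)"
    using sup unfolding en by (simp_all only: subset_antisym)
  then show ?thesis using ne P0P sub by (intro exI[of _ P] conjI)
qed

text \<open>The sequences \<open>as\<close> and \<open>bs\<close> are carried over to the index type
  by a map \<open>N\<close> into the naturals: at \<open>i\<close> the tuples with number
  \<open>N i\<close> are used. The matching then starts from the pairs of components of
  \<open>aa\<close> and \<open>bb\<close> and is made total on both sides.\<close>

lemma ex_ultrafilter_correspondence:
  fixes as bs :: "nat \<Rightarrow> 'm list"
  assumes inf: "infinite (UNIV :: 'v set)" and A: "A \<noteq> {}" "A \<lesssim> (UNIV :: 'v set)"
    and seq: "\<And>n. E n (as n) (bs n)" "\<And>n. as n \<in> tuples k A" "\<And>n. bs n \<in> tuples k A"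
  obtains U :: "'v set set filter" and P aa bb where "is_ultrafilter U"
    "P \<subseteq> (UNIV \<rightarrow> A) \<times> (UNIV \<rightarrow> A)" "fst ` P = (UNIV \<rightarrow> A)" "snd ` P = (UNIV \<rightarrow> A)"
    "\<And>n ps. ps \<in> lists P \<Longrightarrow> eventually (\<lambda>i. i \<in> agree n ps) U"
    "length aa = k" "length bb = k" "set (zip aa bb) \<subseteq> P"
    "\<And>i. \<exists>n. map (\<lambda>x. x i) aa = as n \<and> map (\<lambda>x. x i) bb = bs n"
proof -
  let ?I = "UNIV :: 'v set set set"
  have vi: "(UNIV :: 'v set) \<lesssim> ?I"
    using lepoll_trans[OF lepoll_Pow_self[of "UNIV :: 'v set"], of "UNIV :: 'v set set set"]
      lepoll_Pow_self[of "UNIV :: 'v set set"] by simp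
  have infi: "infinite ?I" using inf vi infinite_lepoll by blast
  obtain dec :: "'v set set \<Rightarrow> ('v \<Rightarrow> 'v set set) \<times> ('v \<Rightarrow> 'v set) \<times> ('v \<Rightarrow> 'v)"
    where "surj dec" using ex_code_functions[OF inf] ..
  from ex_independent_family[OF this inf]
  obtain F :: "'v set set set \<Rightarrow> 'v set set \<Rightarrow> 'v" where F: "large F UNIV UNIV" ..
  obtain h :: "'v \<Rightarrow> 'm" where h: "range h = A" using surj_from_lepoll[OF A(2) A(1)] ..
  have "(UNIV \<rightarrow> A :: ('v set set \<Rightarrow> 'm) set) \<lesssim> (UNIV :: 'v set set set set)"
    by (rule funcset_lepoll_Pow[OF infi lepoll_trans[OF A(2) vi]])
  moreover have "(UNIV \<rightarrow> A :: ('v set set \<Rightarrow> 'm) set) \<noteq> {}" using A(1) by auto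
  ultimately have "\<exists>en :: 'v set set set \<Rightarrow> 'v set set \<Rightarrow> 'm. range en = UNIV \<rightarrow> A"
    by (rule surj_from_lepoll)
  then obtain en :: "'v set set set \<Rightarrow> 'v set set \<Rightarrow> 'm" where en: "range en = UNIV \<rightarrow> A" ..
  have "(UNIV :: nat set) \<lesssim> (UNIV :: 'v set)" using inf infinite_le_lepoll by blast
  from surj_from_lepoll[OF this UNIV_not_empty] obtain \<nu> :: "'v \<Rightarrow> nat" where \<nu>: "surj \<nu>" ..
  \<comment> \<open>One member of the independent family is sacrificed to define \<open>N\<close>.
    Prescribing its value makes \<open>N\<close> equal to any given \<open>n\<close> without
    disturbing the other functions, hence the initial set \<open>{x0}\<close> of spent
    indices.\<close>
  define x0 :: "'v set set set" where "x0 = {}"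
  define N where "N = (\<lambda>i. \<nu> (F x0 i))"
  have lN: "large F (UNIV - {x0}) {i. N i = n}" for n
    unfolding large_def
  proof (intro allI impI)
    fix S s assume S: "S \<subseteq> UNIV - {x0}" "S \<lesssim> (UNIV :: 'v set)"
    obtain v where v: "\<nu> v = n" using surjD[OF \<nu>, of n] by metis
    have "insert x0 S \<lesssim> (UNIV :: 'v set)"
      using Un_lepoll_infinite[OF inf finite_lepoll_infinite[OF inf] S(2), of "{x0}"] by simp
    then obtain i where i: "\<forall>x\<in>insert x0 S. F x i = (s(x0 := v)) x"
      using F unfolding large_def by blast
    have "N i = n" using i v by (simp add: N_def)
    moreover have "\<forall>x\<in>S. F x i = s x" using i S(1) by auto
    ultimately show "\<exists>i\<in>{i. N i = n}. \<forall>x\<in>S. F x i = s x" by blast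
  qed
  define aa where "aa = map (\<lambda>j i. as (N i) ! j) [0..<k]"
  define bb where "bb = map (\<lambda>j i. bs (N i) ! j) [0..<k]"
  have len: "length (as n) = k" "length (bs n) = k" for n using seq by (auto simp: tuples_def)
  have len': "length aa = k" "length bb = k" by (simp_all add: aa_def bb_def)
  have ev: "map (\<lambda>x. x i) aa = as (N i)" "map (\<lambda>x. x i) bb = bs (N i)" for i
    by (auto simp: aa_def bb_def len intro!: nth_equalityI)
  define P0 where "P0 = set (zip aa bb)"
  have zip: "map (\<lambda>p. fst p i) (zip aa bb) = as (N i)" "map (\<lambda>p. snd p i) (zip aa bb) = bs (N i)" for i
  proof -
    have "map (\<lambda>p. fst p i) (zip aa bb) = map (\<lambda>x. x i) (map fst (zip aa bb))"
      "map (\<lambda>p. snd p i) (zip aa bb) = map (\<lambda>x. x i) (map snd (zip aa bb))" by simp_all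
    then show "map (\<lambda>p. fst p i) (zip aa bb) = as (N i)" "map (\<lambda>p. snd p i) (zip aa bb) = bs (N i)"
      by (simp_all add: len' ev del: map_map)
  qed
  have P0: "P0 \<subseteq> (UNIV \<rightarrow> A) \<times> (UNIV \<rightarrow> A)"
  proof
    fix p assume "p \<in> P0"
    then obtain j where "j < k" "p = (\<lambda>i. as (N i) ! j, \<lambda>i. bs (N i) ! j)"
      by (auto simp: P0_def in_set_zip aa_def bb_def)
    moreover have "as n ! j \<in> A" "bs n ! j \<in> A" if "j < k" for n
      using seq(2,3)[of n] that by (auto simp: tuples_def)
    ultimately show "p \<in> (UNIV \<rightarrow> A) \<times> (UNIV \<rightarrow> A)" by auto
  qed
  have ext: "extendible F (UNIV - {x0}) P0"
    unfolding extendible_def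
  proof (intro allI ballI)
    fix n ps assume "ps \<in> lists P0"
    then have "agree n (zip aa bb) \<subseteq> agree n ps" by (intro agree_subset) (auto simp: P0_def)
    \<comment> \<open>Where \<open>N i = n\<close>, the tuples are \<open>as n\<close> and
      \<open>bs n\<close>, which satisfy \<open>E n\<close> by assumption; so a large set of indices
      meets each condition.\<close>
    moreover have "{i. N i = n} \<subseteq> agree n (zip aa bb)"
      using seq(1) by (auto simp: agree_def zip)
    ultimately show "large F (UNIV - {x0}) (agree n ps)"
      by (intro large_mono[OF lN]) auto
  qed
  have "finite P0" by (simp add: P0_def)
  moreover have "finite {x0}" by simp
  ultimately have "\<exists>P. P0 \<subseteq> P \<and> P \<subseteq> (UNIV \<rightarrow> A) \<times> (UNIV \<rightarrow> A) \<and>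
    fst ` P = (UNIV \<rightarrow> A) \<and> snd ` P = (UNIV \<rightarrow> A) \<and> (\<forall>n. \<forall>ps\<in>lists P. agree n ps \<noteq> {})"
    by (rule ex_total_extension[OF inf vi h en _ P0 _ ext])
  then obtain P where PP: "P0 \<subseteq> P \<and> P \<subseteq> (UNIV \<rightarrow> A) \<times> (UNIV \<rightarrow> A) \<and>
    fst ` P = (UNIV \<rightarrow> A) \<and> snd ` P = (UNIV \<rightarrow> A) \<and> (\<forall>n. \<forall>ps\<in>lists P. agree n ps \<noteq> {})" ..
  then have P: "P0 \<subseteq> P" "P \<subseteq> (UNIV \<rightarrow> A) \<times> (UNIV \<rightarrow> A)" "fst ` P = (UNIV \<rightarrow> A)"
    "snd ` P = (UNIV \<rightarrow> A)" "\<And>n ps. ps \<in> lists P \<Longrightarrow> agree n ps \<noteq> {}" by metis+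
  let ?Z = "(\<lambda>(n, ps). agree n ps) ` (UNIV \<times> lists P)"
  have "\<exists>U. is_ultrafilter U \<and> (\<forall>Z\<in>?Z. eventually (\<lambda>i. i \<in> Z) U)"
  proof (rule ex_ultrafilter_base)
    show "?Z \<noteq> {}" "{} \<notin> ?Z" using P(5) by auto
    fix Z W assume "Z \<in> ?Z" "W \<in> ?Z"
    then obtain n ps m qs where *: "ps \<in> lists P" "qs \<in> lists P" "Z = agree n ps" "W = agree m qs"
      by auto
    have "agree (max n m) (ps @ qs) \<subseteq> agree n ps" "agree (max n m) (ps @ qs) \<subseteq> agree m qs"
      by (intro agree_subset; simp)+
    then show "\<exists>V\<in>?Z. V \<subseteq> Z \<inter> W"
      using * by (intro bexI[of _ "agree (max n m) (ps @ qs)"] image_eqI[of _ _ "(max n m, ps @ qs)"]) auto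
  qed
  then obtain U where U: "is_ultrafilter U" "\<forall>Z\<in>?Z. eventually (\<lambda>i. i \<in> Z) U" by blast
  have "eventually (\<lambda>i. i \<in> agree n ps) U" if "ps \<in> lists P" for n ps
    using bspec[OF U(2), of "agree n ps"] that by (auto simp: image_iff)
  moreover have "\<exists>n. map (\<lambda>x. x i) aa = as n \<and> map (\<lambda>x. x i) bb = bs n" for i
    using ev by blast
  ultimately show thesis
    using that[OF U(1) P(2-4) _ len'] P(1) unfolding P0_def by blast
qed

end

section \<open>Ehrenfeucht-Fraisse equivalence and definability\<close>

lemma val_cong: "(\<And>n. n \<in> fv_tm t \<Longrightarrow> e n = e' n) \<Longrightarrow> val M e t = val M e' t"
proof (induction t)
  case (Fn f ts)
  have "val M e t = val M e' t" if "t \<in> set ts" for t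
    by (rule Fn.IH[OF that]) (use Fn.prems that in auto)
  then have "map (val M e) ts = map (val M e') ts" by simp
  then show ?case by (metis val.simps(2))
qed simp

lemma sat_cong: "(\<And>n. n \<in> fv \<phi> \<Longrightarrow> e n = e' n) \<Longrightarrow> sat M e \<phi> \<longleftrightarrow> sat M e' \<phi>"
proof (induction \<phi> arbitrary: e e')
  case (Equal s t)
  then show ?case using val_cong[of s e e' M] val_cong[of t e e' M] by auto
next
  case (Rel p ts)
  then have "map (val M e) ts = map (val M e') ts" by (auto intro!: val_cong)
  then show ?case by (metis sat.simps(2))
next
  case (Neg \<phi>)
  then show ?case by (metis fv.simps(3) sat.simps(3))
next
  case (Conj \<phi> \<psi>)
  then have "sat M e \<phi> = sat M e' \<phi>" "sat M e \<psi> = sat M e' \<psi>" by (metis UnCI fv.simps(4))+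
  then show ?case by simp
next
  case (Exists n \<phi>)
  have "sat M (e(n := x)) \<phi> = sat M (e'(n := x)) \<phi>" for x
    by (rule Exists.IH) (use Exists.prems in auto)
  then show ?case by simp
qed

text \<open>Duplicator wins the Ehrenfeucht-Fraisse game with \<open>n\<close> rounds from this
  position. Round 0 compares equality and predicates only, as is right for the relational language
  of a geometry. Including the previous level makes the relation decreasing in \<open>n\<close> by
  definition.\<close>

primrec ef_equiv ::
    "('f, 'p) lang \<Rightarrow> ('f, 'p, 'u) fostruct \<Rightarrow> nat \<Rightarrow> 'u list \<Rightarrow> 'u list \<Rightarrow> bool" where
  "ef_equiv L M 0 xs ys \<longleftrightarrow>
     (\<forall>i<length xs. \<forall>j<length xs. xs ! i = xs ! j \<longleftrightarrow> ys ! i = ys ! j) \<and>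
     (\<forall>p\<in>psyms L. \<forall>js\<in>tuples (parity L p) {..<length xs}.
        map (nth xs) js \<in> pint M p \<longleftrightarrow> map (nth ys) js \<in> pint M p)"
| "ef_equiv L M (Suc n) xs ys \<longleftrightarrow> ef_equiv L M n xs ys \<and>
     (\<forall>x\<in>univ M. \<exists>y\<in>univ M. ef_equiv L M n (xs @ [x]) (ys @ [y])) \<and>
     (\<forall>y\<in>univ M. \<exists>x\<in>univ M. ef_equiv L M n (xs @ [x]) (ys @ [y]))"

lemma ef_equiv_reindex:
  assumes "ef_equiv L M n xs ys" "length xs = length ys" "set js \<subseteq> {..<length xs}"
  shows "ef_equiv L M n (map (nth xs) js) (map (nth ys) js)"
  using assms
proof (induction n arbitrary: xs ys js)
  case 0
  have nth: "js ! i < length xs" if "i < length js" for i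
    using 0(3) that nth_mem by blast
  have comp: "map (nth (map (nth zs) js)) ks = map (nth zs) (map (nth js) ks)"
    if "set ks \<subseteq> {..<length js}" for zs :: "'c list" and ks
    using that by auto
  show ?case unfolding ef_equiv.simps
  proof (intro conjI allI impI ballI)
    fix i j assume "i < length (map (nth xs) js)" "j < length (map (nth xs) js)"
    then show "map (nth xs) js ! i = map (nth xs) js ! j \<longleftrightarrow> map (nth ys) js ! i = map (nth ys) js ! j"
      using 0(1) nth by simp
  next
    fix p ks assume p: "p \<in> psyms L" and ks: "ks \<in> tuples (parity L p) {..<length (map (nth xs) js)}"
    then have "map (nth js) ks \<in> tuples (parity L p) {..<length xs}"
      using nth by (auto simp: tuples_def)
    then show "map (nth (map (nth xs) js)) ks \<in> pint M p \<longleftrightarrow> map (nth (map (nth ys) js)) ks \<in> pint M p"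
      using 0(1) p comp[of ks xs] comp[of ks ys] ks by (simp add: tuples_def del: map_map map_eq_conv)
  qed
next
  case (Suc n)
  have ext: "ef_equiv L M n (map (nth xs) js @ [x]) (map (nth ys) js @ [y])"
    if "ef_equiv L M n (xs @ [x]) (ys @ [y])" for x y
  proof -
    \<comment> \<open>The element played last sits at position \<open>length xs\<close> on both
      sides, so that number is appended to \<open>js\<close>.\<close>
    have "ef_equiv L M n (map (nth (xs @ [x])) (js @ [length xs])) (map (nth (ys @ [y])) (js @ [length xs]))"
      using Suc.prems that by (intro Suc.IH) auto
    moreover have "map (nth (xs @ [x])) (js @ [length xs]) = map (nth xs) js @ [x]"
      "map (nth (ys @ [y])) (js @ [length xs]) = map (nth ys) js @ [y]"
      using Suc.prems by (auto simp: nth_append)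
    ultimately show ?thesis by metis
  qed
  show ?case unfolding ef_equiv.simps
  proof (intro conjI ballI)
    show "ef_equiv L M n (map (nth xs) js) (map (nth ys) js)" using Suc by simp
    show "\<exists>y\<in>univ M. ef_equiv L M n (map (nth xs) js @ [x]) (map (nth ys) js @ [y])"
      if "x \<in> univ M" for x using Suc.prems(1) that ext by (simp, blast)
    show "\<exists>x\<in>univ M. ef_equiv L M n (map (nth xs) js @ [x]) (map (nth ys) js @ [y])"
      if "y \<in> univ M" for y using Suc.prems(1) that ext by (simp, blast)
  qed
qed

lemma back_forth_system_ef_equiv:
  "back_forth_system (univ M) (\<lambda>n xs ys. length xs = length ys \<and> ef_equiv L M n xs ys)"
  by unfold_locales (auto simp: ef_equiv_reindex)

text \<open>The empty conjunction has to be a true formula without free variables, so that it is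
  admissible for arity 0 as well; on a nonempty universe the quantified equation is one.\<close>

primrec conj_list :: "('f, 'p) fm list \<Rightarrow> ('f, 'p) fm" where
  "conj_list [] = Exists 0 (Equal (Var 0) (Var 0))"
| "conj_list (\<phi> # \<phi>s) = Conj \<phi> (conj_list \<phi>s)"

lemma sat_conj_list: "univ M \<noteq> {} \<Longrightarrow> sat M e (conj_list \<phi>s) \<longleftrightarrow> (\<forall>\<phi>\<in>set \<phi>s. sat M e \<phi>)"
  by (induction \<phi>s) auto

lemma is_formula_conj_list: "is_formula L k (conj_list \<phi>s) \<longleftrightarrow> (\<forall>\<phi>\<in>set \<phi>s. is_formula L k \<phi>)"
  by (induction \<phi>s) (auto simp: is_formula_def)

lemma is_formula_Neg: "is_formula L k (Neg \<phi>) \<longleftrightarrow> is_formula L k \<phi>"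
  by (simp add: is_formula_def)

lemma is_formula_Exists: "is_formula L (Suc k) \<phi> \<Longrightarrow> is_formula L k (Exists k \<phi>)"
  by (auto simp: is_formula_def less_Suc_eq)

text \<open>A Hintikka-style description: it pins down the truth value of every formula of a finite
  list, \<open>S\<close> being the set of the true ones.\<close>

definition complete_conj :: "('f, 'p) fm list \<Rightarrow> ('f, 'p) fm set \<Rightarrow> ('f, 'p) fm" where
  "complete_conj \<phi>s S = conj_list (map (\<lambda>\<phi>. if \<phi> \<in> S then \<phi> else Neg \<phi>) \<phi>s)"

lemma sat_complete_conj:
  "univ M \<noteq> {} \<Longrightarrow> sat M e (complete_conj \<phi>s S) \<longleftrightarrow> (\<forall>\<phi>\<in>set \<phi>s. sat M e \<phi> \<longleftrightarrow> \<phi> \<in> S)"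
proof -
  assume M: "univ M \<noteq> {}"
  have "sat M e (if \<phi> \<in> S then \<phi> else Neg \<phi>) \<longleftrightarrow> (sat M e \<phi> \<longleftrightarrow> \<phi> \<in> S)" for \<phi> by simp
  then show ?thesis by (simp only: complete_conj_def sat_conj_list[OF M] set_map ball_simps)
qed

lemma is_formula_complete_conj:
  "\<forall>\<phi>\<in>set \<phi>s. is_formula L k \<phi> \<Longrightarrow> is_formula L k (complete_conj \<phi>s S)"
  by (auto simp only: complete_conj_def is_formula_conj_list is_formula_Neg set_map ball_simps
      split: if_split)

lemma finite_tuples: "finite A \<Longrightarrow> finite (tuples n A)"
  using finite_lists_length_eq[of A n] by (simp add: tuples_def conj_commute)

text \<open>Finiteness of the set of predicate symbols enters here: there are finitely many atomic
  formulas in \<open>k\<close> variables, and from finitely many formulas in \<open>Suc k\<close>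
  variables only finitely many complete descriptions arise, so every level of the game is governed
  by a finite list.\<close>

lemma ex_formulas_ef_equiv:
  fixes L :: "('f, 'p) lang"
  assumes "univ M \<noteq> {}" "finite (psyms L)"
  shows "\<exists>\<phi>s. (\<forall>\<phi>\<in>set \<phi>s. is_formula L k \<phi>) \<and>
    (\<forall>xs\<in>tuples k (univ M). \<forall>ys\<in>tuples k (univ M).
      (\<forall>\<phi>\<in>set \<phi>s. sat M (nth xs) \<phi> \<longleftrightarrow> sat M (nth ys) \<phi>) \<longrightarrow> ef_equiv L M n xs ys)"
proof (induction n arbitrary: k)
  case 0
  let ?\<Phi> = "(\<lambda>(i, j). Equal (Var i) (Var j) :: ('f, 'p) fm) ` ({..<k} \<times> {..<k}) \<union>
    (\<Union>p\<in>psyms L. (\<lambda>js. Rel p (map Var js)) ` tuples (parity L p) {..<k})"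
  have "finite ?\<Phi>" using assms by (auto intro: finite_tuples)
  from finite_list[OF this] obtain \<phi>s where \<phi>s: "set \<phi>s = ?\<Phi>" ..
  have "\<forall>\<phi>\<in>set \<phi>s. is_formula L k \<phi>"
    unfolding \<phi>s by (auto simp: is_formula_def tuples_def list_all_iff)
  moreover have "ef_equiv L M 0 xs ys"
    if k: "xs \<in> tuples k (univ M)" "ys \<in> tuples k (univ M)"
      and eq: "\<forall>\<phi>\<in>set \<phi>s. sat M (nth xs) \<phi> \<longleftrightarrow> sat M (nth ys) \<phi>" for xs ys
  proof -
    have "xs ! i = xs ! j \<longleftrightarrow> ys ! i = ys ! j" if "i < k" "j < k" for i j
    proof -
      have "Equal (Var i) (Var j) \<in> set \<phi>s"
        unfolding \<phi>s by (intro UnI1 image_eqI[of _ _ "(i, j)"]) (simp_all add: that)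
      from bspec[OF eq this] show ?thesis by simp
    qed
    moreover have "map (nth xs) js \<in> pint M p \<longleftrightarrow> map (nth ys) js \<in> pint M p"
      if "p \<in> psyms L" "js \<in> tuples (parity L p) {..<k}" for p js
    proof -
      have "Rel p (map Var js) \<in> set \<phi>s"
        unfolding \<phi>s by (intro UnI2 UN_I[of p] image_eqI[of _ _ js] that refl)
      from bspec[OF eq this] show ?thesis by (simp add: comp_def)
    qed
    ultimately show ?thesis using k by (simp add: tuples_def)
  qed
  ultimately show ?case by blast
next
  case (Suc n)
  obtain \<phi>s where \<phi>s: "\<forall>\<phi>\<in>set \<phi>s. is_formula L k \<phi>"
    "\<And>xs ys. xs \<in> tuples k (univ M) \<Longrightarrow> ys \<in> tuples k (univ M) \<Longrightarrow>
      \<forall>\<phi>\<in>set \<phi>s. sat M (nth xs) \<phi> \<longleftrightarrow> sat M (nth ys) \<phi> \<Longrightarrow> ef_equiv L M n xs ys"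
    using Suc.IH[of k] by blast
  obtain \<psi>s where \<psi>s: "\<forall>\<phi>\<in>set \<psi>s. is_formula L (Suc k) \<phi>"
    "\<And>xs ys. xs \<in> tuples (Suc k) (univ M) \<Longrightarrow> ys \<in> tuples (Suc k) (univ M) \<Longrightarrow>
      \<forall>\<phi>\<in>set \<psi>s. sat M (nth xs) \<phi> \<longleftrightarrow> sat M (nth ys) \<phi> \<Longrightarrow> ef_equiv L M n xs ys"
    using Suc.IH[of "Suc k"] by blast
  \<comment> \<open>Says which complete descriptions are realised by some choice of the next
    element; variable \<open>k\<close> stands for that element.\<close>
  let ?\<Theta> = "(\<lambda>S. Exists k (complete_conj \<psi>s S)) ` Pow (set \<psi>s)"
  have "finite (set \<phi>s \<union> ?\<Theta>)" by simp
  from finite_list[OF this] obtain \<theta>s where \<theta>s: "set \<theta>s = set \<phi>s \<union> ?\<Theta>" ..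
  have upd: "sat M ((nth xs)(k := x)) \<phi> \<longleftrightarrow> sat M (nth (xs @ [x])) \<phi>"
    if "xs \<in> tuples k (univ M)" "is_formula L (Suc k) \<phi>" for xs x \<phi>
    by (rule sat_cong) (use that in \<open>auto simp: is_formula_def tuples_def nth_append less_Suc_eq\<close>)
  \<comment> \<open>Both orders of the pair are recorded, so that the back condition follows by
    exchanging \<open>xs\<close> and \<open>ys\<close>.\<close>
  have step: "\<exists>y\<in>univ M. ef_equiv L M n (xs @ [x]) (ys @ [y]) \<and> ef_equiv L M n (ys @ [y]) (xs @ [x])"
    if k: "xs \<in> tuples k (univ M)" "ys \<in> tuples k (univ M)" and x: "x \<in> univ M"
      and eq: "\<forall>\<phi>\<in>set \<theta>s. sat M (nth xs) \<phi> \<longleftrightarrow> sat M (nth ys) \<phi>" for xs ys x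
  proof -
    define S where "S = {\<phi> \<in> set \<psi>s. sat M (nth (xs @ [x])) \<phi>}"
    have form: "is_formula L (Suc k) (complete_conj \<psi>s S)"
      using \<psi>s(1) by (rule is_formula_complete_conj)
    have "sat M ((nth xs)(k := x)) (complete_conj \<psi>s S)"
      unfolding upd[OF k(1) form] unfolding sat_complete_conj[OF assms(1)] by (auto simp: S_def)
    then have "sat M (nth xs) (Exists k (complete_conj \<psi>s S))" using x by auto
    moreover have "Exists k (complete_conj \<psi>s S) \<in> set \<theta>s" by (auto simp: \<theta>s S_def)
    ultimately have "sat M (nth ys) (Exists k (complete_conj \<psi>s S))" using bspec[OF eq] by metis
    then obtain y where y: "y \<in> univ M" "sat M ((nth ys)(k := y)) (complete_conj \<psi>s S)" by auto
    from y(2) have "\<forall>\<phi>\<in>set \<psi>s. sat M (nth (ys @ [y])) \<phi> \<longleftrightarrow> sat M (nth (xs @ [x])) \<phi>"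
      unfolding upd[OF k(2) form] unfolding sat_complete_conj[OF assms(1)] by (auto simp: S_def)
    moreover have "xs @ [x] \<in> tuples (Suc k) (univ M)" "ys @ [y] \<in> tuples (Suc k) (univ M)"
      using k x y by (auto simp: tuples_def)
    ultimately show ?thesis using y(1) \<psi>s(2) by (intro bexI[of _ y] conjI) auto
  qed
  have "\<forall>\<phi>\<in>set \<theta>s. is_formula L k \<phi>"
    using \<phi>s(1) \<psi>s(1) unfolding \<theta>s by (auto intro!: is_formula_Exists is_formula_complete_conj)
  moreover have "ef_equiv L M (Suc n) xs ys"
    if k: "xs \<in> tuples k (univ M)" "ys \<in> tuples k (univ M)"
      and eq: "\<forall>\<phi>\<in>set \<theta>s. sat M (nth xs) \<phi> \<longleftrightarrow> sat M (nth ys) \<phi>" for xs ys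
  proof -
    have "ef_equiv L M n xs ys" using \<phi>s(2)[OF k] eq unfolding \<theta>s by blast
    moreover have "\<exists>y\<in>univ M. ef_equiv L M n (xs @ [x]) (ys @ [y])" if "x \<in> univ M" for x
      using step[OF k that eq] by blast
    moreover have "\<exists>x\<in>univ M. ef_equiv L M n (xs @ [x]) (ys @ [y])" if "y \<in> univ M" for y
    proof -
      have "\<forall>\<phi>\<in>set \<theta>s. sat M (nth ys) \<phi> \<longleftrightarrow> sat M (nth xs) \<phi>" using eq by blast
      from step[OF k(2,1) that this] show ?thesis by blast
    qed
    ultimately show ?thesis by simp
  qed
  ultimately show ?case by blast
qed

text \<open>\<open>R\<close> is a union of classes of tuples that agree on the finite list
  \<open>\<phi>s\<close>. Although \<open>R\<close> may be infinite, only finitely many descriptions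
  occur, and their disjunction, written with \<open>Neg\<close> and \<open>conj_list\<close>,
  defines \<open>R\<close>.\<close>

lemma definable_if_ef_invariant:
  assumes M: "univ M \<noteq> {}" "finite (psyms L)" and R: "R \<subseteq> tuples k (univ M)"
    and inv: "\<And>xs ys. xs \<in> R \<Longrightarrow> ys \<in> tuples k (univ M) \<Longrightarrow> ef_equiv L M n xs ys \<Longrightarrow> ys \<in> R"
  shows "definable L M k R"
proof -
  obtain \<phi>s where \<phi>s: "\<forall>\<phi>\<in>set \<phi>s. is_formula L k \<phi>"
    "\<And>xs ys. xs \<in> tuples k (univ M) \<Longrightarrow> ys \<in> tuples k (univ M) \<Longrightarrow>
      \<forall>\<phi>\<in>set \<phi>s. sat M (nth xs) \<phi> \<longleftrightarrow> sat M (nth ys) \<phi> \<Longrightarrow> ef_equiv L M n xs ys"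
    using ex_formulas_ef_equiv[OF M] by blast
  define ty where "ty = (\<lambda>xs. {\<phi> \<in> set \<phi>s. sat M (nth xs) \<phi>})"
  have "(\<lambda>xs. Neg (complete_conj \<phi>s (ty xs))) ` R \<subseteq> (\<lambda>S. Neg (complete_conj \<phi>s S)) ` Pow (set \<phi>s)"
    unfolding ty_def by blast
  then have "finite ((\<lambda>xs. Neg (complete_conj \<phi>s (ty xs))) ` R)"
    by (rule finite_subset) simp
  from finite_list[OF this] obtain \<chi>s where \<chi>s: "set \<chi>s = (\<lambda>xs. Neg (complete_conj \<phi>s (ty xs))) ` R" ..
  let ?\<psi> = "Neg (conj_list \<chi>s)"
  have "is_formula L k ?\<psi>"
    using \<phi>s(1) by (auto simp: is_formula_Neg is_formula_conj_list \<chi>s intro: is_formula_complete_conj)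
  moreover have "sat M (nth ys) ?\<psi> \<longleftrightarrow> ys \<in> R" if ys: "ys \<in> tuples k (univ M)" for ys
  proof -
    have "sat M (nth ys) ?\<psi> \<longleftrightarrow> (\<exists>xs\<in>R. \<forall>\<phi>\<in>set \<phi>s. sat M (nth ys) \<phi> \<longleftrightarrow> \<phi> \<in> ty xs)"
      by (auto simp: sat_conj_list[OF M(1)] \<chi>s sat_complete_conj[OF M(1)])
    also have "\<dots> \<longleftrightarrow> (\<exists>xs\<in>R. \<forall>\<phi>\<in>set \<phi>s. sat M (nth xs) \<phi> \<longleftrightarrow> sat M (nth ys) \<phi>)"
      by (auto simp: ty_def)
    also have "\<dots> \<longleftrightarrow> ys \<in> R"
      using inv[OF _ ys] \<phi>s(2)[OF _ ys] R by blast
    finally show ?thesis .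
  qed
  then have "R = defined_rel M k ?\<psi>" using R by (auto simp: defined_rel_def simp del: sat.simps)
  ultimately show ?thesis unfolding definable_def by blast
qed

lemma ef_equiv_extend:
  assumes "ef_equiv L M (n + length zs) xs ys" "set zs \<subseteq> univ M"
  shows "\<exists>ws. length ws = length zs \<and> set ws \<subseteq> univ M \<and> ef_equiv L M n (xs @ zs) (ys @ ws)"
  using assms
proof (induction zs arbitrary: xs ys)
  case (Cons z zs)
  then obtain w where w: "w \<in> univ M" "ef_equiv L M (n + length zs) (xs @ [z]) (ys @ [w])" by auto
  from Cons.IH[OF w(2)] obtain ws where "length ws = length zs" "set ws \<subseteq> univ M"
    "ef_equiv L M n (xs @ z # zs) (ys @ w # ws)" using Cons.prems by auto
  then show ?case using w by (intro exI[of _ "w # ws"]) auto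
qed auto

text \<open>Spoiler enumerates the whole universe, which takes \<open>card (univ M)\<close> rounds.
  The answers define an injection of a finite set into itself, hence a bijection.\<close>

lemma ex_bij_if_ef_equiv:
  assumes fin: "finite (univ M)" and ef: "ef_equiv L M (card (univ M)) xs ys"
    and xs: "xs \<in> tuples k (univ M)" and ys: "ys \<in> tuples k (univ M)"
  shows "\<exists>\<alpha>. bij_betw \<alpha> (univ M) (univ M) \<and> map \<alpha> xs = ys \<and>
    (\<forall>vs\<in>lists (univ M). ef_equiv L M 0 vs (map \<alpha> vs))"
proof -
  obtain zs where zs: "set zs = univ M" "distinct zs" using finite_distinct_list[OF fin] by blast
  then have "length zs = card (univ M)" using distinct_card by fastforce
  then obtain ws where ws: "length ws = length zs" "set ws \<subseteq> univ M" "ef_equiv L M 0 (xs @ zs) (ys @ ws)"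
    using ef_equiv_extend[of L M 0 zs xs ys] ef zs by auto
  let ?xs = "xs @ zs" and ?ys = "ys @ ws"
  have len: "length ?ys = length ?xs" using xs ys ws by (simp add: tuples_def)
  have setx: "set ?xs = univ M" using xs zs by (auto simp: tuples_def)
  have eq: "?xs ! i = ?xs ! j \<longleftrightarrow> ?ys ! i = ?ys ! j" if "i < length ?xs" "j < length ?xs" for i j
    using ws(3) that by simp
  define k where "k = (\<lambda>x. SOME j. j < length ?xs \<and> ?xs ! j = x)"
  have k: "k x < length ?xs \<and> ?xs ! k x = x" if "x \<in> univ M" for x
    unfolding k_def by (rule someI_ex) (use that setx in \<open>metis in_set_conv_nth\<close>)
  define \<alpha> where "\<alpha> = (\<lambda>x. ?ys ! k x)"
  have \<alpha>_nth: "\<alpha> (?xs ! j) = ?ys ! j" if "j < length ?xs" for j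
  proof -
    have "?xs ! j \<in> univ M" using that setx nth_mem by blast
    then show ?thesis using k eq[of "k (?xs ! j)" j] that unfolding \<alpha>_def by blast
  qed
  have "inj_on \<alpha> (univ M)"
    by (rule inj_onI) (metis \<alpha>_def eq k)
  moreover have "\<alpha> ` univ M \<subseteq> univ M"
  proof -
    have "set ?ys \<subseteq> univ M" using ws ys by (auto simp: tuples_def)
    moreover have "\<alpha> x \<in> set ?ys" if "x \<in> univ M" for x
      unfolding \<alpha>_def using k[OF that] len by (intro nth_mem) simp
    ultimately show ?thesis by blast
  qed
  ultimately have "bij_betw \<alpha> (univ M) (univ M)"
    using fin by (simp add: bij_betw_def endo_inj_surj)
  moreover have "map \<alpha> xs = ys"
  proof (rule nth_equalityI)
    fix i assume "i < length (map \<alpha> xs)"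
    then show "map \<alpha> xs ! i = ys ! i"
      using \<alpha>_nth[of i] xs ys by (simp add: nth_append tuples_def)
  qed (use xs ys in \<open>simp add: tuples_def\<close>)
  moreover have "ef_equiv L M 0 vs (map \<alpha> vs)" if "vs \<in> lists (univ M)" for vs
  proof -
    have "set (map k vs) \<subseteq> {..<length ?xs}" using k that by auto
    from ef_equiv_reindex[OF ws(3) len[symmetric] this]
    have "ef_equiv L M 0 (map (nth ?xs) (map k vs)) (map (nth ?ys) (map k vs))" .
    moreover have "map (nth ?xs) (map k vs) = vs" using k that by (auto intro!: map_idI)
    moreover have "map (nth ?ys) (map k vs) = map \<alpha> vs" by (simp add: \<alpha>_def)
    ultimately show ?thesis by metis
  qed
  ultimately show ?thesis by blast
qed

text \<open>For each \<open>n\<close> undefinability yields a pair of tuples, one in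
  \<open>R\<close> and one outside, that are equivalent for \<open>n\<close> rounds. Over an
  infinite universe these sequences feed Shelah's construction; the independent family needs an
  infinite \<open>'v\<close>, so a finite universe is handled by the bijection obtained from a full
  game.\<close>

theorem ex_ultrafilter_correspondence_if_not_definable:
  assumes M: "univ M \<noteq> {}" "finite (psyms L)"
      "infinite (univ M) \<Longrightarrow> univ M \<lesssim> (UNIV :: 'v set)"
    and R: "R \<subseteq> tuples k (univ M)" "\<not> definable L M k R"
  obtains U :: "'v set set filter" and P aa bb where "is_ultrafilter U"
    "P \<subseteq> (UNIV \<rightarrow> univ M) \<times> (UNIV \<rightarrow> univ M)"
    "fst ` P = (UNIV \<rightarrow> univ M)" "snd ` P = (UNIV \<rightarrow> univ M)"
    "\<And>ps. ps \<in> lists P \<Longrightarrow>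
      eventually (\<lambda>i. ef_equiv L M 0 (map (\<lambda>p. fst p i) ps) (map (\<lambda>p. snd p i) ps)) U"
    "length aa = k" "length bb = k" "set (zip aa bb) \<subseteq> P"
    "\<And>i. map (\<lambda>x. x i) aa \<in> R" "\<And>i. map (\<lambda>x. x i) bb \<in> tuples k (univ M) - R"
proof -
  have "\<exists>xs ys. xs \<in> R \<and> ys \<in> tuples k (univ M) - R \<and> ef_equiv L M n xs ys" for n
    using definable_if_ef_invariant[OF M(1,2) R(1), of n] R(2) by blast
  then obtain as bs where seq: "\<And>n. as n \<in> R" "\<And>n. bs n \<in> tuples k (univ M) - R"
    "\<And>n. ef_equiv L M n (as n) (bs n)" by metis
  have seq': "as n \<in> tuples k (univ M)" "bs n \<in> tuples k (univ M)" for n using seq R(1) by auto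
  show thesis
  proof (cases "finite (univ M)")
    case True
    define n where "n = card (univ M)"
    obtain \<alpha> where \<alpha>: "bij_betw \<alpha> (univ M) (univ M)" "map \<alpha> (as n) = bs n"
      "\<And>vs. vs \<in> lists (univ M) \<Longrightarrow> ef_equiv L M 0 vs (map \<alpha> vs)"
      using ex_bij_if_ef_equiv[OF True seq(3)[of "card (univ M)"] seq'] unfolding n_def by blast
    \<comment> \<open>With a principal ultrafilter the ultrapower is a copy of \<open>M\<close>, so
      the graph of \<open>\<alpha>\<close> applied pointwise is the required correspondence;
      \<open>i0\<close> is an arbitrary index.\<close>
    define i0 :: "'v set set" where "i0 = {}"
    define U where "U = principal {i0}"
    define P where "P = (\<lambda>a. (a, \<lambda>i. \<alpha> (a i))) ` (UNIV \<rightarrow> univ M :: ('v set set \<Rightarrow> _) set)"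
    have aU: "\<alpha> x \<in> univ M" if "x \<in> univ M" for x using \<alpha>(1) that by (auto simp: bij_betw_def)
    define aa where "aa = map (\<lambda>x (i :: 'v set set). x) (as n)"
    define bb where "bb = map (\<lambda>x (i :: 'v set set). x) (bs n)"
    have "is_ultrafilter U" by (auto simp: U_def is_ultrafilter_def eventually_principal trivial_limit_def)
    moreover have "P \<subseteq> (UNIV \<rightarrow> univ M) \<times> (UNIV \<rightarrow> univ M)"
      using aU by (auto simp: P_def)
    moreover have "fst ` P = (UNIV \<rightarrow> univ M)" by (auto simp: P_def image_image)
    moreover have "snd ` P = (UNIV \<rightarrow> univ M)"
    proof (intro equalityI subsetI)
      fix b :: "'v set set \<Rightarrow> _" assume b: "b \<in> UNIV \<rightarrow> univ M"
      let ?a = "\<lambda>i. inv_into (univ M) \<alpha> (b i)"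
      have "\<alpha> ` univ M = univ M" using \<alpha>(1) by (simp add: bij_betw_def)
      then have "?a i \<in> univ M \<and> \<alpha> (?a i) = b i" for i
        using b by (metis PiE UNIV_I f_inv_into_f inv_into_into)
      then have "?a \<in> UNIV \<rightarrow> univ M" "b = (\<lambda>i. \<alpha> (?a i))" by auto
      then show "b \<in> snd ` P" unfolding P_def by (auto simp: image_iff simp del: Pi_UNIV intro!: bexI[of _ ?a])
    qed (use aU in \<open>auto simp: P_def Pi_iff\<close>)
    moreover have "eventually (\<lambda>i. ef_equiv L M 0 (map (\<lambda>p. fst p i) ps) (map (\<lambda>p. snd p i) ps)) U"
      if "ps \<in> lists P" for ps
    proof -
      have "fst p i0 \<in> univ M" "snd p i0 = \<alpha> (fst p i0)" if "p \<in> P" for p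
        using that by (auto simp: P_def Pi_iff)
      then have "map (\<lambda>p. snd p i0) ps = map \<alpha> (map (\<lambda>p. fst p i0) ps)"
        "map (\<lambda>p. fst p i0) ps \<in> lists (univ M)"
        using that by (simp_all add: in_lists_conv_set)
      then have "ef_equiv L M 0 (map (\<lambda>p. fst p i0) ps) (map (\<lambda>p. snd p i0) ps)"
        using \<alpha>(3) by metis
      then show ?thesis by (simp add: U_def eventually_principal del: ef_equiv.simps)
    qed
    moreover have "length aa = k" "length bb = k"
      using seq' by (auto simp: aa_def bb_def tuples_def)
    moreover have "set (zip aa bb) \<subseteq> P"
    proof
      fix p assume "p \<in> set (zip aa bb)"
      then obtain j where j: "j < length (as n)" "j < length (bs n)"
        "p = (\<lambda>i. as n ! j, \<lambda>i. bs n ! j)" by (auto simp: in_set_zip aa_def bb_def)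
      moreover have "bs n ! j = \<alpha> (as n ! j)" using j by (simp flip: \<alpha>(2))
      moreover have "as n ! j \<in> univ M" using seq'(1)[of n] j(1) by (auto simp: tuples_def)
      ultimately show "p \<in> P" by (auto simp: P_def)
    qed
    moreover have "map (\<lambda>x. x i) aa \<in> R" "map (\<lambda>x. x i) bb \<in> tuples k (univ M) - R" for i
      using seq by (simp_all add: aa_def bb_def comp_def)
    ultimately show thesis by (rule that)
  next
    case False
    note M3 = M(3)[OF False]
    have inf: "infinite (UNIV :: 'v set)" using infinite_lepoll[OF False M3] .
    interpret back_forth_system "univ M" "\<lambda>n xs ys. length xs = length ys \<and> ef_equiv L M n xs ys"
      by (rule back_forth_system_ef_equiv)
    have as_bs: "length (as n) = length (bs n) \<and> ef_equiv L M n (as n) (bs n)" for n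
      using seq(3) seq' by (simp add: tuples_def)
    obtain U :: "'v set set filter" and P aa bb where *: "is_ultrafilter U"
      "P \<subseteq> (UNIV \<rightarrow> univ M) \<times> (UNIV \<rightarrow> univ M)"
      "fst ` P = (UNIV \<rightarrow> univ M)" "snd ` P = (UNIV \<rightarrow> univ M)"
      "\<And>n ps. ps \<in> lists P \<Longrightarrow> eventually (\<lambda>i. i \<in> agree n ps) U"
      "length aa = k" "length bb = k" "set (zip aa bb) \<subseteq> P"
      "\<And>i. \<exists>n. map (\<lambda>x. x i) aa = as n \<and> map (\<lambda>x. x i) bb = bs n"
      by (rule ex_ultrafilter_correspondence[OF inf M(1) M3 as_bs seq'], rule that)
    have mem: "map (\<lambda>x. x i) aa \<in> R" "map (\<lambda>x. x i) bb \<in> tuples k (univ M) - R" for i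
      using *(9) seq by metis+
    have ev: "eventually (\<lambda>i. ef_equiv L M 0 (map (\<lambda>p. fst p i) ps) (map (\<lambda>p. snd p i) ps)) U"
      if "ps \<in> lists P" for ps
      using *(5)[of ps 0] that by (auto simp: agree_def simp del: ef_equiv.simps elim!: eventually_mono)
    show thesis by (rule that[OF *(1-4) ev *(6-8) mem])
  qed
qed

section \<open>The theorem of Los\<close>

lemma funcset_UNIV_iff: "x \<in> UNIV \<rightarrow> A \<longleftrightarrow> (\<forall>i. x i \<in> A)"
  by (auto simp: Pi_iff)

lemma eventually_not_ultrafilter:
  assumes "is_ultrafilter U"
  shows "eventually (\<lambda>i. \<not> P i) U \<longleftrightarrow> \<not> eventually P U"
proof
  assume "eventually (\<lambda>i. \<not> P i) U"
  then show "\<not> eventually P U"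
    using assms eventually_conj[of P U "\<lambda>i. \<not> P i"] by (auto simp: is_ultrafilter_def trivial_limit_def)
qed (use assms in \<open>auto simp: is_ultrafilter_def\<close>)

lemma eventually_disj_ultrafilter:
  assumes "is_ultrafilter U"
  shows "eventually (\<lambda>i. P i \<or> Q i) U \<longleftrightarrow> eventually P U \<or> eventually Q U"
proof -
  have "eventually (\<lambda>i. P i \<or> Q i) U \<longleftrightarrow> \<not> eventually (\<lambda>i. \<not> P i \<and> \<not> Q i) U"
    by (subst eventually_not_ultrafilter[OF assms, symmetric]) simp
  then show ?thesis by (simp add: eventually_conj_iff eventually_not_ultrafilter[OF assms])
qed

text \<open>Witnesses are chosen index by index; an element of \<open>A\<close> serves as default
  where there is none.\<close>

lemma eventually_ex_funcset:
  assumes "A \<noteq> {}"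
  shows "eventually (\<lambda>i. \<exists>x\<in>A. P i x) U \<longleftrightarrow> (\<exists>f\<in>UNIV \<rightarrow> A. eventually (\<lambda>i. P i (f i)) U)"
proof
  assume ev: "eventually (\<lambda>i. \<exists>x\<in>A. P i x) U"
  obtain a where a: "a \<in> A" using assms by blast
  have "\<exists>x. x \<in> A \<and> ((\<exists>x\<in>A. P i x) \<longrightarrow> P i x)" for i using a by blast
  then obtain f where f: "\<And>i. f i \<in> A \<and> ((\<exists>x\<in>A. P i x) \<longrightarrow> P i (f i))" by metis
  have "eventually (\<lambda>i. P i (f i)) U" using ev by (rule eventually_mono) (use f in blast)
  moreover have "f \<in> UNIV \<rightarrow> A" using f by auto
  ultimately show "\<exists>f\<in>UNIV \<rightarrow> A. eventually (\<lambda>i. P i (f i)) U" by blast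
next
  assume "\<exists>f\<in>UNIV \<rightarrow> A. eventually (\<lambda>i. P i (f i)) U"
  then obtain f where "f \<in> UNIV \<rightarrow> A" and ev: "eventually (\<lambda>i. P i (f i)) U" by blast
  from ev show "eventually (\<lambda>i. \<exists>x\<in>A. P i x) U"
    by (rule eventually_mono) (use \<open>f \<in> UNIV \<rightarrow> A\<close> in auto)
qed

lemma map_eq_iff_eventually:
  assumes q: "\<And>x y. x \<in> D \<Longrightarrow> y \<in> D \<Longrightarrow> q x = q y \<longleftrightarrow> eventually (\<lambda>i. x i = y i) U"
    and "length xs = length ys" "set xs \<subseteq> D" "set ys \<subseteq> D"
  shows "map q xs = map q ys \<longleftrightarrow> eventually (\<lambda>i. map (\<lambda>x. x i) xs = map (\<lambda>x. x i) ys) U"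
  using assms(2-4)
proof (induction rule: list_induct2)
  case (Cons x xs y ys)
  then show ?case using q[of x y] by (auto simp: eventually_conj_iff)
qed simp

lemma Aut_pint:
  "\<alpha> \<in> Aut L M \<Longrightarrow> p \<in> psyms L \<Longrightarrow> xs \<in> tuples (parity L p) (univ M) \<Longrightarrow>
    xs \<in> pint M p \<longleftrightarrow> map \<alpha> xs \<in> pint M p"
  by (simp add: Aut_def)

lemma Aut_closed: "\<alpha> \<in> Aut L M \<Longrightarrow> x \<in> univ M \<Longrightarrow> \<alpha> x \<in> univ M"
  by (auto simp: Aut_def Bij_def bij_betw_def)

text \<open>\<open>N\<close> is an ultrapower of \<open>M\<close> up to renaming, with
  \<open>q\<close> sending a sequence to the element that it represents. It is instantiated with the
  class map for the expanded field and with \<open>qpt\<close> for the geometry over the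
  ultrapower.\<close>

locale ultra_map =
  fixes U :: "'i filter" and L :: "('f, 'p) lang" and M :: "('f, 'p, 'u) fostruct"
    and N :: "('f, 'p, 'w) fostruct" and q :: "('i \<Rightarrow> 'u) \<Rightarrow> 'w"
  assumes ultrafilter: "is_ultrafilter U"
    and univ_nonempty: "univ M \<noteq> {}"
    and univ_image: "univ N = q ` (UNIV \<rightarrow> univ M)"
    and q_eq_iff: "x \<in> UNIV \<rightarrow> univ M \<Longrightarrow> y \<in> UNIV \<rightarrow> univ M \<Longrightarrow>
      q x = q y \<longleftrightarrow> eventually (\<lambda>i. x i = y i) U"
    and fint_closed: "f \<in> fsyms L \<Longrightarrow> us \<in> tuples (farity L f) (univ M) \<Longrightarrow> fint M f us \<in> univ M"
    and fint_q: "f \<in> fsyms L \<Longrightarrow> xs \<in> tuples (farity L f) (UNIV \<rightarrow> univ M) \<Longrightarrow>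
      fint N f (map q xs) = q (\<lambda>i. fint M f (map (\<lambda>x. x i) xs))"
    and pint_q: "p \<in> psyms L \<Longrightarrow> xs \<in> tuples (parity L p) (UNIV \<rightarrow> univ M) \<Longrightarrow>
      map q xs \<in> pint N p \<longleftrightarrow> eventually (\<lambda>i. map (\<lambda>x. x i) xs \<in> pint M p) U"
begin

lemma U_not_bot: "U \<noteq> bot"
  using ultrafilter by (simp add: is_ultrafilter_def)

lemma val_closed:
  assumes "wf_tm L t" "\<And>n. e n \<in> univ M"
  shows "val M e t \<in> univ M"
  using assms(1)
proof (induction t)
  case (Fn f ts)
  then have "map (val M e) ts \<in> tuples (farity L f) (univ M)"
    by (auto simp: tuples_def list_all_iff)
  then show ?case using Fn.prems fint_closed by simp
qed (simp add: assms(2))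

lemma val_q:
  assumes "wf_tm L t" "\<And>n. e n \<in> UNIV \<rightarrow> univ M"
  shows "val N (\<lambda>n. q (e n)) t = q (\<lambda>i. val M (\<lambda>n. e n i) t)"
  using assms(1)
proof (induction t)
  case (Fn f ts)
  let ?xs = "map (\<lambda>t i. val M (\<lambda>n. e n i) t) ts"
  have e: "e n i \<in> univ M" for n i using assms(2)[of n] by auto
  have wf: "wf_tm L t" if "t \<in> set ts" for t using Fn.prems that by (auto simp: list_all_iff)
  have "map (val N (\<lambda>n. q (e n))) ts = map q ?xs" using Fn.IH wf by auto
  moreover have "?xs \<in> tuples (farity L f) (UNIV \<rightarrow> univ M)"
    using Fn.prems wf val_closed[OF _ e] by (auto simp: tuples_def)
  moreover have "map (\<lambda>x. x i) ?xs = map (val M (\<lambda>n. e n i)) ts" for i by simp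
  ultimately show ?case using Fn.prems fint_q[of f ?xs] by (simp del: map_map)
qed simp

theorem los:
  assumes "wf_fm L \<phi>" "\<And>n. e n \<in> UNIV \<rightarrow> univ M"
  shows "sat N (\<lambda>n. q (e n)) \<phi> \<longleftrightarrow> eventually (\<lambda>i. sat M (\<lambda>n. e n i) \<phi>) U"
  using assms
proof (induction \<phi> arbitrary: e)
  case (Equal s t)
  have e: "e n i \<in> univ M" for n i using Equal.prems(2)[of n] by auto
  have "(\<lambda>i. val M (\<lambda>n. e n i) s) \<in> UNIV \<rightarrow> univ M" "(\<lambda>i. val M (\<lambda>n. e n i) t) \<in> UNIV \<rightarrow> univ M"
    using Equal.prems val_closed[OF _ e] by auto
  then show ?case using Equal.prems by (simp add: val_q q_eq_iff)
next
  case (Rel p ts)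
  let ?xs = "map (\<lambda>t i. val M (\<lambda>n. e n i) t) ts"
  have e: "e n i \<in> univ M" for n i using Rel.prems(2)[of n] by auto
  have wf: "wf_tm L t" if "t \<in> set ts" for t using Rel.prems that by (auto simp: list_all_iff)
  have "map (val N (\<lambda>n. q (e n))) ts = map q ?xs" using val_q Rel.prems(2) wf by auto
  moreover have "?xs \<in> tuples (parity L p) (UNIV \<rightarrow> univ M)"
    using Rel.prems wf val_closed[OF _ e] by (auto simp: tuples_def)
  moreover have "map (\<lambda>x. x i) ?xs = map (val M (\<lambda>n. e n i)) ts" for i by simp
  ultimately show ?case using Rel.prems pint_q[of p ?xs] by (simp del: map_map)
next
  case (Neg \<phi>)
  then show ?case by (simp add: eventually_not_ultrafilter[OF ultrafilter])
next
  case (Conj \<phi> \<psi>)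
  then show ?case by (simp add: eventually_conj_iff)
next
  case (Exists m \<phi>)
  have upd: "(\<lambda>n. q (e n))(m := q x) = (\<lambda>n. q ((e(m := x)) n))"
    "(\<lambda>n. e n i)(m := x i) = (\<lambda>n. (e(m := x)) n i)" for x i by auto
  have "sat N (\<lambda>n. q (e n)) (Exists m \<phi>) \<longleftrightarrow>
      (\<exists>x\<in>UNIV \<rightarrow> univ M. sat N ((\<lambda>n. q (e n))(m := q x)) \<phi>)"
    by (auto simp: univ_image)
  also have "\<dots> \<longleftrightarrow> (\<exists>x\<in>UNIV \<rightarrow> univ M. eventually (\<lambda>i. sat M ((\<lambda>n. e n i)(m := x i)) \<phi>) U)"
    unfolding upd using Exists.IH Exists.prems by (intro bex_cong refl) simp
  also have "\<dots> \<longleftrightarrow> eventually (\<lambda>i. \<exists>x\<in>univ M. sat M ((\<lambda>n. e n i)(m := x)) \<phi>) U"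
    by (rule eventually_ex_funcset[OF univ_nonempty, symmetric])
  finally show ?case by simp
qed

lemma map_q_in_tuples: "xs \<in> tuples n (UNIV \<rightarrow> univ M) \<Longrightarrow> map q xs \<in> tuples n (univ N)"
  by (auto simp: tuples_def univ_image)

lemma map_apply_in_tuples: "xs \<in> tuples n (UNIV \<rightarrow> univ M) \<Longrightarrow> map (\<lambda>x. x i) xs \<in> tuples n (univ M)"
  by (auto simp: tuples_def funcset_UNIV_iff)

lemma defined_rel_q:
  assumes "is_formula L n \<phi>" "xs \<in> tuples n (UNIV \<rightarrow> univ M)"
  shows "map q xs \<in> defined_rel N n \<phi> \<longleftrightarrow> eventually (\<lambda>i. map (\<lambda>x. x i) xs \<in> defined_rel M n \<phi>) U"
proof -
  obtain u where u: "u \<in> univ M" using univ_nonempty by blast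
  \<comment> \<open>\<open>los\<close> requires all variables to have values in the universe; those
    beyond the tuple get a constant sequence, which is harmless because they are not free in
    \<open>\<phi>\<close>.\<close>
  define e where "e = (\<lambda>m. if m < n then xs ! m else (\<lambda>_. u))"
  have len: "length xs = n" using assms(2) by (simp add: tuples_def)
  have e: "e m \<in> UNIV \<rightarrow> univ M" for m
  proof (cases "m < n")
    case True
    then have "xs ! m \<in> set xs" using len by simp
    then show ?thesis using assms(2) True by (simp add: e_def tuples_def subset_iff)
  qed (simp add: e_def u funcset_UNIV_iff)
  have fv: "m < n" if "m \<in> fv \<phi>" for m using assms(1) that by (auto simp: is_formula_def)
  have "sat N (nth (map q xs)) \<phi> \<longleftrightarrow> sat N (\<lambda>m. q (e m)) \<phi>"
    by (rule sat_cong) (use fv len in \<open>auto simp: e_def\<close>)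
  also have "\<dots> \<longleftrightarrow> eventually (\<lambda>i. sat M (\<lambda>m. e m i) \<phi>) U"
    using assms(1) e by (intro los) (auto simp: is_formula_def)
  also have "(\<lambda>i. sat M (\<lambda>m. e m i) \<phi>) = (\<lambda>i. sat M (nth (map (\<lambda>x. x i) xs)) \<phi>)"
    by (intro ext sat_cong) (use fv len in \<open>auto simp: e_def\<close>)
  finally show ?thesis
    using map_q_in_tuples[OF assms(2)] map_apply_in_tuples[OF assms(2)] by (simp add: defined_rel_def)
qed

lemma ex_lift_tuple:
  assumes "ys \<in> tuples n (univ N)"
  obtains xs where "xs \<in> tuples n (UNIV \<rightarrow> univ M)" "map q xs = ys"
proof -
  have "\<forall>y\<in>set ys. \<exists>x. x \<in> UNIV \<rightarrow> univ M \<and> q x = y"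
    using assms by (auto simp: tuples_def univ_image)
  then obtain g where g: "\<forall>y\<in>set ys. g y \<in> UNIV \<rightarrow> univ M \<and> q (g y) = y" by metis
  then have "map g ys \<in> tuples n (UNIV \<rightarrow> univ M)" "map q (map g ys) = ys"
    using assms by (auto simp: tuples_def intro!: map_idI)
  then show thesis by (rule that)
qed

text \<open>\<open>P\<close> relates representatives. Agreement of equalities almost everywhere
  makes the induced relation on classes single-valued and injective, agreement of predicates makes
  it an automorphism, and the two projections make it total and surjective.\<close>

lemma ex_automorphism:
  assumes fs: "fsyms L = {}"
    and P: "P \<subseteq> (UNIV \<rightarrow> univ M) \<times> (UNIV \<rightarrow> univ M)"
      "fst ` P = (UNIV \<rightarrow> univ M)" "snd ` P = (UNIV \<rightarrow> univ M)"
    and ef: "\<And>ps. ps \<in> lists P \<Longrightarrow>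
      eventually (\<lambda>i. ef_equiv L M 0 (map (\<lambda>p. fst p i) ps) (map (\<lambda>p. snd p i) ps)) U"
  obtains \<alpha> where "\<alpha> \<in> Aut L N" "\<And>a b. (a, b) \<in> P \<Longrightarrow> \<alpha> (q a) = q b"
proof -
  have D: "a \<in> UNIV \<rightarrow> univ M" "b \<in> UNIV \<rightarrow> univ M" if "(a, b) \<in> P" for a b
    using P(1) that by auto
  have eq: "q a = q a' \<longleftrightarrow> q b = q b'" if "(a, b) \<in> P" "(a', b') \<in> P" for a b a' b'
  proof -
    have "eventually (\<lambda>i. ef_equiv L M 0 [a i, a' i] [b i, b' i]) U"
      using ef[of "[(a, b), (a', b')]"] that by (simp del: ef_equiv.simps)
    then have ev: "eventually (\<lambda>i. a i = a' i \<longleftrightarrow> b i = b' i) U"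
      by (rule eventually_mono) (auto simp: less_Suc_eq)
    have "eventually (\<lambda>i. a i = a' i) U \<longleftrightarrow> eventually (\<lambda>i. b i = b' i) U"
      using ev by (rule eventually_subst)
    then show ?thesis
      using q_eq_iff[OF D(1)[OF that(1)] D(1)[OF that(2)]] q_eq_iff[OF D(2)[OF that(1)] D(2)[OF that(2)]]
      by simp
  qed
  define \<alpha> where "\<alpha> = (\<lambda>y\<in>univ N. q (SOME b. \<exists>a. (a, b) \<in> P \<and> q a = y))"
  have \<alpha>: "\<alpha> (q a) = q b" if "(a, b) \<in> P" for a b
  proof -
    have "\<exists>b'. \<exists>a'. (a', b') \<in> P \<and> q a' = q a" using that by blast
    then obtain a' where "(a', SOME b. \<exists>a'. (a', b) \<in> P \<and> q a' = q a) \<in> P" "q a' = q a"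
      using someI_ex[of "\<lambda>b'. \<exists>a'. (a', b') \<in> P \<and> q a' = q a"] by blast
    moreover have "q a \<in> univ N" using D[OF that] by (auto simp: univ_image)
    ultimately show ?thesis using eq[OF _ that] by (simp add: \<alpha>_def)
  qed
  have N1: "\<exists>a b. (a, b) \<in> P \<and> q a = y" if "y \<in> univ N" for y
    using that P(2) by (force simp: univ_image)
  have N2: "\<exists>a b. (a, b) \<in> P \<and> q b = y" if "y \<in> univ N" for y
    using that P(3) by (force simp: univ_image)
  have "inj_on \<alpha> (univ N)"
  proof (rule inj_onI)
    fix y y' assume "y \<in> univ N" "y' \<in> univ N" "\<alpha> y = \<alpha> y'"
    moreover from this obtain a b a' b' where "(a, b) \<in> P" "y = q a" "(a', b') \<in> P" "y' = q a'"
      using N1 by blast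
    ultimately show "y = y'" using \<alpha> eq by simp
  qed
  moreover have "\<alpha> ` univ N = univ N"
  proof (intro equalityI subsetI)
    fix y assume "y \<in> \<alpha> ` univ N"
    then obtain a b where "(a, b) \<in> P" "y = \<alpha> (q a)" using N1 by blast
    then show "y \<in> univ N" using \<alpha> D(2) by (auto simp: univ_image)
  next
    fix y assume "y \<in> univ N"
    then obtain a b where "(a, b) \<in> P" "y = q b" using N2 by blast
    moreover from this have "q a \<in> univ N" using D(1) by (auto simp: univ_image)
    ultimately show "y \<in> \<alpha> ` univ N" using \<alpha> by (metis imageI)
  qed
  ultimately have "\<alpha> \<in> Bij (univ N)" by (simp add: Bij_def bij_betw_def \<alpha>_def)
  moreover have "ys \<in> pint N p \<longleftrightarrow> map \<alpha> ys \<in> pint N p"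
    if p: "p \<in> psyms L" and ys: "ys \<in> tuples (parity L p) (univ N)" for p ys
  proof -
    have "\<forall>y\<in>set ys. \<exists>r. r \<in> P \<and> q (fst r) = y"
      using N1 ys by (force simp: tuples_def)
    then obtain g where g: "\<forall>y\<in>set ys. g y \<in> P \<and> q (fst (g y)) = y" by metis
    define ps where "ps = map g ys"
    have ps: "ps \<in> lists P" and len: "length ps = parity L p"
      using g ys by (auto simp: ps_def tuples_def)
    have ya: "ys = map q (map fst ps)" using g by (auto simp: ps_def intro!: map_idI[symmetric])
    have yb: "map \<alpha> ys = map q (map snd ps)"
    proof -
      have "\<alpha> (q (fst r)) = q (snd r)" if "r \<in> set ps" for r
        using \<alpha>[of "fst r" "snd r"] ps that by auto
      then show ?thesis unfolding ya by simp
    qed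
    have tup: "map fst ps \<in> tuples (parity L p) (UNIV \<rightarrow> univ M)"
      "map snd ps \<in> tuples (parity L p) (UNIV \<rightarrow> univ M)"
    proof -
      have "fst r \<in> UNIV \<rightarrow> univ M" "snd r \<in> UNIV \<rightarrow> univ M" if "r \<in> set ps" for r
        using ps that D[of "fst r" "snd r"] by (auto simp: in_lists_conv_set)
      then show "map fst ps \<in> tuples (parity L p) (UNIV \<rightarrow> univ M)"
        "map snd ps \<in> tuples (parity L p) (UNIV \<rightarrow> univ M)"
        using len by (simp_all add: tuples_def image_subset_iff)
    qed
    have "eventually (\<lambda>i. map (\<lambda>x. x i) (map fst ps) \<in> pint M p \<longleftrightarrow>
        map (\<lambda>x. x i) (map snd ps) \<in> pint M p) U"
      using ef[OF ps]
    proof (rule eventually_mono)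
      fix i assume *: "ef_equiv L M 0 (map (\<lambda>p. fst p i) ps) (map (\<lambda>p. snd p i) ps)"
      have "[0..<length ps] \<in> tuples (parity L p) {..<length (map (\<lambda>p. fst p i) ps)}"
        using len by (auto simp: tuples_def)
      then have "map (nth (map (\<lambda>p. fst p i) ps)) [0..<length ps] \<in> pint M p \<longleftrightarrow>
        map (nth (map (\<lambda>p. snd p i) ps)) [0..<length ps] \<in> pint M p"
        using * p unfolding ef_equiv.simps by blast
      moreover have "map (nth (map (\<lambda>p. fst p i) ps)) [0..<length ps] = map (\<lambda>p. fst p i) ps"
        "map (nth (map (\<lambda>p. snd p i) ps)) [0..<length ps] = map (\<lambda>p. snd p i) ps"
        by (auto intro: nth_equalityI)
      ultimately show "map (\<lambda>x. x i) (map fst ps) \<in> pint M p \<longleftrightarrow>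
        map (\<lambda>x. x i) (map snd ps) \<in> pint M p" by (simp add: comp_def)
    qed
    from eventually_subst[OF this] show ?thesis
      unfolding yb pint_q[OF p tup(2)] by (subst ya) (simp only: pint_q[OF p tup(1)])
  qed
  ultimately have "\<alpha> \<in> Aut L N" by (simp add: Aut_def fs)
  then show thesis using \<alpha> by (rule that)
qed

text \<open>If almost all \<open>B i\<close> violated one of the requirements, the violating
  elements, chosen index by index, would represent a violation by \<open>A\<close>. Finitely many
  predicate symbols are needed to combine the statements for the single symbols into one almost
  everywhere.\<close>

lemma eventually_automorphism:
  assumes fs: "fsyms L = {}" and fin: "finite (psyms L)" and A: "A \<in> Aut L N"
    and B: "\<And>i. B i \<in> extensional (univ M)" "\<And>i u. u \<in> univ M \<Longrightarrow> B i u \<in> univ M"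
    and AB: "\<And>x. x \<in> UNIV \<rightarrow> univ M \<Longrightarrow> A (q x) = q (\<lambda>i. B i (x i))"
  shows "eventually (\<lambda>i. B i \<in> Aut L M) U"
proof -
  have BD: "(\<lambda>i. B i (x i)) \<in> UNIV \<rightarrow> univ M" if "x \<in> UNIV \<rightarrow> univ M" for x
    using B(2) that by (auto simp: funcset_UNIV_iff)
  have qD: "q x \<in> univ N" if "x \<in> UNIV \<rightarrow> univ M" for x using that by (auto simp: univ_image)
  have bij: "inj_on A (univ N)" "A ` univ N = univ N"
    using A by (auto simp: Aut_def Bij_def bij_betw_def)
  have "eventually (\<lambda>i. inj_on (B i) (univ M)) U"
  proof (rule ccontr)
    assume "\<not> ?thesis"
    then have "eventually (\<lambda>i. \<exists>u\<in>univ M. \<exists>v\<in>univ M. B i u = B i v \<and> u \<noteq> v) U"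
      unfolding eventually_not_ultrafilter[OF ultrafilter, symmetric] by (simp add: inj_on_def)
    then obtain x y where xy: "x \<in> UNIV \<rightarrow> univ M" "y \<in> UNIV \<rightarrow> univ M"
      "eventually (\<lambda>i. B i (x i) = B i (y i) \<and> x i \<noteq> y i) U"
      unfolding eventually_ex_funcset[OF univ_nonempty] by blast
    then have "q (\<lambda>i. B i (x i)) = q (\<lambda>i. B i (y i))" "q x \<noteq> q y"
      by (simp_all add: q_eq_iff BD eventually_conj_iff eventually_not_ultrafilter[OF ultrafilter])
    then show False using bij(1) qD xy(1,2) by (metis AB inj_onD)
  qed
  moreover have "eventually (\<lambda>i. univ M \<subseteq> B i ` univ M) U"
  proof (rule ccontr)
    assume "\<not> ?thesis"
    then have "eventually (\<lambda>i. \<exists>v\<in>univ M. v \<notin> B i ` univ M) U"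
      unfolding eventually_not_ultrafilter[OF ultrafilter, symmetric] by (simp add: subset_iff Bex_def)
    then obtain y where y: "y \<in> UNIV \<rightarrow> univ M" "eventually (\<lambda>i. y i \<notin> B i ` univ M) U"
      unfolding eventually_ex_funcset[OF univ_nonempty] by blast
    have "q y \<in> A ` univ N" using qD[OF y(1)] bij(2) by simp
    then obtain w where w: "w \<in> univ N" "q y = A w" ..
    from w(1) obtain x where x: "x \<in> UNIV \<rightarrow> univ M" "A (q x) = q y"
      unfolding univ_image using w(2) by auto
    then have "eventually (\<lambda>i. B i (x i) = y i) U"
      using AB[OF x(1)] q_eq_iff[OF BD[OF x(1)] y(1)] by simp
    with y(2) have "eventually (\<lambda>i. False) U"
    proof (rule eventually_elim2)
      fix i assume "y i \<notin> B i ` univ M" "B i (x i) = y i"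
      moreover have "B i (x i) \<in> B i ` univ M" using x(1) by (simp add: funcset_UNIV_iff)
      ultimately show False by simp
    qed
    then show False using U_not_bot by (simp add: trivial_limit_def)
  qed
  moreover have "eventually (\<lambda>i. \<forall>p\<in>psyms L. \<forall>us\<in>tuples (parity L p) (univ M).
      us \<in> pint M p \<longleftrightarrow> map (B i) us \<in> pint M p) U"
  proof (rule eventually_ball_finite[OF fin], rule ballI, rule ccontr)
    fix p assume p: "p \<in> psyms L"
    assume "\<not> eventually (\<lambda>i. \<forall>us\<in>tuples (parity L p) (univ M).
      us \<in> pint M p \<longleftrightarrow> map (B i) us \<in> pint M p) U"
    then have ev: "eventually (\<lambda>i. \<exists>us\<in>tuples (parity L p) (univ M).
      (us \<in> pint M p) \<noteq> (map (B i) us \<in> pint M p)) U"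
      unfolding eventually_not_ultrafilter[OF ultrafilter, symmetric] by simp
    obtain u where "u \<in> univ M" using univ_nonempty by blast
    then have "replicate (parity L p) u \<in> tuples (parity L p) (univ M)"
      by (auto simp: tuples_def)
    then have "tuples (parity L p) (univ M) \<noteq> {}" by blast
    from ev[unfolded eventually_ex_funcset[OF this]]
    obtain z where z: "z \<in> UNIV \<rightarrow> tuples (parity L p) (univ M)"
      "eventually (\<lambda>i. (z i \<in> pint M p) \<noteq> (map (B i) (z i) \<in> pint M p)) U" by blast
    \<comment> \<open>Transposition: the sequence \<open>z\<close> of tuples becomes a tuple of
      sequences, to which \<open>q\<close> applies.\<close>
    define xs where "xs = map (\<lambda>j i. z i ! j) [0..<parity L p]"
    have zi: "length (z i) = parity L p" "set (z i) \<subseteq> univ M" for i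
      using z(1) by (auto simp: tuples_def funcset_UNIV_iff)
    have "z i ! j \<in> univ M" if "j < parity L p" for i j
      using nth_mem[of j "z i"] zi[of i] that by auto
    then have xs: "xs \<in> tuples (parity L p) (UNIV \<rightarrow> univ M)"
      by (auto simp: xs_def tuples_def)
    have xz: "map (\<lambda>x. x i) xs = z i" for i
      by (rule nth_equalityI) (simp_all add: xs_def zi)
    let ?ys = "map (\<lambda>x i. B i (x i)) xs"
    have ys: "?ys \<in> tuples (parity L p) (UNIV \<rightarrow> univ M)"
      using xs BD by (auto simp: tuples_def)
    have yz: "map (\<lambda>x. x i) ?ys = map (B i) (z i)" for i
      by (simp flip: xz)
    have "map A (map q xs) = map q ?ys" using xs AB by (auto simp: tuples_def)
    then have "map q xs \<in> pint N p \<longleftrightarrow> map q ?ys \<in> pint N p"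
      unfolding Aut_pint[OF A p map_q_in_tuples[OF xs]] by (simp only:)
    then have "eventually (\<lambda>i. z i \<in> pint M p) U \<longleftrightarrow> eventually (\<lambda>i. map (B i) (z i) \<in> pint M p) U"
      unfolding pint_q[OF p xs] pint_q[OF p ys] xz yz .
    moreover have "eventually (\<lambda>i. z i \<in> pint M p \<longleftrightarrow> \<not> map (B i) (z i) \<in> pint M p) U"
      using z(2) by (rule eventually_mono) blast
    from eventually_subst[OF this] have "eventually (\<lambda>i. z i \<in> pint M p) U \<longleftrightarrow>
        \<not> eventually (\<lambda>i. map (B i) (z i) \<in> pint M p) U"
      by (simp add: eventually_not_ultrafilter[OF ultrafilter])
    ultimately show False by blast
  qed
  ultimately show ?thesis
  proof eventually_elim
    case (elim i)
    moreover have "B i ` univ M \<subseteq> univ M" using B(2) by blast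
    ultimately show ?case
      using B(1) by (auto simp: Aut_def fs Bij_def bij_betw_def)
  qed
qed

end

section \<open>Invariance of definable relations under automorphisms\<close>

lemma sat_automorphism:
  assumes \<alpha>: "\<alpha> \<in> Aut L M" and closed: "\<And>f us. f \<in> fsyms L \<Longrightarrow> us \<in> tuples (farity L f) (univ M) \<Longrightarrow>
      fint M f us \<in> univ M"
    and "wf_fm L \<phi>" "\<And>n. e n \<in> univ M"
  shows "sat M (\<lambda>n. \<alpha> (e n)) \<phi> \<longleftrightarrow> sat M e \<phi>"
proof -
  have bij: "inj_on \<alpha> (univ M)" "\<alpha> ` univ M = univ M"
    using \<alpha> by (auto simp: Aut_def Bij_def bij_betw_def)
  have val: "val M e t \<in> univ M \<and> val M (\<lambda>n. \<alpha> (e n)) t = \<alpha> (val M e t)"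
    if "wf_tm L t" "\<And>n. e n \<in> univ M" for t e
    using that(1)
  proof (induction t)
    case (Fn f ts)
    then have IH: "val M e t \<in> univ M" "val M (\<lambda>n. \<alpha> (e n)) t = \<alpha> (val M e t)" if "t \<in> set ts" for t
      using that by (auto simp: list_all_iff)
    then have "map (val M e) ts \<in> tuples (farity L f) (univ M)"
      "map (val M (\<lambda>n. \<alpha> (e n))) ts = map \<alpha> (map (val M e) ts)"
      using Fn.prems by (auto simp: tuples_def)
    then show ?case using closed \<alpha> Fn.prems by (simp add: Aut_def del: map_map)
  qed (simp add: that(2))
  show ?thesis using assms(3,4)
  proof (induction \<phi> arbitrary: e)
    case (Equal s t)
    then show ?case using val[of s e] val[of t e] inj_onD[OF bij(1)] by auto
  next
    case (Rel p ts)
    have IH: "val M e t \<in> univ M \<and> val M (\<lambda>n. \<alpha> (e n)) t = \<alpha> (val M e t)" if "t \<in> set ts" for t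
      using Rel.prems that by (intro val) (auto simp: list_all_iff)
    then have "map (val M e) ts \<in> tuples (parity L p) (univ M)"
      "map (val M (\<lambda>n. \<alpha> (e n))) ts = map \<alpha> (map (val M e) ts)"
      using Rel.prems by (auto simp: tuples_def)
    then show ?case using \<alpha> Rel.prems by (simp add: Aut_def del: map_map)
  next
    case (Exists m \<phi>)
    have upd: "(\<lambda>n. \<alpha> (e n))(m := \<alpha> x) = (\<lambda>n. \<alpha> ((e(m := x)) n))" for x by auto
    have "sat M (\<lambda>n. \<alpha> (e n)) (Exists m \<phi>) \<longleftrightarrow> (\<exists>x\<in>\<alpha> ` univ M. sat M ((\<lambda>n. \<alpha> (e n))(m := x)) \<phi>)"
      using bij(2) by simp
    also have "\<dots> \<longleftrightarrow> (\<exists>x\<in>univ M. sat M ((\<lambda>n. \<alpha> (e n))(m := \<alpha> x)) \<phi>)" by blast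
    also have "\<dots> \<longleftrightarrow> (\<exists>x\<in>univ M. sat M (e(m := x)) \<phi>)"
      unfolding upd
    proof (intro bex_cong refl)
      fix x assume "x \<in> univ M"
      then show "sat M (\<lambda>n. \<alpha> ((e(m := x)) n)) \<phi> \<longleftrightarrow> sat M (e(m := x)) \<phi>"
        using Exists.prems by (intro Exists.IH) auto
    qed
    finally show ?case by simp
  qed simp_all
qed

lemma defined_rel_automorphism:
  assumes \<alpha>: "\<alpha> \<in> Aut L M" and closed: "\<And>f us. f \<in> fsyms L \<Longrightarrow> us \<in> tuples (farity L f) (univ M) \<Longrightarrow>
      fint M f us \<in> univ M"
    and \<phi>: "is_formula L n \<phi>" and ne: "univ M \<noteq> {}" and xs: "xs \<in> tuples n (univ M)"
  shows "map \<alpha> xs \<in> defined_rel M n \<phi> \<longleftrightarrow> xs \<in> defined_rel M n \<phi>"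
proof -
  obtain u where u: "u \<in> univ M" using ne by blast
  define e where "e = (\<lambda>m. if m < n then xs ! m else u)"
  have len: "length xs = n" using xs by (simp add: tuples_def)
  have e: "e m \<in> univ M" for m using xs u nth_mem[of m xs] unfolding e_def tuples_def by auto
  have fv: "m < n" if "m \<in> fv \<phi>" for m using \<phi> that by (auto simp: is_formula_def)
  have "sat M (nth (map \<alpha> xs)) \<phi> \<longleftrightarrow> sat M (\<lambda>m. \<alpha> (e m)) \<phi>"
    by (rule sat_cong) (use fv len in \<open>auto simp: e_def\<close>)
  also have "\<dots> \<longleftrightarrow> sat M e \<phi>"
    using \<phi> e by (intro sat_automorphism[OF \<alpha> closed]) (auto simp: is_formula_def)
  also have "\<dots> \<longleftrightarrow> sat M (nth xs) \<phi>"
    by (rule sat_cong) (use fv len in \<open>auto simp: e_def\<close>)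
  finally have "sat M (nth (map \<alpha> xs)) \<phi> \<longleftrightarrow> sat M (nth xs) \<phi>" .
  moreover have "\<alpha> x \<in> univ M" if "x \<in> univ M" for x
    using \<alpha> that by (auto simp: Aut_def Bij_def bij_betw_def)
  then have "map \<alpha> xs \<in> tuples n (univ M)" using xs by (auto simp: tuples_def)
  ultimately show ?thesis using xs by (simp add: defined_rel_def)
qed

section \<open>Ultrapowers of fields and of coordinate geometries\<close>

lemma tuples_nth: "xs \<in> tuples n A \<Longrightarrow> k < n \<Longrightarrow> xs ! k \<in> A"
  using nth_mem[of k xs] by (auto simp: tuples_def)

lemma ult_class_eq_iff:
  assumes "x \<in> UNIV \<rightarrow> A" "y \<in> UNIV \<rightarrow> A"
  shows "ult_class U A x = ult_class U A y \<longleftrightarrow> eventually (\<lambda>i. x i = y i) U"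
proof -
  have "equiv (UNIV \<rightarrow> A) (ult_eq U A)"
  proof (rule equivI)
    show "ult_eq U A \<subseteq> (UNIV \<rightarrow> A) \<times> (UNIV \<rightarrow> A)" "refl_on (UNIV \<rightarrow> A) (ult_eq U A)"
      by (auto simp: refl_on_def ult_eq_def)
    show "sym (ult_eq U A)" by (auto simp: sym_def ult_eq_def eq_commute)
    show "trans (ult_eq U A)"
      unfolding trans_def ult_eq_def by (auto elim: eventually_elim2)
  qed
  from eq_equiv_class_iff[OF this assms] show ?thesis
    using assms by (simp add: ult_class_def ult_eq_def)
qed

lemma mem_ult_class:
  "g \<in> ult_class U A x \<longleftrightarrow> x \<in> UNIV \<rightarrow> A \<and> g \<in> UNIV \<rightarrow> A \<and> eventually (\<lambda>i. x i = g i) U"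
  by (auto simp: ult_class_def ult_eq_def)

text \<open>The interpretations in \<open>ultrapower\<close> quantify over all representatives, so
  independence of their choice has to be checked: lists with the same classes have finitely many
  entries and hence agree entirely at almost all indices.\<close>

lemma ultra_map_ultrapower:
  fixes U :: "'i filter"
  assumes U: "is_ultrafilter U" and M: "is_structure L M"
  shows "ultra_map U L M (ultrapower U M) (ult_class U (univ M))"
proof
  let ?q = "ult_class U (univ M)" and ?D = "UNIV \<rightarrow> univ M :: ('i \<Rightarrow> _) set"
  have map_eq: "map ?q xs = map ?q ys \<longleftrightarrow> eventually (\<lambda>i. map (\<lambda>x. x i) xs = map (\<lambda>x. x i) ys) U"
    if "length xs = length ys" "set xs \<subseteq> ?D" "set ys \<subseteq> ?D" for xs ys
    by (rule map_eq_iff_eventually[OF ult_class_eq_iff that])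
  show "is_ultrafilter U" by fact
  show "univ M \<noteq> {}" using M by (simp add: is_structure_def)
  show "univ (ultrapower U M) = ?q ` ?D"
    by (auto simp: ultrapower_def quotient_def ult_class_def)
  show "?q x = ?q y \<longleftrightarrow> eventually (\<lambda>i. x i = y i) U" if "x \<in> ?D" "y \<in> ?D" for x y
    by (rule ult_class_eq_iff[OF that])
  show closed: "fint M f us \<in> univ M" if "f \<in> fsyms L" "us \<in> tuples (farity L f) (univ M)" for f us
    using M that by (simp add: is_structure_def)
  show "fint (ultrapower U M) f (map ?q xs) = ?q (\<lambda>i. fint M f (map (\<lambda>x. x i) xs))"
    if f: "f \<in> fsyms L" and xs: "xs \<in> tuples (farity L f) ?D" for f xs
  proof -
    have D: "(\<lambda>i. fint M f (map (\<lambda>x. x i) xs)) \<in> ?D"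
    proof (rule funcsetI)
      fix i
      show "fint M f (map (\<lambda>x. x i) xs) \<in> univ M"
        by (rule closed[OF f]) (use xs in \<open>auto simp: tuples_def funcset_UNIV_iff\<close>)
    qed
    show ?thesis
    proof (intro equalityI subsetI)
      fix g assume "g \<in> fint (ultrapower U M) f (map ?q xs)"
      then obtain hs where g: "g \<in> ?D" and hs: "set hs \<subseteq> ?D" "map ?q xs = map ?q hs"
        and ev: "eventually (\<lambda>i. g i = fint M f (map (\<lambda>h. h i) hs)) U"
        by (auto simp: ultrapower_def)
      have "eventually (\<lambda>i. map (\<lambda>x. x i) xs = map (\<lambda>x. x i) hs) U"
        using map_eq[of xs hs] hs xs map_eq_imp_length_eq[OF hs(2)] by (simp add: tuples_def)
      with ev have "eventually (\<lambda>i. fint M f (map (\<lambda>x. x i) xs) = g i) U"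
        by (rule eventually_elim2) simp
      then show "g \<in> ?q (\<lambda>i. fint M f (map (\<lambda>x. x i) xs))"
        unfolding mem_ult_class using D g by blast
    next
      fix g assume "g \<in> ?q (\<lambda>i. fint M f (map (\<lambda>x. x i) xs))"
      then have "g \<in> ?D" "eventually (\<lambda>i. g i = fint M f (map (\<lambda>x. x i) xs)) U"
        unfolding mem_ult_class by (auto elim: eventually_mono)
      then show "g \<in> fint (ultrapower U M) f (map ?q xs)"
        using xs by (auto simp: ultrapower_def tuples_def)
    qed
  qed
  show "map ?q xs \<in> pint (ultrapower U M) p \<longleftrightarrow> eventually (\<lambda>i. map (\<lambda>x. x i) xs \<in> pint M p) U"
    if p: "p \<in> psyms L" and xs: "xs \<in> tuples (parity L p) ?D" for p xs
  proof
    assume "map ?q xs \<in> pint (ultrapower U M) p"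
    then obtain hs where hs: "set hs \<subseteq> ?D" "map ?q xs = map ?q hs"
      and ev: "eventually (\<lambda>i. map (\<lambda>h. h i) hs \<in> pint M p) U"
      by (auto simp: ultrapower_def)
    have "eventually (\<lambda>i. map (\<lambda>x. x i) xs = map (\<lambda>x. x i) hs) U"
      using map_eq[of xs hs] hs xs map_eq_imp_length_eq[OF hs(2)] by (simp add: tuples_def)
    with ev show "eventually (\<lambda>i. map (\<lambda>x. x i) xs \<in> pint M p) U"
      by (rule eventually_elim2) simp
  next
    assume "eventually (\<lambda>i. map (\<lambda>x. x i) xs \<in> pint M p) U"
    then show "map ?q xs \<in> pint (ultrapower U M) p"
      using xs by (auto simp: ultrapower_def tuples_def)
  qed
qed

section \<open>Field operations and finite sums in the ultrapower\<close>

lemma carrier_field_reduct [simp]: "carrier (field_reduct M) = univ M"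
  by (simp add: field_reduct_def)

lemma field_reduct_simps:
  "x \<otimes>\<^bsub>field_reduct M\<^esub> y = fint M Times [x, y]"
  "\<one>\<^bsub>field_reduct M\<^esub> = fint M One []"
  "\<zero>\<^bsub>field_reduct M\<^esub> = fint M Zero []"
  "x \<oplus>\<^bsub>field_reduct M\<^esub> y = fint M Plus [x, y]"
  by (simp_all add: field_reduct_def)

lemma expandsD:
  assumes "expands \<kappa> L M"
  shows "is_structure L M" "contains_field_language L" "field (field_reduct M)"
    "\<kappa> = Ordered_Field \<Longrightarrow> Less \<in> psyms L \<and> parity L Less = 2"
proof -
  have "is_ordered_field M \<Longrightarrow> field (field_reduct M)"
    unfolding is_ordered_field_def by (elim conjE)
  then show "is_structure L M" "contains_field_language L" "field (field_reduct M)"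
    "\<kappa> = Ordered_Field \<Longrightarrow> Less \<in> psyms L \<and> parity L Less = 2"
    using assms by (cases \<kappa>; simp)+
qed

locale ultra_field = ultra_map U L M N q
  for U :: "'i filter" and L :: "('f fsym, 'p psym) lang" and M :: "('f fsym, 'p psym, 'u) fostruct"
    and N :: "('f fsym, 'p psym, 'w) fostruct" and q +
  fixes \<kappa> :: field_kind and d :: nat
  assumes expands: "expands \<kappa> L M"
begin

abbreviation "R \<equiv> field_reduct M"
abbreviation "S \<equiv> field_reduct N"

sublocale R: field R
  by (rule expandsD(3)[OF expands])

lemma q_closed: "x \<in> UNIV \<rightarrow> univ M \<Longrightarrow> q x \<in> univ N"
  unfolding univ_image by (rule imageI)

lemma add_q: "x \<in> UNIV \<rightarrow> univ M \<Longrightarrow> y \<in> UNIV \<rightarrow> univ M \<Longrightarrow> q x \<oplus>\<^bsub>S\<^esub> q y = q (\<lambda>i. x i \<oplus>\<^bsub>R\<^esub> y i)"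
  using fint_q[of Plus "[x, y]"] expandsD(2)[OF expands]
  by (simp add: field_reduct_simps contains_field_language_def tuples_def)

lemma mult_q: "x \<in> UNIV \<rightarrow> univ M \<Longrightarrow> y \<in> UNIV \<rightarrow> univ M \<Longrightarrow> q x \<otimes>\<^bsub>S\<^esub> q y = q (\<lambda>i. x i \<otimes>\<^bsub>R\<^esub> y i)"
  using fint_q[of Times "[x, y]"] expandsD(2)[OF expands]
  by (simp add: field_reduct_simps contains_field_language_def tuples_def)

lemma zero_q: "\<zero>\<^bsub>S\<^esub> = q (\<lambda>i. \<zero>\<^bsub>R\<^esub>)"
  using fint_q[of Zero "[]"] expandsD(2)[OF expands]
  by (simp add: field_reduct_simps contains_field_language_def tuples_def)

lemma one_q: "\<one>\<^bsub>S\<^esub> = q (\<lambda>i. \<one>\<^bsub>R\<^esub>)"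
  using fint_q[of One "[]"] expandsD(2)[OF expands]
  by (simp add: field_reduct_simps contains_field_language_def tuples_def)

lemma funcset_closed:
  "x \<in> UNIV \<rightarrow> univ M \<Longrightarrow> y \<in> UNIV \<rightarrow> univ M \<Longrightarrow> (\<lambda>i. x i \<oplus>\<^bsub>R\<^esub> y i) \<in> UNIV \<rightarrow> univ M"
  "x \<in> UNIV \<rightarrow> univ M \<Longrightarrow> y \<in> UNIV \<rightarrow> univ M \<Longrightarrow> (\<lambda>i. x i \<otimes>\<^bsub>R\<^esub> y i) \<in> UNIV \<rightarrow> univ M"
  "x \<in> UNIV \<rightarrow> univ M \<Longrightarrow> (\<lambda>i. \<ominus>\<^bsub>R\<^esub> x i) \<in> UNIV \<rightarrow> univ M"
  "(\<lambda>i. \<zero>\<^bsub>R\<^esub>) \<in> UNIV \<rightarrow> univ M" "(\<lambda>i. \<one>\<^bsub>R\<^esub>) \<in> UNIV \<rightarrow> univ M"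
  using R.add.m_closed R.m_closed R.a_inv_closed R.zero_closed R.one_closed
  by (simp_all add: funcset_UNIV_iff)

text \<open>Gives access in \<open>S\<close> to the laws of subtraction and of finite sums, from
  which \<open>aff_comb\<close> and \<open>affine_map\<close> are built.\<close>

lemma abelian_group_S: "abelian_group S"
proof (rule abelian_groupI)
  show "\<zero>\<^bsub>S\<^esub> \<in> carrier S" by (simp add: zero_q q_closed funcset_closed)
  fix x y z assume "x \<in> carrier S" "y \<in> carrier S" "z \<in> carrier S"
  then obtain a b c where abc: "x = q a" "y = q b" "z = q c"
    "a \<in> UNIV \<rightarrow> univ M" "b \<in> UNIV \<rightarrow> univ M" "c \<in> UNIV \<rightarrow> univ M"
    by (auto simp: univ_image)
  have i: "a i \<in> univ M" "b i \<in> univ M" "c i \<in> univ M" for i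
    using abc by (simp_all add: funcset_UNIV_iff)
  show "x \<oplus>\<^bsub>S\<^esub> y \<in> carrier S"
    using abc by (simp add: add_q q_closed funcset_closed)
  show "x \<oplus>\<^bsub>S\<^esub> y \<oplus>\<^bsub>S\<^esub> z = x \<oplus>\<^bsub>S\<^esub> (y \<oplus>\<^bsub>S\<^esub> z)"
    using abc i by (simp add: add_q funcset_closed R.a_assoc)
  show "x \<oplus>\<^bsub>S\<^esub> y = y \<oplus>\<^bsub>S\<^esub> x" using abc i by (simp add: add_q R.a_comm)
  show "\<zero>\<^bsub>S\<^esub> \<oplus>\<^bsub>S\<^esub> x = x" using abc i by (simp add: add_q zero_q funcset_closed)
  show "\<exists>y\<in>carrier S. y \<oplus>\<^bsub>S\<^esub> x = \<zero>\<^bsub>S\<^esub>"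
  proof
    show "q (\<lambda>i. \<ominus>\<^bsub>R\<^esub> a i) \<oplus>\<^bsub>S\<^esub> x = \<zero>\<^bsub>S\<^esub>"
      using abc i by (simp add: add_q zero_q funcset_closed R.l_neg)
    show "q (\<lambda>i. \<ominus>\<^bsub>R\<^esub> a i) \<in> carrier S"
      using abc by (simp add: q_closed funcset_closed)
  qed
qed

sublocale S: abelian_group S
  by (rule abelian_group_S)

lemma minus_q:
  assumes "x \<in> UNIV \<rightarrow> univ M" "y \<in> UNIV \<rightarrow> univ M"
  shows "q x \<ominus>\<^bsub>S\<^esub> q y = q (\<lambda>i. x i \<ominus>\<^bsub>R\<^esub> y i)"
proof -
  have i: "y i \<in> univ M" for i using assms by (simp add: funcset_UNIV_iff)
  have "\<ominus>\<^bsub>S\<^esub> q y = q (\<lambda>i. \<ominus>\<^bsub>R\<^esub> y i)"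
    by (rule S.minus_equality)
      (use assms i in \<open>simp_all add: add_q zero_q funcset_closed R.l_neg q_closed\<close>)
  then show ?thesis using assms by (simp add: a_minus_def add_q funcset_closed)
qed

lemma finsum_q:
  fixes n :: nat
  shows "(\<And>k. k < n \<Longrightarrow> x k \<in> UNIV \<rightarrow> univ M) \<Longrightarrow>
    (\<lambda>i. \<Oplus>\<^bsub>R\<^esub>k\<in>{..<n}. x k i) \<in> UNIV \<rightarrow> univ M \<and>
    (\<Oplus>\<^bsub>S\<^esub>k\<in>{..<n}. q (x k)) = q (\<lambda>i. \<Oplus>\<^bsub>R\<^esub>k\<in>{..<n}. x k i)"
proof (induction n)
  case 0
  then show ?case by (simp add: zero_q funcset_closed)
next
  case (Suc n)
  have x: "x k i \<in> univ M" if "k < Suc n" for k i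
    using Suc.prems[OF that] by (simp add: funcset_UNIV_iff)
  have R: "(\<Oplus>\<^bsub>R\<^esub>k\<in>{..<Suc n}. x k i) = x n i \<oplus>\<^bsub>R\<^esub> (\<Oplus>\<^bsub>R\<^esub>k\<in>{..<n}. x k i)" for i
    unfolding lessThan_Suc by (rule R.finsum_insert) (auto simp: x)
  have "(\<Oplus>\<^bsub>S\<^esub>k\<in>{..<Suc n}. q (x k)) = q (x n) \<oplus>\<^bsub>S\<^esub> (\<Oplus>\<^bsub>S\<^esub>k\<in>{..<n}. q (x k))"
    unfolding lessThan_Suc by (rule S.finsum_insert) (use Suc.prems q_closed in auto)
  then show ?case using Suc by (simp add: R add_q funcset_closed)
qed

section \<open>Points and primitives of the geometry over the ultrapower\<close>

definition comps :: "('i \<Rightarrow> 'u list) \<Rightarrow> ('i \<Rightarrow> 'u) list" where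
  "comps x = map (\<lambda>k i. x i ! k) [0..<d]"

text \<open>The identification of a sequence of points with a point over the ultrapower: transpose
  to a list of coordinate sequences, then pass to classes.\<close>

definition qpt :: "('i \<Rightarrow> 'u list) \<Rightarrow> 'w list" where
  "qpt x = map q (comps x)"

lemma comps_in_tuples: "x \<in> UNIV \<rightarrow> points d M \<Longrightarrow> comps x \<in> tuples d (UNIV \<rightarrow> univ M)"
  by (auto simp: comps_def funcset_UNIV_iff tuples_nth[of _ d] tuples_def[of _ "UNIV \<rightarrow> univ M"])

lemma map_comps: "x \<in> UNIV \<rightarrow> points d M \<Longrightarrow> map (\<lambda>h. h i) (comps x) = x i"
  by (auto simp: comps_def tuples_def funcset_UNIV_iff intro: nth_equalityI)

lemma nth_qpt: "k < d \<Longrightarrow> qpt x ! k = q (\<lambda>i. x i ! k)"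
  by (simp add: qpt_def comps_def)

lemma points_N: "points d N = qpt ` (UNIV \<rightarrow> points d M)"
proof (intro equalityI subsetI)
  fix y assume "y \<in> points d N"
  then obtain xs where xs: "xs \<in> tuples d (UNIV \<rightarrow> univ M)" "map q xs = y" by (rule ex_lift_tuple)
  let ?x = "\<lambda>i. map (\<lambda>h. h i) xs"
  have "?x \<in> UNIV \<rightarrow> points d M" using map_apply_in_tuples[OF xs(1)] by simp
  moreover have "comps ?x = xs" using xs(1) by (auto simp: comps_def tuples_def intro: nth_equalityI)
  then have "qpt ?x = y" by (simp add: qpt_def xs(2))
  ultimately show "y \<in> qpt ` (UNIV \<rightarrow> points d M)" by blast
next
  fix y assume "y \<in> qpt ` (UNIV \<rightarrow> points d M)"
  then show "y \<in> points d N" using comps_in_tuples map_q_in_tuples by (auto simp: qpt_def)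
qed

lemma qpt_eq_iff:
  assumes "x \<in> UNIV \<rightarrow> points d M" "y \<in> UNIV \<rightarrow> points d M"
  shows "qpt x = qpt y \<longleftrightarrow> eventually (\<lambda>i. x i = y i) U"
proof -
  have "qpt x = qpt y \<longleftrightarrow>
      eventually (\<lambda>i. map (\<lambda>h. h i) (comps x) = map (\<lambda>h. h i) (comps y)) U"
    unfolding qpt_def using comps_in_tuples[OF assms(1)] comps_in_tuples[OF assms(2)]
    by (intro map_eq_iff_eventually[OF q_eq_iff]) (auto simp: tuples_def)
  then show ?thesis by (simp add: map_comps assms)
qed

lemma nth_funcset: "x \<in> UNIV \<rightarrow> points d M \<Longrightarrow> k < d \<Longrightarrow> (\<lambda>i. x i ! k) \<in> UNIV \<rightarrow> univ M"
  by (auto simp: tuples_nth[of _ d] funcset_UNIV_iff)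

lemma qpt_eqI:
  assumes "length y = d" "\<And>k. k < d \<Longrightarrow> y ! k = q (\<lambda>i. x i ! k)"
  shows "qpt x = y"
  using assms by (auto simp: qpt_def comps_def intro: nth_equalityI)

lemma aff_comb_q:
  assumes "t \<in> UNIV \<rightarrow> univ M" "a \<in> UNIV \<rightarrow> points d M" "c \<in> UNIV \<rightarrow> points d M"
  shows "qpt (\<lambda>i. aff_comb d M (t i) (a i) (c i)) = aff_comb d N (q t) (qpt a) (qpt c)"
    "(\<lambda>i. aff_comb d M (t i) (a i) (c i)) \<in> UNIV \<rightarrow> points d M"
proof -
  have 1: "(\<lambda>i. \<one>\<^bsub>R\<^esub> \<ominus>\<^bsub>R\<^esub> t i) \<in> UNIV \<rightarrow> univ M"
    using assms(1) R.minus_closed[OF R.one_closed] by (simp add: funcset_UNIV_iff)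
  show "qpt (\<lambda>i. aff_comb d M (t i) (a i) (c i)) = aff_comb d N (q t) (qpt a) (qpt c)"
  proof (rule qpt_eqI)
    fix k assume k: "k < d"
    show "aff_comb d N (q t) (qpt a) (qpt c) ! k = q (\<lambda>i. aff_comb d M (t i) (a i) (c i) ! k)"
      using k 1 nth_funcset[OF assms(2) k] nth_funcset[OF assms(3) k] assms(1)
      by (simp add: aff_comb_def nth_qpt one_q minus_q mult_q add_q funcset_closed)
  qed (simp add: aff_comb_def)
  have "a i ! k \<in> univ M" "c i ! k \<in> univ M" "t i \<in> univ M" "\<one>\<^bsub>R\<^esub> \<ominus>\<^bsub>R\<^esub> t i \<in> univ M" if "k < d" for i k
    using nth_funcset[OF assms(2) that] nth_funcset[OF assms(3) that] assms(1) 1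
    by (simp_all add: funcset_UNIV_iff)
  then show "(\<lambda>i. aff_comb d M (t i) (a i) (c i)) \<in> UNIV \<rightarrow> points d M"
    using R.a_closed R.m_closed by (auto simp: aff_comb_def tuples_def)
qed

lemma lt_q:
  assumes "\<kappa> = Ordered_Field" "x \<in> UNIV \<rightarrow> univ M" "y \<in> UNIV \<rightarrow> univ M"
  shows "lt N (q x) (q y) \<longleftrightarrow> eventually (\<lambda>i. lt M (x i) (y i)) U"
  using pint_q[of Less "[x, y]"] expandsD(4)[OF expands assms(1)] assms(2,3)
  by (simp add: lt_def tuples_def)

lemma le_q:
  assumes "\<kappa> = Ordered_Field" "x \<in> UNIV \<rightarrow> univ M" "y \<in> UNIV \<rightarrow> univ M"
  shows "le N (q x) (q y) \<longleftrightarrow> eventually (\<lambda>i. le M (x i) (y i)) U"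
  using assms by (simp add: le_def lt_q q_eq_iff eventually_disj_ultrafilter[OF ultrafilter])

text \<open>\<open>key_rel\<close> is given directly and not by a formula, so instead of
  \<open>los\<close> its parts are transferred by hand: the parameter \<open>t\<close> is chosen
  index by index, and in the collinear case the ultrafilter splits the disjunction.\<close>

lemma key_rel_q:
  assumes abc: "a \<in> UNIV \<rightarrow> points d M" "b \<in> UNIV \<rightarrow> points d M" "c \<in> UNIV \<rightarrow> points d M"
  shows "[qpt a, qpt b, qpt c] \<in> key_rel \<kappa> d N \<longleftrightarrow>
    eventually (\<lambda>i. [a i, b i, c i] \<in> key_rel \<kappa> d M) U"
proof -
  have pt: "qpt a \<in> points d N" "qpt b \<in> points d N" "qpt c \<in> points d N"
    unfolding points_N using abc by blast+
  have pt': "a i \<in> points d M" "b i \<in> points d M" "c i \<in> points d M" for i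
    using abc by (simp_all add: funcset_UNIV_iff)
  have comb: "qpt b = aff_comb d N (q t) (qpt a) (qpt c) \<longleftrightarrow>
      eventually (\<lambda>i. b i = aff_comb d M (t i) (a i) (c i)) U" if "t \<in> UNIV \<rightarrow> univ M" for t
    using qpt_eq_iff[OF abc(2) aff_comb_q(2)[OF that abc(1,3)]] aff_comb_q(1)[OF that abc(1,3)] by simp
  show ?thesis
  proof (cases \<kappa>)
    case Ordered_Field
    have "[qpt a, qpt b, qpt c] \<in> key_rel \<kappa> d N \<longleftrightarrow> Bw d N (qpt a) (qpt b) (qpt c)"
      using pt by (simp add: Ordered_Field)
    also have "\<dots> \<longleftrightarrow> (\<exists>t\<in>UNIV \<rightarrow> univ M. le N \<zero>\<^bsub>S\<^esub> (q t) \<and> le N (q t) \<one>\<^bsub>S\<^esub> \<and>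
        qpt b = aff_comb d N (q t) (qpt a) (qpt c))"
      unfolding Bw_def univ_image by blast
    also have "\<dots> \<longleftrightarrow> (\<exists>t\<in>UNIV \<rightarrow> univ M. eventually (\<lambda>i. le M \<zero>\<^bsub>R\<^esub> (t i) \<and> le M (t i) \<one>\<^bsub>R\<^esub> \<and>
        b i = aff_comb d M (t i) (a i) (c i)) U)"
      by (intro bex_cong refl)
        (simp add: zero_q one_q le_q[OF Ordered_Field] funcset_closed comb eventually_conj_iff)
    also have "\<dots> \<longleftrightarrow> eventually (\<lambda>i. Bw d M (a i) (b i) (c i)) U"
      unfolding Bw_def by (rule eventually_ex_funcset[OF univ_nonempty, symmetric])
    also have "(\<lambda>i. Bw d M (a i) (b i) (c i)) = (\<lambda>i. [a i, b i, c i] \<in> key_rel \<kappa> d M)"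
      using pt' by (simp add: Ordered_Field)
    finally show ?thesis .
  next
    case Plain_Field
    have "[qpt a, qpt b, qpt c] \<in> key_rel \<kappa> d N \<longleftrightarrow> Col d N (qpt a) (qpt b) (qpt c)"
      using pt by (simp add: Plain_Field)
    also have "\<dots> \<longleftrightarrow> qpt a = qpt b \<or> qpt b = qpt c \<or> qpt a = qpt c \<or>
        (\<exists>t\<in>UNIV \<rightarrow> univ M. qpt b = aff_comb d N (q t) (qpt a) (qpt c))"
      unfolding Col_def univ_image by blast
    also have "(\<exists>t\<in>UNIV \<rightarrow> univ M. qpt b = aff_comb d N (q t) (qpt a) (qpt c)) \<longleftrightarrow>
        (\<exists>t\<in>UNIV \<rightarrow> univ M. eventually (\<lambda>i. b i = aff_comb d M (t i) (a i) (c i)) U)"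
      by (intro bex_cong refl comb)
    also have "\<dots> \<longleftrightarrow> eventually (\<lambda>i. \<exists>t\<in>univ M. b i = aff_comb d M t (a i) (c i)) U"
      by (rule eventually_ex_funcset[OF univ_nonempty, symmetric])
    also have "(qpt a = qpt b \<or> qpt b = qpt c \<or> qpt a = qpt c \<or>
        eventually (\<lambda>i. \<exists>t\<in>univ M. b i = aff_comb d M t (a i) (c i)) U) \<longleftrightarrow>
        eventually (\<lambda>i. Col d M (a i) (b i) (c i)) U"
      by (simp add: Col_def qpt_eq_iff abc eventually_disj_ultrafilter[OF ultrafilter])
    also have "(\<lambda>i. Col d M (a i) (b i) (c i)) = (\<lambda>i. [a i, b i, c i] \<in> key_rel \<kappa> d M)"
      using pt' by (simp add: Plain_Field)
    finally show ?thesis .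
  qed
qed

lemma map_qpt_in_tuples: "as \<in> tuples n (UNIV \<rightarrow> points d M) \<Longrightarrow> map qpt as \<in> tuples n (points d N)"
  by (auto simp: tuples_def[of n] points_N)

lemma prim_rel_q:
  assumes \<phi>: "is_formula L (d * n) \<phi>" and as: "as \<in> tuples n (UNIV \<rightarrow> points d M)"
  shows "map qpt as \<in> prim_rel d N (n, \<phi>) \<longleftrightarrow>
    eventually (\<lambda>i. map (\<lambda>x. x i) as \<in> prim_rel d M (n, \<phi>)) U"
proof -
  have a: "x \<in> UNIV \<rightarrow> points d M" if "x \<in> set as" for x using as that by (auto simp: tuples_def[of n])
  let ?hs = "concat (map comps as)"
  have hs: "?hs \<in> tuples (d * n) (UNIV \<rightarrow> univ M)"
  proof -
    have c: "length (comps x) = d" "set (comps x) \<subseteq> UNIV \<rightarrow> univ M" if "x \<in> set as" for x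
      using comps_in_tuples[OF a[OF that]] by (simp_all add: tuples_def)
    have "map length (map comps as) = map (\<lambda>_. d) as" using c by simp
    then have "length ?hs = d * n"
      using as by (simp add: length_concat tuples_def map_replicate_const sum_list_replicate)
    then show ?thesis using c by (auto simp: tuples_def)
  qed
  have "qpt = (\<lambda>x. map q (comps x))" by (rule ext) (rule qpt_def)
  then have 1: "concat (map qpt as) = map q ?hs" by (simp add: map_concat comp_def)
  have 2: "map (\<lambda>h. h i) ?hs = concat (map (\<lambda>x. x i) as)" for i
    using a by (simp add: map_concat comp_def map_comps cong: map_cong)
  have 3: "map (\<lambda>x. x i) as \<in> tuples n (points d M)" for i
    using as by (auto simp: tuples_def[of n] funcset_UNIV_iff)
  show ?thesis
    unfolding prim_rel_def using map_qpt_in_tuples[OF as] 3 defined_rel_q[OF \<phi> hs]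
    by (simp add: 1 2)
qed

lemma points_nonempty: "points d M \<noteq> {}"
proof -
  obtain u where "u \<in> univ M" using univ_nonempty by blast
  then have "replicate d u \<in> points d M" by (auto simp: tuples_def)
  then show ?thesis by blast
qed

text \<open>Forming the geometry commutes with forming the ultrapower, so Los's theorem becomes
  available for formulas in the language of the geometry.\<close>

lemma ultra_map_geo_struct:
  assumes "is_geometry L d \<Gamma>"
  shows "ultra_map U (geo_lang \<Gamma>) (geo_struct \<kappa> d \<Gamma> M) (geo_struct \<kappa> d \<Gamma> N) qpt"
proof
  show "is_ultrafilter U" by (rule ultrafilter)
  show "univ (geo_struct \<kappa> d \<Gamma> M) \<noteq> {}" using points_nonempty by (simp add: geo_struct_def)
  show "univ (geo_struct \<kappa> d \<Gamma> N) = qpt ` (UNIV \<rightarrow> univ (geo_struct \<kappa> d \<Gamma> M))"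
    by (simp add: geo_struct_def points_N)
  show "qpt x = qpt y \<longleftrightarrow> eventually (\<lambda>i. x i = y i) U"
    if "x \<in> UNIV \<rightarrow> univ (geo_struct \<kappa> d \<Gamma> M)" "y \<in> UNIV \<rightarrow> univ (geo_struct \<kappa> d \<Gamma> M)" for x y
    using that by (simp add: geo_struct_def qpt_eq_iff)
  show "map qpt xs \<in> pint (geo_struct \<kappa> d \<Gamma> N) p \<longleftrightarrow>
      eventually (\<lambda>i. map (\<lambda>x. x i) xs \<in> pint (geo_struct \<kappa> d \<Gamma> M) p) U"
    if p: "p \<in> psyms (geo_lang \<Gamma>)"
      and xs: "xs \<in> tuples (parity (geo_lang \<Gamma>) p) (UNIV \<rightarrow> univ (geo_struct \<kappa> d \<Gamma> M))" for p xs
  proof (cases p)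
    case Key
    have "length xs = Suc (Suc (Suc 0))" "set xs \<subseteq> UNIV \<rightarrow> points d M"
      using xs by (simp_all add: Key geo_lang_def geo_struct_def tuples_def[of 3])
    then obtain a b c where abc: "xs = [a, b, c]"
      "a \<in> UNIV \<rightarrow> points d M" "b \<in> UNIV \<rightarrow> points d M" "c \<in> UNIV \<rightarrow> points d M"
      by (auto simp: length_Suc_conv)
    then show ?thesis using key_rel_q[OF abc(2-4)] by (simp add: Key geo_struct_def)
  next
    case (Prim j)
    then have j: "j < length \<Gamma>" using p by (auto simp: geo_lang_def)
    obtain n \<phi> where \<Gamma>: "\<Gamma> ! j = (n, \<phi>)" by (cases "\<Gamma> ! j")
    then have "(n, \<phi>) \<in> set \<Gamma>" using j nth_mem by metis
    then have "is_formula L (d * n) \<phi>" using assms by (auto simp: is_geometry_def)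
    moreover have "xs \<in> tuples n (UNIV \<rightarrow> points d M)"
      using xs by (simp add: Prim geo_lang_def geo_struct_def \<Gamma>)
    ultimately show ?thesis using prim_rel_q by (simp add: Prim geo_struct_def \<Gamma>)
  qed
qed (simp_all add: geo_lang_def)

section \<open>Affine maps and matrices over the ultrapower\<close>

lemma affine_map_q:
  assumes A: "\<And>r s. r < d \<Longrightarrow> s < d \<Longrightarrow> A r s \<in> UNIV \<rightarrow> univ M"
    and b: "b \<in> UNIV \<rightarrow> points d M" and y: "y \<in> UNIV \<rightarrow> points d M"
  shows "affine_map d S (\<lambda>r s. q (A r s)) (qpt b) (qpt y) =
      qpt (\<lambda>i. affine_map d R (\<lambda>r s. A r s i) (b i) (y i))"
proof (rule qpt_eqI[symmetric])
  have yN: "qpt y \<in> points d N" unfolding points_N using y by blast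
  have yM: "y i \<in> points d M" for i using y by (simp add: funcset_UNIV_iff)
  show "length (affine_map d S (\<lambda>r s. q (A r s)) (qpt b) (qpt y)) = d"
    using yN by (simp add: affine_map_def)
  fix k assume k: "k < d"
  have Ay: "(\<lambda>i. A k j i \<otimes>\<^bsub>R\<^esub> y i ! j) \<in> UNIV \<rightarrow> univ M" if "j < d" for j
    using A[OF k that] nth_funcset[OF y that] by (rule funcset_closed(2))
  have "(\<Oplus>\<^bsub>S\<^esub>j\<in>{..<d}. q (A k j) \<otimes>\<^bsub>S\<^esub> qpt y ! j) = (\<Oplus>\<^bsub>S\<^esub>j\<in>{..<d}. q (\<lambda>i. A k j i \<otimes>\<^bsub>R\<^esub> y i ! j))"
    by (rule S.finsum_cong') (use A[OF k] nth_funcset[OF y] Ay in \<open>auto simp: nth_qpt mult_q q_closed\<close>)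
  then show "affine_map d S (\<lambda>r s. q (A r s)) (qpt b) (qpt y) ! k =
      q (\<lambda>i. affine_map d R (\<lambda>r s. A r s i) (b i) (y i) ! k)"
    using yN yM k finsum_q[of d "\<lambda>j i. A k j i \<otimes>\<^bsub>R\<^esub> y i ! j"] Ay nth_funcset[OF b k]
    by (simp add: affine_map_def nth_qpt add_q)
qed

lemma affine_map_closed:
  assumes "\<And>r s. r < d \<Longrightarrow> s < d \<Longrightarrow> A r s \<in> univ M" "b \<in> points d M" "y \<in> points d M"
  shows "affine_map d R A b y \<in> points d M"
proof -
  have "b ! k \<in> univ M" "y ! k \<in> univ M" if "k < d" for k
    using assms(2,3) that by (auto simp: tuples_def subset_iff)
  then have "(\<Oplus>\<^bsub>R\<^esub>j\<in>{..<d}. A k j \<otimes>\<^bsub>R\<^esub> y ! j) \<oplus>\<^bsub>R\<^esub> b ! k \<in> univ M" if "k < d" for k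
    using assms(1) that R.add.m_closed R.m_closed
      R.finsum_closed[of "\<lambda>j. A k j \<otimes>\<^bsub>R\<^esub> y ! j" "{..<d}"] by (auto simp: Pi_iff)
  then show ?thesis using assms(3) by (auto simp: affine_map_def tuples_def)
qed

text \<open>Invertibility with a given inverse consists of finitely many equations between entries;
  each holds at almost all indices, hence all of them do together.\<close>

lemma eventually_inverse_matrices:
  assumes A: "\<And>r s. r < d \<Longrightarrow> s < d \<Longrightarrow> A r s \<in> UNIV \<rightarrow> univ M"
    and B: "\<And>r s. r < d \<Longrightarrow> s < d \<Longrightarrow> B r s \<in> UNIV \<rightarrow> univ M"
    and inv: "inverse_matrices d S (\<lambda>r s. q (A r s)) (\<lambda>r s. q (B r s))"
  shows "eventually (\<lambda>i. inverse_matrices d R (\<lambda>r s. A r s i) (\<lambda>r s. B r s i)) U"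
proof -
  have entry: "(\<Oplus>\<^bsub>S\<^esub>k\<in>{..<d}. q (A r k) \<otimes>\<^bsub>S\<^esub> q (B k s)) = (if r = s then \<one>\<^bsub>S\<^esub> else \<zero>\<^bsub>S\<^esub>) \<longleftrightarrow>
      eventually (\<lambda>i. (\<Oplus>\<^bsub>R\<^esub>k\<in>{..<d}. A r k i \<otimes>\<^bsub>R\<^esub> B k s i) = (if r = s then \<one>\<^bsub>R\<^esub> else \<zero>\<^bsub>R\<^esub>)) U"
    if A: "\<And>r s. r < d \<Longrightarrow> s < d \<Longrightarrow> A r s \<in> UNIV \<rightarrow> univ M"
      and B: "\<And>r s. r < d \<Longrightarrow> s < d \<Longrightarrow> B r s \<in> UNIV \<rightarrow> univ M" and rs: "r < d" "s < d" for A B r s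
  proof -
    have AB: "(\<lambda>i. A r k i \<otimes>\<^bsub>R\<^esub> B k s i) \<in> UNIV \<rightarrow> univ M" if "k < d" for k
      using A[OF rs(1) that] B[OF that rs(2)] by (rule funcset_closed(2))
    have "(\<Oplus>\<^bsub>S\<^esub>k\<in>{..<d}. q (A r k) \<otimes>\<^bsub>S\<^esub> q (B k s)) = (\<Oplus>\<^bsub>S\<^esub>k\<in>{..<d}. q (\<lambda>i. A r k i \<otimes>\<^bsub>R\<^esub> B k s i))"
      by (rule S.finsum_cong') (use A[OF rs(1)] B[OF _ rs(2)] AB in \<open>auto simp: mult_q q_closed\<close>)
    then have e1: "(\<Oplus>\<^bsub>S\<^esub>k\<in>{..<d}. q (A r k) \<otimes>\<^bsub>S\<^esub> q (B k s)) = q (\<lambda>i. \<Oplus>\<^bsub>R\<^esub>k\<in>{..<d}. A r k i \<otimes>\<^bsub>R\<^esub> B k s i)"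
      "(\<lambda>i. \<Oplus>\<^bsub>R\<^esub>k\<in>{..<d}. A r k i \<otimes>\<^bsub>R\<^esub> B k s i) \<in> UNIV \<rightarrow> univ M"
      using finsum_q[of d "\<lambda>k i. A r k i \<otimes>\<^bsub>R\<^esub> B k s i"] AB by simp_all
    have e2: "(if r = s then \<one>\<^bsub>S\<^esub> else \<zero>\<^bsub>S\<^esub>) = q (\<lambda>i. if r = s then \<one>\<^bsub>R\<^esub> else \<zero>\<^bsub>R\<^esub>)"
      "(\<lambda>i. if r = s then \<one>\<^bsub>R\<^esub> else \<zero>\<^bsub>R\<^esub>) \<in> UNIV \<rightarrow> univ M"
      using funcset_closed(4,5) by (cases "r = s"; simp add: zero_q one_q)+
    show ?thesis unfolding e1(1) e2(1) by (rule q_eq_iff[OF e1(2) e2(2)])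
  qed
  have "eventually (\<lambda>i. \<forall>r\<in>{..<d}. \<forall>s\<in>{..<d}.
      (\<Oplus>\<^bsub>R\<^esub>k\<in>{..<d}. A r k i \<otimes>\<^bsub>R\<^esub> B k s i) = (if r = s then \<one>\<^bsub>R\<^esub> else \<zero>\<^bsub>R\<^esub>) \<and>
      (\<Oplus>\<^bsub>R\<^esub>k\<in>{..<d}. B r k i \<otimes>\<^bsub>R\<^esub> A k s i) = (if r = s then \<one>\<^bsub>R\<^esub> else \<zero>\<^bsub>R\<^esub>)) U"
  proof (intro eventually_ball_finite finite_lessThan ballI eventually_conj)
    fix r s assume rs: "r \<in> {..<d}" "s \<in> {..<d}"
    show "eventually (\<lambda>i. (\<Oplus>\<^bsub>R\<^esub>k\<in>{..<d}. A r k i \<otimes>\<^bsub>R\<^esub> B k s i) = (if r = s then \<one>\<^bsub>R\<^esub> else \<zero>\<^bsub>R\<^esub>)) U"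
      using entry[of A B r s] A B inv rs by (simp add: inverse_matrices_def)
    show "eventually (\<lambda>i. (\<Oplus>\<^bsub>R\<^esub>k\<in>{..<d}. B r k i \<otimes>\<^bsub>R\<^esub> A k s i) = (if r = s then \<one>\<^bsub>R\<^esub> else \<zero>\<^bsub>R\<^esub>)) U"
      using entry[of B A r s] A B inv rs by (simp add: inverse_matrices_def)
  qed
  then show ?thesis by (simp add: inverse_matrices_def Ball_def)
qed

end

section \<open>Concepts and affine automorphisms\<close>

lemma univ_geo_struct [simp]: "univ (geo_struct \<kappa> d \<Gamma> M) = points d M"
  by (simp add: geo_struct_def)

lemma fsyms_geo_lang [simp]: "fsyms (geo_lang \<Gamma>) = {}"
  by (simp add: geo_lang_def)

lemma finite_psyms_geo_lang: "finite (psyms (geo_lang \<Gamma>))"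
  by (simp add: geo_lang_def)

text \<open>The easy direction: a primitive of the first geometry is one of its concepts, hence
  definable in the second, and automorphisms of the second preserve whatever is definable
  there.\<close>

lemma AffAut_mono_if_Conc_mono:
  assumes M: "points d M \<noteq> {}" and C: "Conc \<kappa> d \<Gamma> M \<subseteq> Conc \<kappa> d \<Gamma>' M"
  shows "AffAut \<kappa> d \<Gamma>' M \<subseteq> AffAut \<kappa> d \<Gamma> M"
proof
  fix \<alpha> assume \<alpha>: "\<alpha> \<in> AffAut \<kappa> d \<Gamma>' M"
  then have Aut: "\<alpha> \<in> Aut (geo_lang \<Gamma>') (geo_struct \<kappa> d \<Gamma>' M)" by (simp add: AffAut_def)
  have "xs \<in> pint (geo_struct \<kappa> d \<Gamma> M) p \<longleftrightarrow> map \<alpha> xs \<in> pint (geo_struct \<kappa> d \<Gamma> M) p"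
    if p: "p \<in> psyms (geo_lang \<Gamma>)" and xs: "xs \<in> tuples (parity (geo_lang \<Gamma>) p) (points d M)" for p xs
  \<comment> \<open>These symbols do not go through \<open>Conc\<close>: the key relation is
    primitive in both geometries, and a primitive of arity 0 is no concept, but
    \<open>map \<alpha>\<close> fixes the empty tuple.\<close>
  proof (cases "p = Key \<or> parity (geo_lang \<Gamma>) p = 0")
    case True
    then show ?thesis
    proof
      assume "p = Key"
      then show ?thesis using Aut_pint[OF Aut, of Key xs] xs by (simp add: geo_lang_def geo_struct_def)
    next
      assume "parity (geo_lang \<Gamma>) p = 0"
      then show ?thesis using xs by (simp add: tuples_def)
    qed
  next
    case False
    define n where "n = parity (geo_lang \<Gamma>) p"
    define \<phi> :: "(unit, geo_sym) fm" where "\<phi> = Rel p (map Var [0..<n])"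
    have \<phi>: "is_formula (geo_lang \<Gamma>) n \<phi>"
      using p by (auto simp: \<phi>_def is_formula_def n_def list_all_iff)
    have sat: "ys \<in> defined_rel (geo_struct \<kappa> d \<Gamma> M) n \<phi> \<longleftrightarrow> ys \<in> pint (geo_struct \<kappa> d \<Gamma> M) p"
      if "ys \<in> tuples n (points d M)" for ys
    proof -
      have "map (nth ys) [0..<n] = ys" using that by (auto simp: tuples_def intro: nth_equalityI)
      then show ?thesis using that by (simp add: defined_rel_def \<phi>_def comp_def)
    qed
    have "defined_rel (geo_struct \<kappa> d \<Gamma> M) n \<phi> \<in> Conc \<kappa> d \<Gamma> M"
      using \<phi> False unfolding Conc_def definable_def n_def
      by (intro CollectI exI[of _ "parity (geo_lang \<Gamma>) p"] exI[of _ \<phi>] conjI) auto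
    \<comment> \<open>A member of \<open>Conc\<close> carries no arity, so the defining formula may
      come with some \<open>m\<close> different from \<open>n\<close>; in that case its relation
      contains no tuple of length \<open>n\<close>, and both sides of the equivalence below are
      false.\<close>
    then obtain m \<psi> where \<psi>: "is_formula (geo_lang \<Gamma>') m \<psi>"
      "defined_rel (geo_struct \<kappa> d \<Gamma> M) n \<phi> = defined_rel (geo_struct \<kappa> d \<Gamma>' M) m \<psi>"
      using C unfolding Conc_def definable_def by blast
    have xs': "xs \<in> tuples n (points d M)" using xs by (simp add: n_def)
    have "\<alpha> x \<in> points d M" if "x \<in> points d M" for x using Aut_closed[OF Aut] that by simp
    then have \<alpha>xs: "map \<alpha> xs \<in> tuples n (points d M)" using xs' by (auto simp: tuples_def[of n])
    have "map \<alpha> xs \<in> defined_rel (geo_struct \<kappa> d \<Gamma>' M) m \<psi> \<longleftrightarrow>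
        xs \<in> defined_rel (geo_struct \<kappa> d \<Gamma>' M) m \<psi>"
    proof (cases "m = n")
      case True
      show ?thesis
        by (rule defined_rel_automorphism[OF Aut _ \<psi>(1)]) (use M xs' True in auto)
    next
      case False
      then show ?thesis using xs' \<alpha>xs by (auto simp: defined_rel_def tuples_def)
    qed
    then show ?thesis using sat[OF xs'] sat[OF \<alpha>xs] \<psi>(2) by simp
  qed
  moreover have "\<alpha> \<in> Bij (points d M)" using Aut by (simp add: Aut_def)
  ultimately show "\<alpha> \<in> AffAut \<kappa> d \<Gamma> M" using \<alpha> by (simp add: AffAut_def Aut_def)
qed

text \<open>Points are lists over \<open>'a\<close>, and an infinite type has no more lists than
  elements. This permits \<open>'v\<close> to be \<open>'a\<close>, whence the index type
  \<open>'a set set\<close> in the faithfulness assumption.\<close>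

lemma points_lepoll:
  fixes M :: "('f, 'p, 'a) fostruct"
  assumes "infinite (points d M)"
  shows "points d M \<lesssim> (UNIV :: 'a set)"
proof -
  have "infinite (UNIV :: 'a set)"
  proof
    assume "finite (UNIV :: 'a set)"
    then have "finite (univ M)" by (rule finite_subset[OF subset_UNIV])
    then show False using finite_tuples[of "univ M" d] assms by simp
  qed
  then have *: "lists (UNIV :: 'a set) \<lesssim> (UNIV :: 'a set)" by (rule lists_lepoll_infinite) (rule lepoll_refl)
  show ?thesis by (rule lepoll_trans[OF subset_imp_lepoll *]) simp
qed

lemma prim_rel_coordinatewise:
  assumes \<sigma>: "\<sigma> \<in> Aut L M" and closed: "\<And>f us. f \<in> fsyms L \<Longrightarrow> us \<in> tuples (farity L f) (univ M) \<Longrightarrow>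
      fint M f us \<in> univ M"
    and \<phi>: "is_formula L (d * n) \<phi>" and ne: "univ M \<noteq> {}" and xs: "xs \<in> tuples n (points d M)"
  shows "map (coordinatewise d M \<sigma>) xs \<in> prim_rel d M (n, \<phi>) \<longleftrightarrow> xs \<in> prim_rel d M (n, \<phi>)"
proof -
  have x: "x \<in> points d M" if "x \<in> set xs" for x using xs that by (auto simp: tuples_def[of n])
  have "map (coordinatewise d M \<sigma>) xs = map (map \<sigma>) xs" using x by (simp add: coordinatewise_def)
  then have 1: "concat (map (coordinatewise d M \<sigma>) xs) = map \<sigma> (concat xs)"
    by (simp only: map_concat)
  have "map \<sigma> x \<in> points d M" if "x \<in> points d M" for x
    using that Aut_closed[OF \<sigma>] by (auto simp: tuples_def)
  then have 2: "map (coordinatewise d M \<sigma>) xs \<in> tuples n (points d M)"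
    using xs by (auto simp: tuples_def[of n] coordinatewise_def)
  have "map length xs = map (\<lambda>_. d) xs" using x by (simp add: tuples_def)
  then have "length (concat xs) = d * n"
    using xs by (simp add: length_concat tuples_def map_replicate_const sum_list_replicate)
  then have "concat xs \<in> tuples (d * n) (univ M)" using x by (auto simp: tuples_def)
  from defined_rel_automorphism[OF \<sigma> closed \<phi> ne this]
  show ?thesis unfolding prim_rel_def using 1 2 xs by simp
qed

context ultra_field
begin

lemma fint_closed_N: "f \<in> fsyms L \<Longrightarrow> us \<in> tuples (farity L f) (univ N) \<Longrightarrow> fint N f us \<in> univ N"
proof -
  assume f: "f \<in> fsyms L" and us: "us \<in> tuples (farity L f) (univ N)"
  obtain xs where xs: "xs \<in> tuples (farity L f) (UNIV \<rightarrow> univ M)" "map q xs = us"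
    using us by (rule ex_lift_tuple)
  have "fint M f (map (\<lambda>x. x i) xs) \<in> univ M" for i
    using f map_apply_in_tuples[OF xs(1)] by (rule fint_closed)
  then show "fint N f us \<in> univ N"
    using fint_q[OF f xs(1)] xs(2) by (auto intro: q_closed)
qed

text \<open>The coordinatewise map \<open>\<sigma>\<close> preserves the key relation because both \<open>\<alpha>\<close> and
  the affine map do; so it is an automorphism of every geometry over \<open>N\<close>.\<close>

lemma coordinatewise_in_Aut:
  assumes \<alpha>: "\<alpha> \<in> Aut (geo_lang \<Gamma>') (geo_struct \<kappa> d \<Gamma>' N)"
    and A: "A \<in> Aut (geo_lang \<Gamma>') (geo_struct \<kappa> d \<Gamma>' N)"
    and \<sigma>: "\<sigma> \<in> Aut L N" and eq: "\<alpha> = compose (points d N) A (coordinatewise d N \<sigma>)"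
    and \<Gamma>: "is_geometry L d \<Gamma>"
  shows "coordinatewise d N \<sigma> \<in> Aut (geo_lang \<Gamma>) (geo_struct \<kappa> d \<Gamma> N)"
proof -
  let ?s = "coordinatewise d N \<sigma>"
  have bij\<sigma>: "inj_on \<sigma> (univ N)" "\<sigma> ` univ N = univ N"
    using \<sigma> by (auto simp: Aut_def Bij_def bij_betw_def)
  have s: "?s x \<in> points d N" if "x \<in> points d N" for x
    using that Aut_closed[OF \<sigma>] by (auto simp: tuples_def coordinatewise_def)
  have "inj_on ?s (points d N)"
  proof (rule inj_onI)
    fix x y assume xy: "x \<in> points d N" "y \<in> points d N" "?s x = ?s y"
    then have "map \<sigma> x = map \<sigma> y" by (simp add: coordinatewise_def)
    moreover have "inj_on \<sigma> (set x \<union> set y)"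
      using xy by (intro inj_on_subset[OF bij\<sigma>(1)]) (auto simp: tuples_def)
    ultimately show "x = y" by (rule map_inj_on)
  qed
  moreover have "?s ` points d N = points d N"
  proof (intro equalityI subsetI)
    fix y assume y: "y \<in> points d N"
    let ?x = "map (inv_into (univ N) \<sigma>) y"
    have "inv_into (univ N) \<sigma> u \<in> univ N" "\<sigma> (inv_into (univ N) \<sigma> u) = u" if "u \<in> set y" for u
    proof -
      have "u \<in> \<sigma> ` univ N" using y that bij\<sigma>(2) by (auto simp: tuples_def)
      then show "inv_into (univ N) \<sigma> u \<in> univ N" "\<sigma> (inv_into (univ N) \<sigma> u) = u"
        by (rule inv_into_into, rule f_inv_into_f)
    qed
    then have "?x \<in> points d N" "map \<sigma> ?x = y" using y by (auto simp: tuples_def intro: map_idI)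
    then have "y = ?s ?x" "?x \<in> points d N" by (simp_all add: coordinatewise_def)
    then show "y \<in> ?s ` points d N" by blast
  qed (use s in blast)
  ultimately have "?s \<in> Bij (points d N)"
    by (simp add: Bij_def bij_betw_def coordinatewise_def)
  moreover have "xs \<in> pint (geo_struct \<kappa> d \<Gamma> N) p \<longleftrightarrow> map ?s xs \<in> pint (geo_struct \<kappa> d \<Gamma> N) p"
    if p: "p \<in> psyms (geo_lang \<Gamma>)" and xs: "xs \<in> tuples (parity (geo_lang \<Gamma>) p) (points d N)" for p xs
  proof (cases p)
    case Key
    have xs3: "xs \<in> tuples 3 (points d N)" using xs by (simp add: Key geo_lang_def)
    have key: "ys \<in> key_rel \<kappa> d N \<longleftrightarrow> map \<beta> ys \<in> key_rel \<kappa> d N"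
      if "\<beta> \<in> Aut (geo_lang \<Gamma>') (geo_struct \<kappa> d \<Gamma>' N)" "ys \<in> tuples 3 (points d N)" for \<beta> ys
      using Aut_pint[OF that(1), of Key ys] that(2) by (simp add: geo_lang_def geo_struct_def)
    have s3: "map ?s xs \<in> tuples 3 (points d N)" using xs3 s by (auto simp: tuples_def[of 3])
    have "map \<alpha> xs = map A (map ?s xs)"
      using xs3 by (auto simp: eq compose_def tuples_def[of 3])
    then have "xs \<in> key_rel \<kappa> d N \<longleftrightarrow> map ?s xs \<in> key_rel \<kappa> d N"
      using key[OF \<alpha> xs3] key[OF A s3] by (simp only:)
    then show ?thesis by (simp add: Key geo_struct_def)
  next
    case (Prim j)
    then have j: "j < length \<Gamma>" using p by (auto simp: geo_lang_def)
    obtain n \<phi> where \<Gamma>j: "\<Gamma> ! j = (n, \<phi>)" by (cases "\<Gamma> ! j")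
    then have "(n, \<phi>) \<in> set \<Gamma>" using j nth_mem by metis
    then have \<phi>: "is_formula L (d * n) \<phi>" using \<Gamma> by (auto simp: is_geometry_def)
    have "xs \<in> tuples n (points d N)" using xs by (simp add: Prim geo_lang_def \<Gamma>j)
    moreover have "univ N \<noteq> {}" using univ_nonempty by (auto simp: univ_image funcset_UNIV_iff)
    ultimately show ?thesis
      using prim_rel_coordinatewise[OF \<sigma> fint_closed_N \<phi>] by (simp add: Prim geo_struct_def \<Gamma>j)
  qed
  ultimately show ?thesis by (simp add: Aut_def)
qed

text \<open>The matrix, its inverse and the translation vector are lifted entry by entry. The
  inverse is lifted too because its equations then certify almost all components as
  invertible.\<close>

lemma ex_lift_affine:
  assumes "A \<in> Aff d S"
  obtains B where "\<And>x. x \<in> UNIV \<rightarrow> points d M \<Longrightarrow> A (qpt x) = qpt (\<lambda>i. B i (x i))"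
    "\<And>i. B i \<in> extensional (points d M)" "\<And>i x. x \<in> points d M \<Longrightarrow> B i x \<in> points d M"
    "eventually (\<lambda>i. B i \<in> Aff d R) U"
proof -
  obtain C b where A: "A = affine_map d S C b" and C: "C \<in> GL d S" and b: "b \<in> points d N"
    using assms by (auto simp: Aff_def)
  then obtain C' where C': "is_matrix d S C" "is_matrix d S C'" "inverse_matrices d S C C'"
    by (auto simp: GL_def)
  have lift: "\<exists>X. \<forall>r<d. \<forall>s<d. X r s \<in> UNIV \<rightarrow> univ M \<and> q (X r s) = Y r s"
    if "is_matrix d S Y" for Y
  proof -
    have "\<exists>x. r < d \<longrightarrow> s < d \<longrightarrow> x \<in> UNIV \<rightarrow> univ M \<and> q x = Y r s" for r s
    proof (cases "r < d \<and> s < d")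
      case True
      then have "Y r s \<in> q ` (UNIV \<rightarrow> univ M)"
        using that by (simp add: is_matrix_def flip: univ_image)
      then show ?thesis by (elim imageE) (intro exI impI conjI, simp_all only:)
    qed auto
    then show ?thesis by metis
  qed
  obtain X where X: "\<And>r s. r < d \<Longrightarrow> s < d \<Longrightarrow> X r s \<in> UNIV \<rightarrow> univ M"
    "\<And>r s. r < d \<Longrightarrow> s < d \<Longrightarrow> q (X r s) = C r s" using lift[OF C'(1)] by blast
  obtain X' where X': "\<And>r s. r < d \<Longrightarrow> s < d \<Longrightarrow> X' r s \<in> UNIV \<rightarrow> univ M"
    "\<And>r s. r < d \<Longrightarrow> s < d \<Longrightarrow> q (X' r s) = C' r s" using lift[OF C'(2)] by blast
  obtain b' where b': "b' \<in> UNIV \<rightarrow> points d M" "qpt b' = b" using b unfolding points_N by blast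
  define B where "B = (\<lambda>i. affine_map d R (\<lambda>r s. X r s i) (b' i))"
  have Xi: "X r s i \<in> univ M" "X' r s i \<in> univ M" if "r < d" "s < d" for r s i
    using X(1)[OF that] X'(1)[OF that] by (simp_all add: funcset_UNIV_iff)
  have bi: "b' i \<in> points d M" for i using b'(1) by (simp add: funcset_UNIV_iff)
  have mclosed: "x \<otimes>\<^bsub>S\<^esub> y \<in> univ N" if "x \<in> univ N" "y \<in> univ N" for x y
    using that mult_q funcset_closed(2) unfolding univ_image by fastforce
  have sum_cong: "(\<Oplus>\<^bsub>S\<^esub>k\<in>{..<d}. f k \<otimes>\<^bsub>S\<^esub> g k) = (\<Oplus>\<^bsub>S\<^esub>k\<in>{..<d}. f' k \<otimes>\<^bsub>S\<^esub> g' k)"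
    if "\<And>k. k < d \<Longrightarrow> f k = f' k \<and> g k = g' k \<and> f' k \<in> univ N \<and> g' k \<in> univ N" for f g f' g'
    by (rule S.finsum_cong') (use that mclosed in auto)
  have Xq: "q (X r s) \<in> univ N" "q (X' r s) \<in> univ N" if "r < d" "s < d" for r s
    using q_closed[OF X(1)[OF that]] q_closed[OF X'(1)[OF that]] .
  have qX: "affine_map d S C b y = affine_map d S (\<lambda>r s. q (X r s)) (qpt b') y"
    if "y \<in> points d N" for y
  proof -
    have "(\<Oplus>\<^bsub>S\<^esub>j\<in>{..<d}. C r j \<otimes>\<^bsub>S\<^esub> y ! j) = (\<Oplus>\<^bsub>S\<^esub>j\<in>{..<d}. q (X r j) \<otimes>\<^bsub>S\<^esub> y ! j)" if "r < d" for r
      using X(2)[OF that] Xq(1)[OF that] tuples_nth[OF \<open>y \<in> points d N\<close>] by (intro sum_cong) simp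
    then show ?thesis using b'(2) that by (simp add: affine_map_def)
  qed
  show thesis
  proof (rule that)
    show "A (qpt x) = qpt (\<lambda>i. B i (x i))" if "x \<in> UNIV \<rightarrow> points d M" for x
    proof -
      have x: "qpt x \<in> points d N" unfolding points_N using that by (rule imageI)
      then show ?thesis
        unfolding A qX[OF x] B_def by (intro affine_map_q[OF X(1) b'(1) that])
    qed
    show "B i \<in> extensional (points d M)" for i by (simp add: B_def affine_map_def)
    show "B i x \<in> points d M" if "x \<in> points d M" for i x
      unfolding B_def by (rule affine_map_closed[OF Xi(1) bi that])
    \<comment> \<open>The lifts reproduce \<open>C\<close> and \<open>C'\<close> only at entries
      below \<open>d\<close>, so the matrix equations are transported sum by sum.\<close>
    have "inverse_matrices d S (\<lambda>r s. q (X r s)) (\<lambda>r s. q (X' r s))"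
    proof -
      have "(\<Oplus>\<^bsub>S\<^esub>k\<in>{..<d}. q (X r k) \<otimes>\<^bsub>S\<^esub> q (X' k s)) = (\<Oplus>\<^bsub>S\<^esub>k\<in>{..<d}. C r k \<otimes>\<^bsub>S\<^esub> C' k s)"
        "(\<Oplus>\<^bsub>S\<^esub>k\<in>{..<d}. q (X' r k) \<otimes>\<^bsub>S\<^esub> q (X k s)) = (\<Oplus>\<^bsub>S\<^esub>k\<in>{..<d}. C' r k \<otimes>\<^bsub>S\<^esub> C k s)"
        if "r < d" "s < d" for r s
        using that X(2) X'(2) Xq by (auto intro!: sum_cong simp flip: X(2) X'(2))
      then show ?thesis using C'(3) by (simp add: inverse_matrices_def)
    qed
    from eventually_inverse_matrices[OF X(1) X'(1) this]
    show "eventually (\<lambda>i. B i \<in> Aff d R) U"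
    proof (rule eventually_mono)
      fix i assume "inverse_matrices d R (\<lambda>r s. X r s i) (\<lambda>r s. X' r s i)"
      then have "(\<lambda>r s. X r s i) \<in> GL d R" using Xi
        by (auto simp: GL_def is_matrix_def intro!: exI[of _ "\<lambda>r s. X' r s i"])
      then show "B i \<in> Aff d R" using bi by (auto simp: B_def Aff_def)
    qed
  qed
qed

end

theorem theorem6p4:
  fixes L :: "('f fsym, 'p psym) lang"
    and \<F> :: "('f fsym, 'p psym, 'a) fostruct"
    and \<G> \<G>' :: "('f, 'p) geometry"
    and \<kappa> :: field_kind
    and d :: nat
  assumes "d \<ge> 2"
    and "expands \<kappa> L \<F>"
    and "is_geometry L d \<G>"
    and "is_geometry L d \<G>'"
    and "semilinearly_faithful TYPE('a set set) \<kappa> d \<G>' L \<F>"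
  shows "Conc \<kappa> d \<G> \<F> \<subseteq> Conc \<kappa> d \<G>' \<F> \<longleftrightarrow> AffAut \<kappa> d \<G>' \<F> \<subseteq> AffAut \<kappa> d \<G> \<F>"
proof
  have "univ \<F> \<noteq> {}" using expandsD(1)[OF assms(2)] by (simp add: is_structure_def)
  then obtain u where "u \<in> univ \<F>" by blast
  then have "replicate d u \<in> points d \<F>" by (auto simp: tuples_def)
  then have ne: "points d \<F> \<noteq> {}" by blast
  show "AffAut \<kappa> d \<G>' \<F> \<subseteq> AffAut \<kappa> d \<G> \<F>" if "Conc \<kappa> d \<G> \<F> \<subseteq> Conc \<kappa> d \<G>' \<F>"
    using ne that by (rule AffAut_mono_if_Conc_mono)
  assume aff: "AffAut \<kappa> d \<G>' \<F> \<subseteq> AffAut \<kappa> d \<G> \<F>"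
  show "Conc \<kappa> d \<G> \<F> \<subseteq> Conc \<kappa> d \<G>' \<F>"
  proof
    fix Q assume "Q \<in> Conc \<kappa> d \<G> \<F>"
    then obtain n \<psi> where n: "n \<ge> 1" and \<psi>: "is_formula (geo_lang \<G>) n \<psi>"
      and Q: "Q = defined_rel (geo_struct \<kappa> d \<G> \<F>) n \<psi>"
      by (auto simp: Conc_def definable_def)
    have "definable (geo_lang \<G>') (geo_struct \<kappa> d \<G>' \<F>) n Q"
    proof (rule ccontr)
      assume ndef: "\<not> ?thesis"
      have Qsub: "Q \<subseteq> tuples n (points d \<F>)" by (auto simp: Q defined_rel_def)
      obtain U :: "'a set set filter" and P aa bb where U: "is_ultrafilter U"
        and P: "P \<subseteq> (UNIV \<rightarrow> points d \<F>) \<times> (UNIV \<rightarrow> points d \<F>)"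
          "fst ` P = (UNIV \<rightarrow> points d \<F>)" "snd ` P = (UNIV \<rightarrow> points d \<F>)"
          "\<And>ps. ps \<in> lists P \<Longrightarrow> eventually (\<lambda>i. ef_equiv (geo_lang \<G>') (geo_struct \<kappa> d \<G>' \<F>) 0
            (map (\<lambda>p. fst p i) ps) (map (\<lambda>p. snd p i) ps)) U"
        and ab: "length aa = n" "length bb = n" "set (zip aa bb) \<subseteq> P"
        and aQ: "\<And>i. map (\<lambda>x. x i) aa \<in> Q" and bQ: "\<And>i. map (\<lambda>x. x i) bb \<in> tuples n (points d \<F>) - Q"
        by (rule ex_ultrafilter_correspondence_if_not_definable
            [of "geo_struct \<kappa> d \<G>' \<F>" "geo_lang \<G>'" Q n, unfolded univ_geo_struct],
            rule ne, rule finite_psyms_geo_lang, erule points_lepoll, rule Qsub, rule ndef, rule that)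
      let ?N = "ultrapower U \<F>" and ?q = "ult_class U (univ \<F>)"
      interpret base: ultra_map U L \<F> ?N ?q
        by (rule ultra_map_ultrapower[OF U expandsD(1)[OF assms(2)]])
      interpret uf: ultra_field U L \<F> ?N ?q \<kappa> d
        by unfold_locales (rule assms(2))
      interpret G: ultra_map U "geo_lang \<G>" "geo_struct \<kappa> d \<G> \<F>" "geo_struct \<kappa> d \<G> ?N" uf.qpt
        by (rule uf.ultra_map_geo_struct[OF assms(3)])
      interpret G': ultra_map U "geo_lang \<G>'" "geo_struct \<kappa> d \<G>' \<F>" "geo_struct \<kappa> d \<G>' ?N" uf.qpt
        by (rule uf.ultra_map_geo_struct[OF assms(4)])
      obtain \<alpha> where \<alpha>: "\<alpha> \<in> Aut (geo_lang \<G>') (geo_struct \<kappa> d \<G>' ?N)"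
        "\<And>a b. (a, b) \<in> P \<Longrightarrow> \<alpha> (uf.qpt a) = uf.qpt b"
        by (rule G'.ex_automorphism[of P, unfolded univ_geo_struct, OF fsyms_geo_lang P(1-3)],
            rule P(4), assumption, rule that)
      obtain A \<sigma> where A: "A \<in> AffAut \<kappa> d \<G>' ?N" and \<sigma>: "\<sigma> \<in> Aut L ?N"
        and \<alpha>_eq: "\<alpha> = compose (points d ?N) A (coordinatewise d ?N \<sigma>)"
        using assms(5) U \<alpha>(1) unfolding semilinearly_faithful_def by blast
      have A': "A \<in> Aut (geo_lang \<G>') (geo_struct \<kappa> d \<G>' ?N)" "A \<in> Aff d (field_reduct ?N)"
        using A by (simp_all add: AffAut_def)
      let ?s = "coordinatewise d ?N \<sigma>"
      have s: "?s \<in> Aut (geo_lang \<G>) (geo_struct \<kappa> d \<G> ?N)"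
        by (rule uf.coordinatewise_in_Aut[OF \<alpha>(1) A'(1) \<sigma> \<alpha>_eq assms(3)])
      \<comment> \<open>The inclusion \<open>aff\<close> concerns \<open>\<F>\<close> and not its
        ultrapower, so nothing is known about \<open>A\<close> and \<open>\<G>\<close> directly;
        \<open>A\<close> has to be split into components over \<open>\<F>\<close>.\<close>
      obtain B where B: "\<And>x. x \<in> UNIV \<rightarrow> points d \<F> \<Longrightarrow> A (uf.qpt x) = uf.qpt (\<lambda>i. B i (x i))"
        "\<And>i. B i \<in> extensional (points d \<F>)" "\<And>i x. x \<in> points d \<F> \<Longrightarrow> B i x \<in> points d \<F>"
        "eventually (\<lambda>i. B i \<in> Aff d (field_reduct \<F>)) U"
        by (rule uf.ex_lift_affine[OF A'(2)]) (rule that)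
      have BAut: "eventually (\<lambda>i. B i \<in> Aut (geo_lang \<G>') (geo_struct \<kappa> d \<G>' \<F>)) U"
        by (rule G'.eventually_automorphism[of A B, unfolded univ_geo_struct,
              OF fsyms_geo_lang finite_psyms_geo_lang A'(1) B(2,3,1)])
      have aD: "aa \<in> tuples n (UNIV \<rightarrow> points d \<F>)" and bD: "bb \<in> tuples n (UNIV \<rightarrow> points d \<F>)"
      proof -
        have "set aa = fst ` set (zip aa bb)" "set bb = snd ` set (zip aa bb)"
          using ab(1,2) by (simp_all flip: set_map)
        then have "set aa \<subseteq> fst ` P" "set bb \<subseteq> snd ` P" using image_mono[OF ab(3)] by metis+
        then show "aa \<in> tuples n (UNIV \<rightarrow> points d \<F>)" "bb \<in> tuples n (UNIV \<rightarrow> points d \<F>)"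
          unfolding P(2,3) using ab(1,2) by (simp_all add: tuples_def[of n])
      qed
      have neN: "points d ?N \<noteq> {}" using ne unfolding uf.points_N by (auto simp: funcset_UNIV_iff)
      \<comment> \<open>The intermediate tuple: \<open>?s\<close> keeps it inside the relation
        defined by \<open>\<psi>\<close>, while \<open>A\<close> sends it to the class of
        \<open>bb\<close>, whose components avoid \<open>Q\<close>.\<close>
      let ?Y = "map ?s (map uf.qpt aa)"
      have "map uf.qpt aa \<in> defined_rel (geo_struct \<kappa> d \<G> ?N) n \<psi>"
        using G.defined_rel_q[of n \<psi> aa] \<psi> aD aQ by (simp add: Q)
      then have Y: "?Y \<in> defined_rel (geo_struct \<kappa> d \<G> ?N) n \<psi>"
        using defined_rel_automorphism[OF s _ \<psi>, of "map uf.qpt aa"] neN uf.map_qpt_in_tuples[OF aD]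
        by simp
      then have "?Y \<in> tuples n (univ (geo_struct \<kappa> d \<G> ?N))" by (simp add: defined_rel_def)
      then obtain ys where ys: "ys \<in> tuples n (UNIV \<rightarrow> points d \<F>)" "map uf.qpt ys = ?Y"
        using G.ex_lift_tuple by (metis univ_geo_struct)
      have evY: "eventually (\<lambda>i. map (\<lambda>x. x i) ys \<in> Q) U"
        using Y G.defined_rel_q[of n \<psi> ys] \<psi> ys by (simp add: Q)
      let ?zs = "map (\<lambda>x i. B i (x i)) ys"
      have "map uf.qpt bb = map \<alpha> (map uf.qpt aa)"
      proof (rule nth_equalityI)
        fix j assume "j < length (map uf.qpt bb)"
        then have "(aa ! j, bb ! j) \<in> set (zip aa bb)" "j < n" using ab(1,2) by (auto simp: in_set_zip)
        then have "(aa ! j, bb ! j) \<in> P" "j < n" using ab(3) by auto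
        then show "map uf.qpt bb ! j = map \<alpha> (map uf.qpt aa) ! j" using \<alpha>(2) ab by simp
      qed (simp add: ab)
      also have "\<dots> = map A ?Y"
        using uf.map_qpt_in_tuples[OF aD] by (auto simp: \<alpha>_eq compose_def tuples_def[of n])
      also have "\<dots> = map A (map uf.qpt ys)" by (simp only: ys(2))
      also have "\<dots> = map uf.qpt ?zs"
        using ys(1) B(1) by (auto simp: tuples_def[of n])
      finally have bz: "map uf.qpt bb = map uf.qpt ?zs" .
      have "?zs \<in> tuples n (UNIV \<rightarrow> points d \<F>)"
        using ys(1) B(3) by (auto simp: tuples_def[of n] funcset_UNIV_iff)
      then have "length bb = length ?zs" "set bb \<subseteq> UNIV \<rightarrow> points d \<F>" "set ?zs \<subseteq> UNIV \<rightarrow> points d \<F>"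
        using bD by (simp_all add: tuples_def[of n])
      from iffD1[OF map_eq_iff_eventually[OF uf.qpt_eq_iff this] bz]
      have "eventually (\<lambda>i. map (\<lambda>x. x i) bb = map (\<lambda>x. x i) ?zs) U" .
      \<comment> \<open>At a common index \<open>B i\<close> is an affine automorphism of
        \<open>\<G>'\<close>, hence of \<open>\<G>\<close>, and yet maps a tuple of \<open>Q\<close>
        to a tuple outside \<open>Q\<close>.\<close>
      with BAut B(4) evY have "eventually (\<lambda>i. False) U"
      proof eventually_elim
        case (elim i)
        then have "B i \<in> Aut (geo_lang \<G>) (geo_struct \<kappa> d \<G> \<F>)" 
          using aff by (auto simp: AffAut_def)
        then have "map (B i) (map (\<lambda>x. x i) ys) \<in> Q"
          unfolding Q
          using defined_rel_automorphism[of "B i" "geo_lang \<G>" "geo_struct \<kappa> d \<G> \<F>" n \<psi>]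
            elim(3) \<psi> ne by (simp add: Q defined_rel_def del: map_map)
        then show False using elim bQ[of i] by (simp add: comp_def)
      qed
      then show False using base.U_not_bot by (simp add: trivial_limit_def)
    qed
    then show "Q \<in> Conc \<kappa> d \<G>' \<F>" using n by (auto simp: Conc_def)
  qed
qed

end
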